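(* Let $\psi:\mathbb{N}\to\mathbb{R}^+$ be a function with $$\psi(q)=O\left(\frac{1}{q\log q\,(\log\log q)^{3}}\right).$$ Let $\gamma,\beta$ be irrational real numbers such that $\sigma_{(\gamma,\beta)}(q)=O\big((\log\log\log q)^{1/2}\big)$. Then there is a number $c>0$ such that the following holds. Let $\omega:\mathbb{N}\to\mathbb{R}$ be the function $$\omega(q)=\begin{cases}1 & \text{if } \log\log q\le 1 \ (\text{i.e. } q\le 4),\\ c/(\log\log\log q)^{1/2} & \text{if }\log\log q>1\ (\text{i.e. } q\ge 5).\end{cases}$$ Let $\gamma'$ be a real number. If $$\sum_{\substack{q\in\mathbb{N}\\ \|q\beta-\gamma'\|\in[q^{-\omega(q)},1)}}\frac{\psi(q)}{\|q\beta-\gamma'\|}=\infty,$$ then $|W(\psi,\beta,\gamma,\gamma')|=1$.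
   Context: $\mathbb{N}=\{1,2,3,\dots\}$ and $\mathbb{R}^+=(0,\infty)$. For real $x$, $\|x\|$ is the distance from $x$ to the nearest integer. $|A|$ denotes the Lebesgue measure of a measurable set $A\subset\mathbb{R}$. $\log$ is the base $2$ logarithm. The bound $f(q)=O(g(q))$ means that there is a constant $C>0$ with $f(q)\le Cg(q)$ for all $q$ for which $g(q)$ is defined and positive ($q\ge3$ for expressions in $\log\log q$, $q\ge 5$ for expressions in $\log\log\log q$). For $\psi:\mathbb{N}\to\mathbb{R}^+$ and real numbers $\beta,\gamma,\gamma'$, $$W(\psi,\beta,\gamma,\gamma')=\{x\in[0,1]:\ \|qx-\gamma\|\,\|q\beta-\gamma'\|<\psi(q)\text{ for infinitely many } q\in\mathbb{N}\}.$$ For real numbers $\gamma,\beta$ and an integer $N\ge2$, $\sigma_{(\gamma,\beta)}(N)\in[0,\infty]$ is the infimum of all $\sigma>0$ such that $$\|k_1\gamma+k_2\beta\|\ge\max\{|k_1|,|k_2|\}^{-\sigma}$$ for all integers $k_1,k_2$ with $2\le\max\{|k_1|,|k_2|\}\le N$ (the infimum of the empty set being $\infty$). *)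

theory Defs
  imports "HOL-Analysis.Analysis"
begin

definition dist_nint :: "real \<Rightarrow> real" where
  "dist_nint x = \<bar>x - of_int (round x)\<bar>"

(* Functions on the positive integers are functions on nat whose value at 0 is ignored. *)

definition W_set :: "(nat \<Rightarrow> real) \<Rightarrow> real \<Rightarrow> real \<Rightarrow> real \<Rightarrow> real set" where
  "W_set \<psi> \<beta> \<gamma> \<gamma>' =
     {x \<in> {0..1}. infinite {q::nat. q \<ge> 1 \<and>
        dist_nint (real q * x - \<gamma>) * dist_nint (real q * \<beta> - \<gamma>') < \<psi> q}}"

(* Inf {} = \<infinity> in ennreal. *)

definition sigma_exp :: "real \<Rightarrow> real \<Rightarrow> nat \<Rightarrow> ennreal" where
  "sigma_exp \<gamma> \<beta> N =
     Inf {ennreal \<sigma> | \<sigma>::real. \<sigma> > 0 \<and>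
       (\<forall>k1 k2 :: int. 2 \<le> max \<bar>k1\<bar> \<bar>k2\<bar> \<and> max \<bar>k1\<bar> \<bar>k2\<bar> \<le> int N \<longrightarrow>
          dist_nint (of_int k1 * \<gamma> + of_int k2 * \<beta>) \<ge> of_int (max \<bar>k1\<bar> \<bar>k2\<bar>) powr (- \<sigma>))}"

(* At q = 1, where log log q is not defined, log 2 (log 2 1) = log 2 0 = 0 in Isabelle,
   so the first branch is taken exactly for q \<le> 4. *)

definition omega_fun :: "real \<Rightarrow> nat \<Rightarrow> real" where
  "omega_fun c q =
     (if log 2 (log 2 (real q)) \<le> 1 then 1 else c / sqrt (log 2 (log 2 (log 2 (real q)))))"

end

theory Submission
  imports Defs "HOL-Probability.Probability" "HOL-Number_Theory.Cong" "HOL-Real_Asymp.Real_Asymp"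
begin

text \<open>
  Write \<open>\<delta> q = \<psi> q / \<parallel>q \<beta> - \<gamma>'\<parallel>\<close> and \<open>A q = {x. \<parallel>q x - \<gamma>\<parallel> < \<delta> q}\<close>, restricted to those \<open>q\<close> that occur in
  the divergent series. For \<open>g = gcd q r\<close> the intersection of \<open>A q\<close> and \<open>A r\<close> has measure at most
  \<open>4 \<delta> q \<delta> r + 2 g min (\<delta> q / q) (\<delta> r / r)\<close>, and it is empty unless
  \<open>\<parallel>(r/g - q/g) \<gamma>\<parallel> < (r/g) \<delta> q + (q/g) \<delta> r\<close>. The main term has the constant of exact independence, so by
  Chebyshev's inequality it suffices that, for fixed \<open>q\<close>, the second terms sum to \<open>O(\<delta> q)\<close> over the
  \<open>r < q\<close> that satisfy this condition.

  Put \<open>q = z powr (32 s\<^sup>3)\<close>, where \<open>s\<close> is of order \<open>sqrt (log log log q)\<close>, and \<open>t = z powr s\<^sup>2\<close>; then \<open>z\<close> exceeds the number of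
  divisors of \<open>q\<close> and any fixed power of \<open>log q\<close>, and \<open>\<parallel>r \<beta> - \<gamma>'\<parallel> \<ge> 1 / t\<close> when \<open>r \<ge> sqrt q\<close>. The \<open>r \<le> q / t\<^sup>2\<close> contribute little by
  counting multiples of each divisor. If \<open>g > t\<^sup>8\<close>, the Diophantine condition on \<open>\<gamma>\<close> makes the condition on \<open>r\<close> rare enough to
  absorb the number of divisors. If \<open>g \<le> t\<^sup>8\<close>, the points \<open>(n \<gamma>, n g \<beta>)\<close> are equidistributed at the
  relevant scale up to a constant, by Fejer kernels and the Diophantine condition on \<open>(\<gamma>, \<beta>)\<close>. A dyadic
  decomposition of \<open>r = g n\<close> then gives \<open>O((1 + log g + log log log q) / (g (log log q)\<^sup>3))\<close>, and the sum over \<open>g\<close>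
  is bounded because \<open>\<Sum>g | q. 1 / g\<close> and \<open>\<Sum>g | q. log g / g\<close> are \<open>O((log log q)\<^sup>2)\<close> and \<open>O((log log q)\<^sup>3)\<close>.
\<close>

section \<open>Fejer kernels and points in boxes\<close>

lemma dist_nint_le: "dist_nint x \<le> \<bar>x - of_int n\<bar>"
  unfolding dist_nint_def by (rule round_diff_minimal)

lemma dist_nint_nonneg [simp]: "0 \<le> dist_nint x"
  by (simp add: dist_nint_def)

lemma dist_nint_le_half: "dist_nint x \<le> 1/2"
  using of_int_round_abs_le[of x] by (simp add: dist_nint_def abs_minus_commute)

lemma dist_nint_ex: "\<exists>n::int. dist_nint x = \<bar>x - of_int n\<bar>"
  unfolding dist_nint_def by blast

lemma dist_nint_add_int [simp]: "dist_nint (x + of_int n) = dist_nint x"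
proof (rule antisym)
  obtain m where "dist_nint x = \<bar>x - of_int m\<bar>" using dist_nint_ex by blast
  then show "dist_nint (x + of_int n) \<le> dist_nint x"
    using dist_nint_le[of "x + of_int n" "m + n"] by simp
  obtain k where "dist_nint (x + of_int n) = \<bar>x + of_int n - of_int k\<bar>" using dist_nint_ex by blast
  then show "dist_nint x \<le> dist_nint (x + of_int n)"
    using dist_nint_le[of x "k - n"] by (simp add: algebra_simps)
qed

lemma dist_nint_add_nat [simp]: "dist_nint (x + of_nat n) = dist_nint x"
  using dist_nint_add_int[of x "int n"] by simp

lemma dist_nint_mult_int: "dist_nint (of_int k * x) \<le> \<bar>of_int k\<bar> * dist_nint x"
proof -
  obtain m where m: "dist_nint x = \<bar>x - of_int m\<bar>" using dist_nint_ex by blast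
  have "dist_nint (of_int k * x) \<le> \<bar>of_int k * x - of_int (k * m)\<bar>" by (rule dist_nint_le)
  also have "\<dots> = \<bar>of_int k\<bar> * dist_nint x" by (simp add: m abs_mult[symmetric] algebra_simps)
  finally show ?thesis .
qed

lemma borel_measurable_dist_nint [measurable]: "dist_nint \<in> borel_measurable borel"
  unfolding dist_nint_def[abs_def] round_def by measurable

section \<open>Additive characters, exponential sums and Fejer kernels\<close>

definition unit_exp :: "real \<Rightarrow> complex" where
  "unit_exp x = cis (2 * pi * x)"

lemma unit_exp_add: "unit_exp (x + y) = unit_exp x * unit_exp y"
  by (simp add: unit_exp_def cis_mult distrib_left)

lemma unit_exp_mult_nat: "unit_exp (of_nat n * x) = unit_exp x ^ n"
  unfolding unit_exp_def Complex.DeMoivre by (simp add: mult_ac)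

lemma norm_unit_exp [simp]: "norm (unit_exp x) = 1"
  by (simp add: unit_exp_def)

lemma unit_exp_int: "unit_exp (of_int n) = 1"
  unfolding unit_exp_def by (rule cis_multiple_2pi) simp

lemma unit_exp_neg: "unit_exp (- x) = cnj (unit_exp x)"
  by (simp add: unit_exp_def cis_cnj)

text \<open>With \<open>y\<close> the signed distance from \<open>x\<close> to the nearest integer,
  the norm equals \<open>2 * \<bar>sin (pi * y)\<bar>\<close>, and the sine is at least half its
  argument on \<open>[0, pi / 2]\<close>. The constant \<open>pi\<close> gained this way is given
  away.\<close>

lemma norm_unit_exp_minus_one_ge: "dist_nint x \<le> norm (unit_exp x - 1)"
proof -
  define y where "y = x - of_int (round x)"
  define t where "t = pi * \<bar>y\<bar>"
  have y: "\<bar>y\<bar> \<le> 1/2"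
    using dist_nint_le_half[of x] by (simp add: y_def dist_nint_def)
  have t: "0 \<le> t" "t \<le> pi / 2" using y by (auto simp: t_def)
  have "unit_exp x = unit_exp y * unit_exp (of_int (round x))"
    by (simp add: y_def flip: unit_exp_add)
  then have "unit_exp x = cis (2 * (pi * y))" by (simp add: unit_exp_int) (simp add: unit_exp_def mult.assoc)
  moreover have "(norm (cis (2 * (pi * y)) - 1))\<^sup>2 = (2 * sin (pi * y))\<^sup>2"
    unfolding cmod_power2 by (simp add: cos_double_sin sin_double power_mult_distrib)
      (use sin_cos_squared_add[of "pi * y"] in algebra)
  ultimately have *: "norm (unit_exp x - 1) = \<bar>2 * sin (pi * y)\<bar>"
    by (metis abs_norm_cancel real_sqrt_abs)
  have "\<bar>sin t - t\<bar> \<le> t ^ 3 / 6"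
    using Maclaurin_sin_bound[of t 3] t
    by (simp add: sin_coeff_def eval_nat_numeral field_simps)
  \<comment> \<open>Since \<open>pi / 2 < 1.7\<close> and \<open>1.7 * 1.7 < 3\<close>, the cubic
    Taylor error takes away at most half of \<open>t\<close>.\<close>
  moreover have "t ^ 3 \<le> 3 * t"
  proof -
    have "t \<le> 1.7" using t pi_less_4 pi_approx by simp
    then have "t * t \<le> 1.7 * 1.7" using t by (intro mult_mono) auto
    then have "t * t \<le> 3" by simp
    from mult_right_mono[OF this t(1)] show ?thesis by (simp add: eval_nat_numeral)
  qed
  ultimately have "sin t \<ge> t / 2" by linarith
  moreover have "t \<ge> \<bar>y\<bar>" unfolding t_def using pi_gt3 mult_right_mono[of 1 pi "\<bar>y\<bar>"] by simp
  moreover have "\<bar>sin (pi * y)\<bar> = \<bar>sin t\<bar>" by (cases "y \<ge> 0") (auto simp: t_def)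
  ultimately have "\<bar>2 * sin (pi * y)\<bar> \<ge> \<bar>y\<bar>" by linarith
  then show ?thesis using * by (simp add: y_def dist_nint_def)
qed

text \<open>A geometric sum whose numerator has norm at most 2 for every \<open>N\<close>. Lower
  bounds for \<open>dist_nint\<close> thus become cancellation, uniformly in the number of
  terms.\<close>

lemma norm_sum_unit_exp_le:
  assumes "dist_nint x > 0"
  shows "norm (\<Sum>n<N. unit_exp (of_nat n * x)) \<le> 2 / dist_nint x"
proof -
  have ne: "unit_exp x \<noteq> 1" using norm_unit_exp_minus_one_ge[of x] assms by auto
  have "(\<Sum>n<N. unit_exp (of_nat n * x)) = (\<Sum>n<N. unit_exp x ^ n)" by (simp add: unit_exp_mult_nat)
  also have "\<dots> = (unit_exp x ^ N - 1) / (unit_exp x - 1)" by (rule geometric_sum[OF ne])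
  also have "norm \<dots> = norm (unit_exp x ^ N - 1) / norm (unit_exp x - 1)" by (rule norm_divide)
  also have "\<dots> \<le> 2 / norm (unit_exp x - 1)"
    using norm_triangle_ineq4[of "unit_exp x ^ N" 1] by (intro divide_right_mono) (auto simp: norm_power)
  also have "\<dots> \<le> 2 / dist_nint x"
    using assms norm_unit_exp_minus_one_ge[of x] ne by (intro divide_left_mono mult_pos_pos) auto
  finally show ?thesis .
qed

text \<open>The Fejer kernel, for \<open>K > 0\<close> normalised to mean value 1 over a period.
  Being nonnegative, it majorises \<open>K / 4\<close> times the indicator of a neighbourhood of the
  integers.\<close>

definition fejer :: "nat \<Rightarrow> real \<Rightarrow> real" where
  "fejer K x = (norm (\<Sum>k<K. unit_exp (of_nat k * x)))\<^sup>2 / K"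

lemma fejer_nonneg [simp]: "0 \<le> fejer K x"
  by (simp add: fejer_def)

lemma complex_of_real_fejer:
  "complex_of_real (fejer K x) =
     (\<Sum>a<K. \<Sum>b<K. unit_exp (of_int (int a - int b) * x)) / of_nat K"
proof -
  let ?S = "\<Sum>k<K. unit_exp (of_nat k * x)"
  have "complex_of_real ((norm ?S)\<^sup>2) = ?S * cnj ?S" by (rule complex_norm_square)
  also have "\<dots> = (\<Sum>a<K. \<Sum>b<K. unit_exp (of_nat a * x) * cnj (unit_exp (of_nat b * x)))"
    by (simp add: sum_product)
  also have "\<dots> = (\<Sum>a<K. \<Sum>b<K. unit_exp (of_int (int a - int b) * x))"
    by (intro sum.cong refl) (simp add: algebra_simps flip: unit_exp_neg unit_exp_add)
  finally show ?thesis by (simp add: fejer_def)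
qed

text \<open>For \<open>k < K\<close> the angle \<open>2 * pi * k * y\<close> stays within
  \<open>pi / 4\<close>, where the cosine is at least 1/2, so the sum has norm at least
  \<open>K / 2\<close>. The kernel with \<open>K = 1\<close> is the constant 1 and serves
  neighbourhoods too wide to impose a condition.\<close>

lemma fejer_ge:
  assumes "K > 0" "K = 1 \<or> dist_nint x \<le> 1 / (8 * real K)"
  shows "K / 4 \<le> fejer K x"
proof (cases "K = 1")
  case True
  then show ?thesis by (simp add: fejer_def)
next
  case False
  define y where "y = x - of_int (round x)"
  have y: "\<bar>y\<bar> \<le> 1 / (8 * real K)" using assms False by (auto simp: y_def dist_nint_def)
  have e: "unit_exp (of_nat k * x) = unit_exp (of_nat k * y)" for k
  proof -
    have "unit_exp x = unit_exp y * unit_exp (of_int (round x))"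
      by (simp add: y_def flip: unit_exp_add)
    then show ?thesis by (simp add: unit_exp_mult_nat unit_exp_int)
  qed
  have "1/2 \<le> Re (unit_exp (of_nat k * y))" if "k < K" for k
  proof -
    have "\<bar>real k * y\<bar> \<le> real K * (1 / (8 * real K))"
      unfolding abs_mult using that y by (intro mult_mono) auto
    then have "\<bar>real k * y\<bar> \<le> 1/8" using assms by simp
    then have le: "2 * pi * \<bar>real k * y\<bar> \<le> 2 * pi * (1/8)" by (intro mult_left_mono) auto
    then have "cos (pi / 3) \<le> cos (2 * pi * \<bar>real k * y\<bar>)"
      by (intro cos_monotone_0_pi_le) auto
    then show ?thesis by (cases "y \<ge> 0") (auto simp: unit_exp_def cos_60 abs_mult)
  qed
  then have "(\<Sum>k<K. 1/2) \<le> (\<Sum>k<K. Re (unit_exp (of_nat k * y)))" by (intro sum_mono) auto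
  also have "\<dots> = Re (\<Sum>k<K. unit_exp (of_nat k * x))" by (simp add: e)
  also have "\<dots> \<le> norm (\<Sum>k<K. unit_exp (of_nat k * x))" by (rule complex_Re_le_cmod)
  finally have "real K / 2 \<le> norm (\<Sum>k<K. unit_exp (of_nat k * x))" by simp
  then have "(real K / 2)\<^sup>2 \<le> (norm (\<Sum>k<K. unit_exp (of_nat k * x)))\<^sup>2" by (intro power_mono) auto
  then have "(real K / 2)\<^sup>2 / K \<le> fejer K x" unfolding fejer_def by (intro divide_right_mono) auto
  moreover have "(real K / 2)\<^sup>2 / K = K / 4" by (simp add: power2_eq_square)
  ultimately show ?thesis by simp
qed

text \<open>Expanding both kernels gives \<open>(K1 * K2)\<^sup>2\<close> character sums over
  \<open>n\<close>. The \<open>K1 * K2\<close> diagonal ones equal \<open>N\<close>, the others are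
  at most \<open>2 * D\<close> in norm, and the normalisation divides by
  \<open>K1 * K2\<close>.\<close>

lemma sum_fejer_product_le:
  fixes \<alpha>1 \<alpha>2 c1 c2 D :: real and K1 K2 N :: nat
  assumes "K1 > 0" "K2 > 0"
    and D: "\<And>k1 k2 :: int. (k1, k2) \<noteq> (0, 0) \<Longrightarrow> \<bar>k1\<bar> < int K1 \<Longrightarrow> \<bar>k2\<bar> < int K2 \<Longrightarrow>
       dist_nint (of_int k1 * \<alpha>1 + of_int k2 * \<alpha>2) > 0 \<and> 1 / dist_nint (of_int k1 * \<alpha>1 + of_int k2 * \<alpha>2) \<le> D"
    and "D \<ge> 0"
  shows "(\<Sum>n<N. fejer K1 (real n * \<alpha>1 + c1) * fejer K2 (real n * \<alpha>2 + c2)) \<le> N + 2 * D * K1 * K2"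
proof -
  let ?I = "({..<K1} \<times> {..<K1}) \<times> ({..<K2} \<times> {..<K2})"
  define t where "t = (\<lambda>((a, b), (c, d)). unit_exp (of_int (int a - int b) * c1 + of_int (int c - int d) * c2)
     * (\<Sum>n<N. unit_exp (of_nat n * (of_int (int a - int b) * \<alpha>1 + of_int (int c - int d) * \<alpha>2))))"
  define S where "S = (\<Sum>n<N. fejer K1 (real n * \<alpha>1 + c1) * fejer K2 (real n * \<alpha>2 + c2))"
  have "complex_of_real S = (\<Sum>n<N. (\<Sum>((a, b), (c, d))\<in>?I.
       unit_exp (of_int (int a - int b) * (real n * \<alpha>1 + c1)) * unit_exp (of_int (int c - int d) * (real n * \<alpha>2 + c2)))
         / (of_nat K1 * of_nat K2))"
    unfolding S_def of_real_sum of_real_mult complex_of_real_fejer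
    by (intro sum.cong refl) (simp add: sum_product sum.cartesian_product split_def)
  also have "\<dots> = (\<Sum>n<N. \<Sum>((a, b), (c, d))\<in>?I.
       unit_exp (of_int (int a - int b) * (real n * \<alpha>1 + c1)) * unit_exp (of_int (int c - int d) * (real n * \<alpha>2 + c2)))
         / (of_nat K1 * of_nat K2)"
    by (rule sum_divide_distrib[symmetric])
  also have "(\<Sum>n<N. \<Sum>((a, b), (c, d))\<in>?I.
       unit_exp (of_int (int a - int b) * (real n * \<alpha>1 + c1)) * unit_exp (of_int (int c - int d) * (real n * \<alpha>2 + c2)))
     = (\<Sum>x\<in>?I. t x)"
    unfolding t_def by (subst sum.swap) (auto simp: sum_distrib_left algebra_simps simp flip: unit_exp_add intro!: sum.cong)
  finally have eq: "complex_of_real S = (\<Sum>x\<in>?I. t x) / (of_nat K1 * of_nat K2)" .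
  have tb: "norm (t ((a, b), (c, d))) \<le> (if a = b \<and> c = d then real N else 0) + 2 * D"
    if "a < K1" "b < K1" "c < K2" "d < K2" for a b c d
  proof (cases "a = b \<and> c = d")
    case True
    then show ?thesis using \<open>D \<ge> 0\<close> by (simp add: t_def unit_exp_def norm_mult)
  next
    case False
    let ?x = "of_int (int a - int b) * \<alpha>1 + of_int (int c - int d) * \<alpha>2"
    have "dist_nint ?x > 0 \<and> 1 / dist_nint ?x \<le> D" using False that by (intro D) auto
    moreover from this have "norm (t ((a, b), (c, d))) \<le> 2 / dist_nint ?x"
      using norm_sum_unit_exp_le[of ?x N] by (simp add: t_def norm_mult)
    ultimately show ?thesis using False by auto
  qed
  have "S \<le> norm (complex_of_real S)" by simp
  also have "\<dots> \<le> (\<Sum>x\<in>?I. norm (t x)) / (K1 * K2)"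
    unfolding eq norm_divide norm_mult by (simp add: divide_right_mono norm_sum)
  also have "(\<Sum>x\<in>?I. norm (t x)) \<le> (\<Sum>((a, b), (c, d))\<in>?I. (if a = b \<and> c = d then real N else 0) + 2 * D)"
    using tb by (intro sum_mono) auto
  also have "\<dots> = K1 * K2 * N + 2 * D * K1 * K1 * K2 * K2"
  proof -
    have "(\<Sum>((a, b), (c, d))\<in>?I. if a = b \<and> c = d then real N else 0)
       = (\<Sum>a<K1. \<Sum>b<K1. \<Sum>c<K2. \<Sum>d<K2. if a = b then (if c = d then real N else 0) else 0)"
      unfolding sum.cartesian_product' prod.case by (intro sum.cong refl) auto
    also have "\<dots> = (\<Sum>a<K1. \<Sum>b<K1. if a = b then real K2 * N else 0)"
      by (intro sum.cong refl) auto
    also have "\<dots> = K1 * K2 * N" by simp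
    finally show ?thesis by (simp add: split_def sum.distrib)
  qed
  finally have "S \<le> (K1 * K2 * N + 2 * D * K1 * K1 * K2 * K2) / (K1 * K2)" by (simp add: divide_right_mono)
  also have "\<dots> = N + 2 * D * K1 * K2" using assms(1,2) by (simp add: field_simps)
  finally show ?thesis by (simp add: S_def)
qed

text \<open>Each point of the box has weight at least \<open>K1 * K2 / 16\<close> in a product of
  Fejer kernels of lengths about \<open>1 / (8 * \<epsilon>)\<close>. With
  \<open>1 / K \<le> 16 * \<epsilon>\<close> in each coordinate this gives the constants
  \<open>4096 = 16 ^ 3\<close> and \<open>32 = 16 * 2\<close>.\<close>

lemma card_box_le:
  fixes \<alpha>1 \<alpha>2 c1 c2 D \<epsilon>1 \<epsilon>2 :: real and M N :: nat
  assumes \<epsilon>: "\<epsilon>1 > 0" "\<epsilon>2 > 0"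
    and D: "\<And>k1 k2 :: int. (k1, k2) \<noteq> (0, 0) \<Longrightarrow> of_int \<bar>k1\<bar> \<le> 1 / \<epsilon>1 \<Longrightarrow> of_int \<bar>k2\<bar> \<le> 1 / \<epsilon>2 \<Longrightarrow>
       dist_nint (of_int k1 * \<alpha>1 + of_int k2 * \<alpha>2) > 0 \<and> 1 / dist_nint (of_int k1 * \<alpha>1 + of_int k2 * \<alpha>2) \<le> D"
    and "D \<ge> 0"
  shows "card {n \<in> {M..<M+N}. dist_nint (real n * \<alpha>1 + c1) \<le> \<epsilon>1 \<and> dist_nint (real n * \<alpha>2 + c2) \<le> \<epsilon>2}
    \<le> 4096 * real N * \<epsilon>1 * \<epsilon>2 + 32 * D"
proof -
  \<comment> \<open>Beyond 1/8 the coordinate imposes no condition: the kernel of length 1 is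
    constant and has only the frequency 0, which satisfies any bound
    \<open>1 / \<epsilon>\<close>.\<close>
  define kk :: "real \<Rightarrow> nat" where "kk \<epsilon> = (if \<epsilon> \<le> 1/8 then nat \<lfloor>1 / (8 * \<epsilon>)\<rfloor> else 1)" for \<epsilon>
  have kk: "kk \<epsilon> > 0 \<and> 1 / kk \<epsilon> \<le> 16 * \<epsilon> \<and> (kk \<epsilon> = 1 \<or> (\<epsilon> \<le> 1 / (8 * kk \<epsilon>) \<and> kk \<epsilon> \<le> 1 / \<epsilon>))" if "\<epsilon> > 0" for \<epsilon>
  proof (cases "\<epsilon> \<le> 1/8")
    case True
    let ?y = "1 / (8 * \<epsilon>)"
    have y: "?y \<ge> 1" using True that by (simp add: field_simps)
    have f: "of_int \<lfloor>?y\<rfloor> \<le> ?y" "?y < of_int \<lfloor>?y\<rfloor> + 1" "\<lfloor>?y\<rfloor> \<ge> 1"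
      using y by (auto simp: le_floor_iff)
    have k: "real (kk \<epsilon>) = of_int \<lfloor>?y\<rfloor>" using True f(3) unfolding kk_def by (simp only: if_True)
    have k1: "real (kk \<epsilon>) \<ge> 1" using f k by simp
    have "?y \<le> 2 * kk \<epsilon>" using f k k1 by linarith
    then have "1 / kk \<epsilon> \<le> 16 * \<epsilon>" using that k1 by (simp add: field_simps)
    moreover have le: "kk \<epsilon> \<le> ?y" using f k by simp
    moreover have "?y \<le> 1 / \<epsilon>" using that by (simp add: field_simps)
    moreover have "\<epsilon> \<le> 1 / (8 * kk \<epsilon>)" using le that k1 by (simp add: field_simps)
    moreover have "kk \<epsilon> > 0" using k1 by linarith
    ultimately show ?thesis by linarith
  next
    case False
    then show ?thesis by (auto simp: kk_def)
  qed
  define K1 where "K1 = kk \<epsilon>1"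
  define K2 where "K2 = kk \<epsilon>2"
  have K1: "K1 > 0" "1 / K1 \<le> 16 * \<epsilon>1" "K1 = 1 \<or> (\<epsilon>1 \<le> 1 / (8 * K1) \<and> K1 \<le> 1 / \<epsilon>1)"
    using kk[OF \<epsilon>(1)] by (auto simp: K1_def)
  have K2: "K2 > 0" "1 / K2 \<le> 16 * \<epsilon>2" "K2 = 1 \<or> (\<epsilon>2 \<le> 1 / (8 * K2) \<and> K2 \<le> 1 / \<epsilon>2)"
    using kk[OF \<epsilon>(2)] by (auto simp: K2_def)
  \<comment> \<open>The starting point \<open>M\<close> of the block moves into the phases, which
    are arbitrary in \<open>sum_fejer_product_le\<close>.\<close>
  let ?d1 = "c1 + M * \<alpha>1" and ?d2 = "c2 + M * \<alpha>2"
  define A where "A = {n \<in> {..<N}. dist_nint (real n * \<alpha>1 + ?d1) \<le> \<epsilon>1 \<and> dist_nint (real n * \<alpha>2 + ?d2) \<le> \<epsilon>2}"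
  have "{n \<in> {M..<M+N}. dist_nint (real n * \<alpha>1 + c1) \<le> \<epsilon>1 \<and> dist_nint (real n * \<alpha>2 + c2) \<le> \<epsilon>2} = (\<lambda>n. n + M) ` A"
  proof (intro equalityI subsetI)
    fix n assume n: "n \<in> {n \<in> {M..<M+N}. dist_nint (real n * \<alpha>1 + c1) \<le> \<epsilon>1 \<and> dist_nint (real n * \<alpha>2 + c2) \<le> \<epsilon>2}"
    then have "n - M \<in> A" by (auto simp: A_def of_nat_diff algebra_simps)
    then show "n \<in> (\<lambda>n. n + M) ` A" using n by (intro image_eqI[of _ _ "n - M"]) auto
  qed (auto simp: A_def algebra_simps)
  then have card: "card {n \<in> {M..<M+N}. dist_nint (real n * \<alpha>1 + c1) \<le> \<epsilon>1 \<and> dist_nint (real n * \<alpha>2 + c2) \<le> \<epsilon>2} = card A"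
    by (simp add: card_image)
  have "(\<Sum>n\<in>A. real K1 / 4 * (real K2 / 4)) \<le> (\<Sum>n\<in>A. fejer K1 (real n * \<alpha>1 + ?d1) * fejer K2 (real n * \<alpha>2 + ?d2))"
  proof (intro sum_mono mult_mono)
    fix n assume n: "n \<in> A"
    have "K1 = 1 \<or> dist_nint (real n * \<alpha>1 + ?d1) \<le> 1 / (8 * real K1)"
      using n K1 by (auto simp: A_def)
    then show "real K1 / 4 \<le> fejer K1 (real n * \<alpha>1 + ?d1)" using K1 by (intro fejer_ge) auto
    have "K2 = 1 \<or> dist_nint (real n * \<alpha>2 + ?d2) \<le> 1 / (8 * real K2)"
      using n K2 by (auto simp: A_def)
    then show "real K2 / 4 \<le> fejer K2 (real n * \<alpha>2 + ?d2)" using K2 by (intro fejer_ge) auto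
  qed auto
  also have "\<dots> \<le> (\<Sum>n<N. fejer K1 (real n * \<alpha>1 + ?d1) * fejer K2 (real n * \<alpha>2 + ?d2))"
    by (intro sum_mono2) (auto simp: A_def)
  also have "\<dots> \<le> N + 2 * D * K1 * K2"
  proof (rule sum_fejer_product_le)
    fix k1 k2 :: int assume k: "(k1, k2) \<noteq> (0, 0)" "\<bar>k1\<bar> < int K1" "\<bar>k2\<bar> < int K2"
    have "of_int \<bar>k1\<bar> \<le> 1 / \<epsilon>1"
    proof (cases "K1 = 1")
      case True then have "k1 = 0" using k by simp
      then show ?thesis using \<epsilon> by simp
    next
      case False
      have "(of_int \<bar>k1\<bar> :: real) \<le> of_int (int K1)" using k by (subst of_int_le_iff) linarith
      then show ?thesis using False K1 by simp
    qed
    moreover have "of_int \<bar>k2\<bar> \<le> 1 / \<epsilon>2"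
    proof (cases "K2 = 1")
      case True then have "k2 = 0" using k by simp
      then show ?thesis using \<epsilon> by simp
    next
      case False
      have "(of_int \<bar>k2\<bar> :: real) \<le> of_int (int K2)" using k by (subst of_int_le_iff) linarith
      then show ?thesis using False K2 by simp
    qed
    ultimately show "dist_nint (of_int k1 * \<alpha>1 + of_int k2 * \<alpha>2) > 0 \<and> 1 / dist_nint (of_int k1 * \<alpha>1 + of_int k2 * \<alpha>2) \<le> D"
      using D k(1) by blast
  qed (use K1 K2 \<open>D \<ge> 0\<close> in auto)
  finally have "card A * (real K1 * real K2) \<le> 16 * (N + 2 * D * K1 * K2)" by simp
  then have "card A \<le> 16 * (N + 2 * D * K1 * K2) / (real K1 * real K2)"
    using K1 K2 by (subst pos_le_divide_eq) auto
  also have "\<dots> = 16 * N * ((1 / K1) * (1 / K2)) + 32 * D" using K1 K2 by (simp add: field_simps)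
  also have "\<dots> \<le> 16 * N * ((16 * \<epsilon>1) * (16 * \<epsilon>2)) + 32 * D"
    using K1 K2 \<epsilon> by (intro add_right_mono mult_left_mono mult_mono) auto
  finally show ?thesis unfolding card by (simp add: mult_ac)
qed

section \<open>A variance criterion and pairwise overlaps\<close>

text \<open>The leading constant 1 in \<open>corr\<close> cancels the squared mean, so the variance
  of the counting function is only linear in its mean. By Chebyshev the event that the count stays
  below a fixed \<open>K\<close> is null; a larger leading constant would give only positive
  probability by this argument.\<close>

lemma (in prob_space) prob_infinitely_often_eq_1:
  fixes A :: "nat \<Rightarrow> 'a set" and S :: "nat set" and C :: real
  assumes A [measurable]: "\<And>q. A q \<in> events"
    and corr: "\<And>n. (\<Sum>q\<in>S \<inter> {..<n}. \<Sum>r\<in>S \<inter> {..<n}. prob (A q \<inter> A r))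
        \<le> (\<Sum>q\<in>S \<inter> {..<n}. prob (A q))\<^sup>2 + C * (\<Sum>q\<in>S \<inter> {..<n}. prob (A q))"
    and unbounded: "\<And>B. \<exists>n. B \<le> (\<Sum>q\<in>S \<inter> {..<n}. prob (A q))"
  shows "prob {x \<in> space M. infinite {q \<in> S. x \<in> A q}} = 1"
proof -
  define N where "N n x = (\<Sum>q\<in>S \<inter> {..<n}. indicator (A q) x :: real)" for n x
  define m where "m n = (\<Sum>q\<in>S \<inter> {..<n}. prob (A q))" for n
  have [measurable]: "N n \<in> borel_measurable M" for n unfolding N_def by measurable
  have N_card: "N n x = card {q \<in> S \<inter> {..<n}. x \<in> A q}" for n x
    unfolding N_def indicator_def by (subst sum_of_bool_eq) (auto simp: Int_def)
  have integrable_ind: "integrable M (indicator (A q) :: 'a \<Rightarrow> real)" for q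
    by (simp add: integrable_indicator_iff emeasure_eq_measure)
  have EN: "expectation (N n) = m n" for n
    unfolding N_def m_def by (subst Bochner_Integration.integral_sum) (auto simp: integrable_ind)
  have N2: "(N n x)\<^sup>2 = (\<Sum>q\<in>S \<inter> {..<n}. \<Sum>r\<in>S \<inter> {..<n}. indicator (A q \<inter> A r) x)" for n x
    unfolding N_def power2_eq_square sum_product by (simp add: indicator_inter_arith)
  have iN2: "integrable M (\<lambda>x. (N n x)\<^sup>2)" for n
    unfolding N2 by (intro Bochner_Integration.integrable_sum) (auto simp: integrable_indicator_iff emeasure_eq_measure)
  have iN: "integrable M (N n)" for n
    unfolding N_def by (intro Bochner_Integration.integrable_sum integrable_ind)
  have EN2: "expectation (\<lambda>x. (N n x)\<^sup>2) = (\<Sum>q\<in>S \<inter> {..<n}. \<Sum>r\<in>S \<inter> {..<n}. prob (A q \<inter> A r))" for n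
    unfolding N2
    by (subst Bochner_Integration.integral_sum)
       (auto simp: integrable_indicator_iff emeasure_eq_measure intro!: sum.cong Bochner_Integration.integrable_sum)
  have var: "variance (N n) \<le> C * m n" for n
    using variance_eq[OF iN iN2, of n] corr[of n] by (simp add: EN EN2 m_def)
  define B where "B K = {x \<in> space M. \<forall>n. N n x \<le> real K}" for K :: nat
  have [measurable]: "B K \<in> events" for K unfolding B_def by measurable
  have B0: "prob (B K) = 0" for K
  proof (rule ccontr)
    assume "prob (B K) \<noteq> 0"
    then have pos: "prob (B K) > 0" by (simp add: zero_less_measure_iff)
    \<comment> \<open>This makes \<open>K\<close> at most half the mean \<open>m n\<close>, and the
      Chebyshev bound \<open>4 * C / m n\<close> smaller than \<open>prob (B K)\<close>. The
      absolute value is there because the sign of \<open>C\<close> is not assumed.\<close>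
    obtain n where n: "2 * K + 1 + \<bar>4 * C\<bar> / prob (B K) + 1 \<le> m n"
      using unbounded unfolding m_def by blast
    have c0: "0 \<le> \<bar>4 * C\<bar> / prob (B K)" using pos by simp
    have mn: "m n > 0" "K \<le> m n / 2" "\<bar>4 * C\<bar> / prob (B K) < m n" using n c0 by linarith+
    have "B K \<subseteq> {x \<in> space M. \<bar>N n x - expectation (N n)\<bar> \<ge> m n / 2}"
    proof
      fix x assume x: "x \<in> B K"
      then have "N n x \<le> K" by (auto simp: B_def)
      then have "m n / 2 \<le> \<bar>N n x - m n\<bar>" using mn(2) by linarith
      then show "x \<in> {x \<in> space M. \<bar>N n x - expectation (N n)\<bar> \<ge> m n / 2}"
        using x by (auto simp: B_def EN)
    qed
    then have "prob (B K) \<le> prob {x \<in> space M. \<bar>N n x - expectation (N n)\<bar> \<ge> m n / 2}"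
      by (intro finite_measure_mono) auto
    also have "\<dots> \<le> variance (N n) / (m n / 2)\<^sup>2"
      using mn by (intro Chebyshev_inequality iN2) auto
    also have "\<dots> \<le> (C * m n) / (m n / 2)\<^sup>2" by (intro divide_right_mono var) auto
    also have "\<dots> = 4 * C / m n" using mn by (simp add: power2_eq_square field_simps)
    also have "\<dots> \<le> \<bar>4 * C\<bar> / m n" using mn by (intro divide_right_mono) auto
    also have "\<dots> < prob (B K)"
      using mn pos by (simp add: field_simps)
    finally show False by simp
  qed
  have null: "(\<Union>K. B K) \<in> null_sets M"
    using B0 by (intro null_sets_UN) (auto simp: null_sets_def emeasure_eq_measure)
  have "{x \<in> space M. infinite {q \<in> S. x \<in> A q}} = space M - (\<Union>K. B K)"
  proof (intro set_eqI iffI)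
    fix x assume x: "x \<in> {x \<in> space M. infinite {q \<in> S. x \<in> A q}}"
    have "x \<notin> B K" for K
    proof
      assume "x \<in> B K"
      then have le: "card {q \<in> S \<inter> {..<n}. x \<in> A q} \<le> K" for n by (auto simp: B_def N_card)
      obtain F where F: "F \<subseteq> {q \<in> S. x \<in> A q}" "finite F" "card F = Suc K"
        using infinite_arbitrarily_large x by (metis (no_types, lifting) mem_Collect_eq)
      have "F \<subseteq> {q \<in> S \<inter> {..<Suc (Max F)}. x \<in> A q}" using F by (auto simp: less_Suc_eq_le)
      then have "card F \<le> card {q \<in> S \<inter> {..<Suc (Max F)}. x \<in> A q}" by (intro card_mono) auto
      with le[of "Suc (Max F)"] F show False by simp
    qed
    then show "x \<in> space M - (\<Union>K. B K)" using x by auto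
  next
    fix x assume x: "x \<in> space M - (\<Union>K. B K)"
    show "x \<in> {x \<in> space M. infinite {q \<in> S. x \<in> A q}}"
    proof (rule ccontr)
      assume "\<not> ?thesis"
      then have fin: "finite {q \<in> S. x \<in> A q}" using x by auto
      have "card {q \<in> S \<inter> {..<n}. x \<in> A q} \<le> card {q \<in> S. x \<in> A q}" for n
        using fin by (intro card_mono) auto
      then have "x \<in> B (card {q \<in> S. x \<in> A q})" using x by (auto simp: B_def N_card)
      then show False using x by auto
    qed
  qed
  then show ?thesis using null by (simp add: prob_compl measure_eq_0_null_sets)
qed

section \<open>Counting integers and residues\<close>

lemma card_ints_in_interval_le:
  fixes y b :: real
  assumes "b > 0"
  shows "finite {n :: int. \<bar>y + of_int n\<bar> < b}" "card {n :: int. \<bar>y + of_int n\<bar> < b} \<le> 2 * b + 1"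
proof -
  have sub: "{n :: int. \<bar>y + of_int n\<bar> < b} \<subseteq> {\<lfloor>- y - b\<rfloor> + 1 .. \<lceil>- y + b\<rceil> - 1}"
    by (auto simp: abs_less_iff) linarith+
  then show "finite {n :: int. \<bar>y + of_int n\<bar> < b}" by (rule finite_subset) simp
  have "card {n :: int. \<bar>y + of_int n\<bar> < b} \<le> card {\<lfloor>- y - b\<rfloor> + 1 .. \<lceil>- y + b\<rceil> - 1}"
    by (intro card_mono sub) simp
  also have "\<dots> = nat (\<lceil>- y + b\<rceil> - 1 - \<lfloor>- y - b\<rfloor>)" by simp
  also have "real \<dots> \<le> 2 * b + 1" using assms by linarith
  finally show "card {n :: int. \<bar>y + of_int n\<bar> < b} \<le> 2 * b + 1" by simp
qed

text \<open>As \<open>r'\<close> is invertible modulo \<open>q'\<close>, the congruence fixes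
  \<open>p mod q'\<close>; what remains is \<open>p div q'\<close>, which takes at most
  \<open>g\<close> values.\<close>

lemma card_cong_fibre_le:
  fixes g q' r' :: nat and n :: int
  assumes "q' > 0" "coprime q' r'"
  shows "card {p \<in> {..<g * q'}. [int r' * int p = n] (mod int q')} \<le> g"
proof -
  let ?F = "{p \<in> {..<g * q'}. [int r' * int p = n] (mod int q')}"
  have "inj_on (\<lambda>p. p div q') ?F"
  proof (rule inj_onI)
    fix p s assume p: "p \<in> ?F" and s: "s \<in> ?F" and eq: "p div q' = s div q'"
    have "[int r' * int p = int r' * int s] (mod int q')"
      using p s by (auto intro: cong_trans cong_sym)
    then have "[int p = int s] (mod int q')"
      using assms(2) by (subst (asm) cong_mult_lcancel) (auto simp: coprime_commute)
    then have "p mod q' = s mod q'" by (metis cong_int_iff cong_def)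
    with eq show "p = s" by (metis div_mult_mod_eq)
  qed
  moreover have "(\<lambda>p. p div q') ` ?F \<subseteq> {..<g}"
    by (auto intro!: less_mult_imp_div_less)
  ultimately have "card ?F \<le> card {..<g}" by (intro card_inj_on_le[of "\<lambda>p. p div q'"]) auto
  then show ?thesis by simp
qed

text \<open>In lowest terms the points are multiples of \<open>1 / q'\<close>, each taken at most
  \<open>g\<close> times modulo 1. At most \<open>2 * b * q' + 1\<close> numerators are admissible,
  and multiplying by \<open>g\<close> turns the extra 1 into the gcd.\<close>

lemma card_dist_nint_multiples_le:
  fixes q r :: nat and t b :: real
  assumes "q > 0" "b > 0"
  shows "card {p \<in> {..<q}. dist_nint (real r * real p / real q + t) < b} \<le> 2 * b * q + real (gcd q r)"
proof -
  define g where "g = gcd q r"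
  have "g > 0" using assms by (simp add: g_def)
  obtain q' r' where q': "q = g * q'" and r': "r = g * r'" and cop: "coprime q' r'"
    using gcd_coprime_exists[of q r] \<open>g > 0\<close> unfolding g_def by (metis mult.commute less_irrefl)
  have "q' > 0" using assms q' by (cases q') auto
  define I where "I = {n :: int. \<bar>q' * t + of_int n\<bar> < b * q'}"
  have I: "finite I" "card I \<le> 2 * (b * q') + 1"
    unfolding I_def using card_ints_in_interval_le[of "b * q'" "q' * t"] assms \<open>q' > 0\<close> by auto
  have "{p \<in> {..<q}. dist_nint (real r * real p / real q + t) < b}
     \<subseteq> (\<Union>n\<in>I. {p \<in> {..<g * q'}. [int r' * int p = n] (mod int q')})"
  proof
    fix p assume p: "p \<in> {p \<in> {..<q}. dist_nint (real r * real p / real q + t) < b}"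
    have rq: "real r * real p / real q = real r' * real p / real q'"
      using \<open>g > 0\<close> by (simp add: q' r')
    obtain m :: int where m: "\<bar>real r * real p / real q + t - of_int m\<bar> < b"
      using p dist_nint_ex[of "real r * real p / real q + t"] by auto
    then have "q' * \<bar>real r' * real p / real q' + t - of_int m\<bar> < q' * b"
      using \<open>q' > 0\<close> by (simp add: rq)
    also have "q' * \<bar>real r' * real p / real q' + t - of_int m\<bar>
        = \<bar>q' * (real r' * real p / real q' + t - of_int m)\<bar>" by (simp add: abs_mult)
    also have "q' * (real r' * real p / real q' + t - of_int m) = q' * t + of_int (int r' * int p - int q' * m)"
      using \<open>q' > 0\<close> by (simp add: algebra_simps)
    finally have "int r' * int p - int q' * m \<in> I" by (simp add: I_def mult.commute)
    moreover have "[int r' * int p = int r' * int p - int q' * m] (mod int q')"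
      by (simp add: cong_iff_dvd_diff)
    ultimately show "p \<in> (\<Union>n\<in>I. {p \<in> {..<g * q'}. [int r' * int p = n] (mod int q')})"
      using p q' by blast
  qed
  then have "card {p \<in> {..<q}. dist_nint (real r * real p / real q + t) < b}
     \<le> card (\<Union>n\<in>I. {p \<in> {..<g * q'}. [int r' * int p = n] (mod int q')})"
    using I by (intro card_mono) auto
  also have "\<dots> \<le> (\<Sum>n\<in>I. card {p \<in> {..<g * q'}. [int r' * int p = n] (mod int q')})"
    by (rule card_UN_le[OF I(1)])
  also have "\<dots> \<le> (\<Sum>n\<in>I. g)" by (intro sum_mono card_cong_fibre_le \<open>q' > 0\<close> cop)
  also have "\<dots> = g * card I" by simp
  finally have "real (card {p \<in> {..<q}. dist_nint (real r * real p / real q + t) < b}) \<le> real (g * card I)"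
    by (rule of_nat_mono)
  also have "\<dots> \<le> g * (2 * (b * q') + 1)" using I by (simp add: mult_left_mono)
  also have "\<dots> = 2 * b * q + g" by (simp add: q' algebra_simps)
  finally show ?thesis by (simp add: g_def)
qed

section \<open>Measure of periodic sets\<close>

lemma lmeasurable_Ico_Int:
  assumes P: "P \<in> sets borel"
  shows "{a..<b::real} \<inter> P \<in> lmeasurable"
proof -
  have "{a..<b} \<inter> P \<in> sets borel" using P by auto
  then have "{a..<b} \<inter> P \<in> sets lebesgue" by simp
  moreover have "bounded ({a..<b} \<inter> P)" by (rule bounded_subset[of "{a..b}"]) auto
  ultimately show ?thesis using bounded_set_imp_lmeasurable by blast
qed

lemma measure_Ico_Int_split:
  assumes P: "P \<in> sets borel" and "a \<le> b" "b \<le> (c::real)"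
  shows "measure lebesgue ({a..<c} \<inter> P) = measure lebesgue ({a..<b} \<inter> P) + measure lebesgue ({b..<c} \<inter> P)"
proof -
  have "{a..<c} \<inter> P = ({a..<b} \<inter> P) \<union> ({b..<c} \<inter> P)" using assms by auto
  moreover have "({a..<b} \<inter> P) \<inter> ({b..<c} \<inter> P) = {}" by auto
  ultimately show ?thesis
    using measure_Un3[OF lmeasurable_Ico_Int[OF P] lmeasurable_Ico_Int[OF P], of a b b c] by simp
qed

text \<open>The translated set lives on \<open>[t, 1 + t)\<close>; the part above 1 is moved back by
  one period.\<close>

lemma measure_periodic_shift:
  fixes P :: "real set"
  assumes P: "P \<in> sets borel" and per: "\<And>x. x + 1 \<in> P \<longleftrightarrow> x \<in> P" and t: "0 \<le> t" "t \<le> 1"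
  shows "measure lebesgue ({0..<1} \<inter> {x. x + t \<in> P}) = measure lebesgue ({0..<1} \<inter> P)"
proof -
  have "(+) t ` ({0..<1} \<inter> {x. x + t \<in> P}) = {t..<1+t} \<inter> P"
  proof (intro equalityI subsetI)
    fix y assume "y \<in> {t..<1+t} \<inter> P"
    then show "y \<in> (+) t ` ({0..<1} \<inter> {x. x + t \<in> P})"
      by (intro image_eqI[of _ _ "y - t"]) auto
  qed (auto simp: add.commute)
  then have "measure lebesgue ({0..<1} \<inter> {x. x + t \<in> P}) = measure lebesgue ({t..<1+t} \<inter> P)"
    by (metis measure_translation)
  also have "\<dots> = measure lebesgue ({t..<1} \<inter> P) + measure lebesgue ({1..<1+t} \<inter> P)"
    using t by (intro measure_Ico_Int_split P) auto
  also have "{1..<1+t} \<inter> P = (+) 1 ` ({0..<t} \<inter> P)"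
  proof (intro equalityI subsetI)
    fix y assume y: "y \<in> {1..<1+t} \<inter> P"
    then have "y - 1 \<in> P" using per[of "y - 1"] by simp
    then show "y \<in> (+) 1 ` ({0..<t} \<inter> P)" using y by (intro image_eqI[of _ _ "y - 1"]) auto
  qed (use per in \<open>auto simp: add.commute\<close>)
  also have "measure lebesgue \<dots> = measure lebesgue ({0..<t} \<inter> P)" by (rule measure_translation)
  also have "measure lebesgue ({t..<1} \<inter> P) + \<dots> = measure lebesgue ({0..<1} \<inter> P)"
    using measure_Ico_Int_split[OF P t] by simp
  finally show ?thesis .
qed

lemma measure_periodic_unit_interval:
  fixes P :: "real set"
  assumes P: "P \<in> sets borel" and per: "\<And>x. x + 1 \<in> P \<longleftrightarrow> x \<in> P"
  shows "measure lebesgue ({c..<c+1} \<inter> P) = measure lebesgue ({0..<1} \<inter> P)"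
proof -
  have per_nat: "x + real n \<in> P \<longleftrightarrow> x \<in> P" for x n
  proof (induction n)
    case (Suc n)
    have "x + real (Suc n) = (x + real n) + 1" by simp
    then show ?case using per Suc.IH by metis
  qed simp
  have per_int: "x + of_int k \<in> P \<longleftrightarrow> x \<in> P" for x k
  proof (cases "k \<ge> 0")
    case True
    then show ?thesis using per_nat[of x "nat k"] by simp
  next
    case False
    then show ?thesis using per_nat[of "x + of_int k" "nat (- k)"] by simp
  qed
  have "(+) c ` ({0..<1} \<inter> {x. x + frac c \<in> P}) = {c..<c+1} \<inter> P"
  proof (intro equalityI subsetI)
    fix y assume y: "y \<in> {c..<c+1} \<inter> P"
    have "y - c + frac c = y + of_int (- \<lfloor>c\<rfloor>)" by (simp add: frac_def)
    then have "y - c + frac c \<in> P" using y per_int[of y "- \<lfloor>c\<rfloor>"] by (simp only: IntD2)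
    then show "y \<in> (+) c ` ({0..<1} \<inter> {x. x + frac c \<in> P})"
      using y by (intro image_eqI[of _ _ "y - c"]) auto
  next
    fix y assume "y \<in> (+) c ` ({0..<1} \<inter> {x. x + frac c \<in> P})"
    then obtain x where x: "y = c + x" "0 \<le> x" "x < 1" "x + frac c \<in> P" by auto
    have "y = (x + frac c) + of_int \<lfloor>c\<rfloor>" using x by (simp add: frac_def)
    then have "y \<in> P" using x(4) per_int[of "x + frac c" "\<lfloor>c\<rfloor>"] by simp
    then show "y \<in> {c..<c+1} \<inter> P" using x by auto
  qed
  then have "measure lebesgue ({c..<c+1} \<inter> P) = measure lebesgue ({0..<1} \<inter> {x. x + frac c \<in> P})"
    by (metis measure_translation)
  also have "\<dots> = measure lebesgue ({0..<1} \<inter> P)"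
    using frac_lt_1[of c] by (intro measure_periodic_shift P per) auto
  finally show ?thesis .
qed

lemma measure_periodic_interval:
  fixes P :: "real set"
  assumes P: "P \<in> sets borel" and per: "\<And>x. x + 1 \<in> P \<longleftrightarrow> x \<in> P"
  shows "measure lebesgue ({c..<c + real n} \<inter> P) = n * measure lebesgue ({0..<1} \<inter> P)"
proof (induction n)
  case (Suc n)
  have "measure lebesgue ({c..<c + real (Suc n)} \<inter> P) = measure lebesgue ({c..<c + real n} \<inter> P)
      + measure lebesgue ({c + real n..<c + real (Suc n)} \<inter> P)"
    by (intro measure_Ico_Int_split P) auto
  also have "{c + real n..<c + real (Suc n)} = {c + real n..<(c + real n) + 1}" by (simp add: algebra_simps)
  also have "measure lebesgue ({c..<c + real n} \<inter> P) + measure lebesgue ({c + real n..<(c + real n) + 1} \<inter> P)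
      = n * measure lebesgue ({0..<1} \<inter> P) + measure lebesgue ({0..<1} \<inter> P)"
    by (simp only: Suc.IH measure_periodic_unit_interval[OF P per])
  finally show ?case by (simp add: algebra_simps)
qed simp

section \<open>Approximation sets and their pairwise intersections\<close>

definition near_set :: "nat \<Rightarrow> real \<Rightarrow> real \<Rightarrow> real set" where
  "near_set q \<gamma> \<delta> = {x. dist_nint (real q * x - \<gamma>) < \<delta>}"

lemma near_set_borel [measurable]: "near_set q \<gamma> \<delta> \<in> sets borel"
  unfolding near_set_def by measurable

lemma near_set_periodic: "x + 1 \<in> near_set q \<gamma> \<delta> \<longleftrightarrow> x \<in> near_set q \<gamma> \<delta>"
proof -
  have "real q * (x + 1) - \<gamma> = (real q * x - \<gamma>) + real q" by (simp add: algebra_simps)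
  then show ?thesis unfolding near_set_def by (metis dist_nint_add_nat mem_Collect_eq)
qed

text \<open>The map \<open>x \<mapsto> q * x - \<gamma>\<close> carries \<open>[0, 1)\<close> onto
  \<open>q\<close> periods and the set onto the neighbourhood \<open>U\<close> of the integers; the
  dilation factor \<open>q\<close> cancels the number of periods.\<close>

lemma measure_near_set:
  assumes "q \<ge> 1" "0 < \<delta>" "\<delta> \<le> 1/2"
  shows "measure lebesgue ({0..<1} \<inter> near_set q \<gamma> \<delta>) = 2 * \<delta>"
proof -
  define U where "U = near_set 1 0 \<delta>"
  have U: "U \<in> sets borel" "\<And>x. x + 1 \<in> U \<longleftrightarrow> x \<in> U"
    by (simp_all add: U_def near_set_periodic)
  \<comment> \<open>Within \<open>[0, 1)\<close> the set \<open>U\<close> consists of two pieces at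
    the ends; a shift by 1/2 joins them into one interval.\<close>
  have "measure lebesgue ({0..<1} \<inter> U) = measure lebesgue ({0..<1} \<inter> {x. x + 1/2 \<in> U})"
    by (intro measure_periodic_shift[symmetric] U) auto
  also have "{0..<1} \<inter> {x. x + 1/2 \<in> U} = {1/2 - \<delta> <..< 1/2 + \<delta>}"
  proof -
    have "x + 1/2 \<in> U \<longleftrightarrow> \<bar>x - 1/2\<bar> < \<delta>" if "0 \<le> x" "x < 1" for x
    proof -
      have "round (x + 1/2) = 1" using that unfolding round_def by (simp add: floor_eq_iff)
      then show ?thesis by (simp add: U_def near_set_def dist_nint_def)
    qed
    then show ?thesis using assms by (auto simp: abs_less_iff)
  qed
  also have "measure lebesgue \<dots> = 2 * \<delta>" using assms by simp
  finally have mU: "measure lebesgue ({0..<1} \<inter> U) = 2 * \<delta>" .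
  have "(\<lambda>x. - \<gamma> + real q *\<^sub>R x) ` ({0..<1} \<inter> near_set q \<gamma> \<delta>) = {- \<gamma>..< - \<gamma> + real q} \<inter> U"
  proof (intro equalityI subsetI)
    fix y assume y: "y \<in> {- \<gamma>..< - \<gamma> + real q} \<inter> U"
    then show "y \<in> (\<lambda>x. - \<gamma> + real q *\<^sub>R x) ` ({0..<1} \<inter> near_set q \<gamma> \<delta>)"
      using assms(1) by (intro image_eqI[of _ _ "(y + \<gamma>) / q"])
        (auto simp: U_def near_set_def field_simps)
  qed (use assms(1) in \<open>auto simp: U_def near_set_def algebra_simps\<close>)
  then have "measure lebesgue ({- \<gamma>..< - \<gamma> + real q} \<inter> U) = q * measure lebesgue ({0..<1} \<inter> near_set q \<gamma> \<delta>)"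
    using measure_lebesgue_affine[of "real q" "- \<gamma>" "{0..<1} \<inter> near_set q \<gamma> \<delta>"] by (simp add: add.commute)
  then show ?thesis using measure_periodic_interval[OF U, of "- \<gamma>" q] mU assms(1) by simp
qed

text \<open>Averaging over the shifts \<open>x + p / q\<close>, which all lie in the first set when \<open>x\<close> does.\<close>

lemma measure_near_set_Int_le:
  assumes "q \<ge> 1" "r \<ge> 1" "0 < a" "a \<le> 1/2" "0 < b"
  shows "measure lebesgue ({0..<1} \<inter> (near_set q \<gamma> a \<inter> near_set r \<gamma> b)) \<le> 4 * a * b + 2 * a * real (gcd q r) / q"
proof -
  define P where "P = near_set q \<gamma> a \<inter> near_set r \<gamma> b"
  define Q where "Q = {0..<1} \<inter> near_set q \<gamma> a"
  define c where "c = 2 * b * q + real (gcd q r)"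
  define T where "T p = {0..<1} \<inter> {x. x + real p / real q \<in> P}" for p :: nat
  have P: "P \<in> sets borel" by (simp add: P_def)
  have "(\<lambda>x. x + real p / real q) -` P \<inter> space borel \<in> sets borel" for p
    using P by (intro measurable_sets[of _ borel borel]) auto
  then have T: "T p \<in> lmeasurable" for p
    unfolding T_def using lmeasurable_Ico_Int[of "(\<lambda>x. x + real p / real q) -` P" 0 1] by (simp add: vimage_def)
  have Q: "Q \<in> lmeasurable" unfolding Q_def by (rule lmeasurable_Ico_Int) simp
  have iT: "integrable lebesgue (indicator (T p) :: real \<Rightarrow> real)" for p
    using T[of p] by (auto simp: fmeasurable_def less_top)
  have iQ: "integrable lebesgue (indicator Q :: real \<Rightarrow> real)"
    using Q by (auto simp: fmeasurable_def less_top)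
  \<comment> \<open>Multiplication by \<open>q\<close> turns the shift \<open>p / q\<close> into an
    integer, so the condition at \<open>q\<close> is the same for all \<open>p\<close>. Only the
    condition at \<open>r\<close> has to be counted over \<open>p\<close>.\<close>
  have pw: "(\<Sum>p<q. indicator (T p) x) \<le> c * indicator Q x" for x :: real
  proof (cases "x \<in> Q")
    case False
    have "x \<notin> T p" for p
    proof
      assume x: "x \<in> T p"
      have "real q * (x + real p / real q) - \<gamma> = (real q * x - \<gamma>) + real p"
        using assms(1) by (simp add: field_simps)
      then have "dist_nint (real q * (x + real p / real q) - \<gamma>) = dist_nint (real q * x - \<gamma>)"
        by (simp only: dist_nint_add_nat)
      then show False using x False by (auto simp: T_def P_def Q_def near_set_def)
    qed
    then show ?thesis using False by simp
  next
    case True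
    have "(\<Sum>p<q. indicator (T p) x :: real) = (\<Sum>p<q. of_bool (x \<in> T p))" by (simp add: indicator_def)
    also have "\<dots> = card {p \<in> {..<q}. x \<in> T p}" by (simp add: Int_def)
    also have "\<dots> \<le> card {p \<in> {..<q}. dist_nint (real r * real p / real q + (real r * x - \<gamma>)) < b}"
      by (intro of_nat_mono card_mono) (auto simp: T_def P_def near_set_def algebra_simps)
    also have "\<dots> \<le> c" unfolding c_def using assms by (intro card_dist_nint_multiples_le) auto
    finally show ?thesis using True by simp
  qed
  have "measure lebesgue (T p) = measure lebesgue ({0..<1} \<inter> P)" if "p < q" for p
    unfolding T_def using that
    by (intro measure_periodic_shift P) (auto simp: P_def near_set_periodic)
  then have "q * measure lebesgue ({0..<1} \<inter> P) = (\<Sum>p<q. measure lebesgue (T p))" by simp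
  also have "\<dots> = integral\<^sup>L lebesgue (\<lambda>x. \<Sum>p<q. indicator (T p) x)"
    by (subst Bochner_Integration.integral_sum) (use iT in auto)
  also have "\<dots> \<le> integral\<^sup>L lebesgue (\<lambda>x. c * indicator Q x)"
    using pw by (intro integral_mono Bochner_Integration.integrable_sum iT integrable_mult_right iQ) auto
  also have "\<dots> = c * measure lebesgue Q" by simp
  also have "measure lebesgue Q = 2 * a" unfolding Q_def using assms by (intro measure_near_set) auto
  finally have "measure lebesgue ({0..<1} \<inter> P) \<le> c * (2 * a) / q" using assms(1) by (simp add: field_simps)
  also have "\<dots> = 4 * a * b + 2 * a * real (gcd q r) / q" using assms(1) by (simp add: c_def field_simps)
  finally show ?thesis by (simp add: P_def)
qed

text \<open>Multiplying the condition at \<open>g * q'\<close> by \<open>r'\<close> and that at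
  \<open>g * r'\<close> by \<open>q'\<close> gives the same multiple of \<open>x\<close>.
  Subtraction eliminates \<open>x\<close> and leaves an integer and a multiple of
  \<open>\<gamma>\<close>.\<close>

lemma near_set_Int_nonempty:
  fixes q' r' g :: nat and a b :: real
  assumes "x \<in> near_set (g * q') \<gamma> a \<inter> near_set (g * r') \<gamma> b" "q' > 0" "r' > 0"
  shows "dist_nint ((real r' - real q') * \<gamma>) < r' * a + q' * b"
proof -
  obtain m where m: "\<bar>real (g * q') * x - \<gamma> - of_int m\<bar> < a"
    using assms(1) dist_nint_ex[of "real (g * q') * x - \<gamma>"] by (auto simp: near_set_def)
  obtain n where n: "\<bar>real (g * r') * x - \<gamma> - of_int n\<bar> < b"
    using assms(1) dist_nint_ex[of "real (g * r') * x - \<gamma>"] by (auto simp: near_set_def)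
  have "dist_nint ((real r' - real q') * \<gamma>) \<le> \<bar>(real r' - real q') * \<gamma> - of_int (int q' * n - int r' * m)\<bar>"
    by (rule dist_nint_le)
  also have "(real r' - real q') * \<gamma> - of_int (int q' * n - int r' * m)
      = q' * (real (g * r') * x - \<gamma> - of_int n) - r' * (real (g * q') * x - \<gamma> - of_int m)"
    by (simp add: algebra_simps)
  also have "\<bar>\<dots>\<bar> \<le> \<bar>q' * (real (g * r') * x - \<gamma> - of_int n)\<bar> + \<bar>r' * (real (g * q') * x - \<gamma> - of_int m)\<bar>"
    by (rule abs_triangle_ineq4)
  also have "\<dots> = q' * \<bar>real (g * r') * x - \<gamma> - of_int n\<bar> + r' * \<bar>real (g * q') * x - \<gamma> - of_int m\<bar>"
    by (simp add: abs_mult)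
  also have "\<dots> < q' * b + r' * a"
    using assms m n by (intro add_strict_mono mult_strict_left_mono) auto
  finally show ?thesis by simp
qed

section \<open>Divisor sums\<close>

lemma sum_ln_prime_factors_le:
  assumes "m > (0::nat)"
  shows "(\<Sum>p\<in>prime_factors m. ln (real p)) \<le> ln (real m)"
proof -
  have pos: "p > 0" if "p \<in> prime_factors m" for p
    using that by (auto simp: prime_gt_0_nat in_prime_factors_iff)
  have "(\<Prod>p\<in>prime_factors m. p) dvd (\<Prod>p\<in>prime_factors m. p ^ multiplicity p m)"
  proof (rule prod_dvd_prod)
    fix p assume p: "p \<in> prime_factors m"
    then have "multiplicity p m > 0" by (simp add: prime_factors_multiplicity)
    then show "p dvd p ^ multiplicity p m" by (simp add: dvd_power)
  qed
  also have "\<dots> = m" using assms by (simp add: prod_prime_factors)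
  finally have "(\<Prod>p\<in>prime_factors m. p) \<le> m" using assms by (rule dvd_imp_le)
  then have "real (\<Prod>p\<in>prime_factors m. p) \<le> real m" by (rule of_nat_mono)
  moreover have "(\<Sum>p\<in>prime_factors m. ln (real p)) = ln (\<Prod>p\<in>prime_factors m. real p)"
    using pos by (subst ln_prod) auto
  moreover have "(\<Prod>p\<in>prime_factors m. real p) > 0" using pos by (intro prod_pos) auto
  ultimately show ?thesis by (simp add: of_nat_prod)
qed

lemma card_multiples_ge:
  assumes "p > (0::nat)"
  shows "n div p \<le> card {m \<in> {1..n}. p dvd m}"
proof -
  have "(\<lambda>k. p * k) ` {1..n div p} \<subseteq> {m \<in> {1..n}. p dvd m}"
  proof
    fix x assume "x \<in> (\<lambda>k. p * k) ` {1..n div p}"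
    then obtain k where k: "x = p * k" "1 \<le> k" "k \<le> n div p" by (auto simp only: image_iff atLeastAtMost_iff)
    have "p * k \<le> p * (n div p)" using k by simp
    also have "\<dots> \<le> n" by simp
    finally show "x \<in> {m \<in> {1..n}. p dvd m}" using k assms by auto
  qed
  then have "card ((\<lambda>k. p * k) ` {1..n div p}) \<le> card {m \<in> {1..n}. p dvd m}" by (intro card_mono) auto
  then show ?thesis using assms by (simp add: card_image inj_on_def)
qed

text \<open>The factor 2 comes from \<open>\<lfloor>n / p\<rfloor> \<ge> n / (2 p)\<close> in the factorisation of \<open>n!\<close>,
  and avoids Chebyshev's estimates.\<close>

lemma sum_ln_over_primes_le:
  assumes "n \<ge> 1"
  shows "(\<Sum>p | prime p \<and> p \<le> n. ln (real p) / real p) \<le> 2 * ln (real n)"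
proof -
  let ?P = "{p::nat. prime p \<and> p \<le> n}"
  have fin: "finite ?P" by (rule finite_subset[of _ "{..n}"]) auto
  have "(\<Sum>p\<in>?P. ln (real p) * (real n / (2 * real p))) \<le> (\<Sum>p\<in>?P. ln (real p) * card {m \<in> {1..n}. p dvd m})"
  proof (intro sum_mono mult_left_mono)
    fix p assume p: "p \<in> ?P"
    then have p0: "p > 0" by (auto simp: prime_gt_0_nat)
    have "n div p \<ge> 1" using p p0 by (simp add: div_greater_zero_iff Suc_le_eq)
    then have "p \<le> p * (n div p)" by simp
    moreover have "n = p * (n div p) + n mod p" "n mod p < p" using p0 by auto
    ultimately have "n \<le> 2 * (p * (n div p))" by linarith
    then have "n \<le> 2 * (p * card {m \<in> {1..n}. p dvd m})"
      using card_multiples_ge[OF p0, of n] by (meson le_trans mult_le_mono2)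
    then have "real n \<le> real (2 * (p * card {m \<in> {1..n}. p dvd m}))" by (rule of_nat_mono)
    then show "real n / (2 * real p) \<le> real (card {m \<in> {1..n}. p dvd m})"
      using p0 by (simp add: field_simps)
    show "0 \<le> ln (real p)" using p0 by simp
  qed
  also have "\<dots> = (\<Sum>p\<in>?P. \<Sum>m\<in>{1..n}. if p dvd m then ln (real p) else 0)"
    by (intro sum.cong refl) (simp add: sum.If_cases Int_def)
  also have "\<dots> = (\<Sum>m\<in>{1..n}. \<Sum>p\<in>?P. if p dvd m then ln (real p) else 0)" by (rule sum.swap)
  also have "\<dots> \<le> (\<Sum>m\<in>{1..n}. ln (real n))"
  proof (intro sum_mono)
    fix m assume m: "m \<in> {1..n}"
    have "(\<Sum>p\<in>?P. if p dvd m then ln (real p) else 0) = (\<Sum>p\<in>?P \<inter> {p. p dvd m}. ln (real p))"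
      using fin by (simp add: sum.If_cases)
    also have "?P \<inter> {p. p dvd m} = prime_factors m"
    proof -
      have "p \<le> n" if "p dvd m" for p using dvd_imp_le[OF that] m by simp
      then show ?thesis using m by (auto simp: in_prime_factors_iff)
    qed
    also have "(\<Sum>p\<in>prime_factors m. ln (real p)) \<le> ln (real m)"
      using m by (intro sum_ln_prime_factors_le) auto
    also have "\<dots> \<le> ln (real n)" using m by auto
    finally show "(\<Sum>p\<in>?P. if p dvd m then ln (real p) else 0) \<le> ln (real n)" .
  qed
  also have "\<dots> = n * ln (real n)" by simp
  finally have "real n / 2 * (\<Sum>p\<in>?P. ln (real p) / real p) \<le> n * ln (real n)"
    by (simp add: sum_distrib_left field_simps)
  then show ?thesis using assms by simp
qed

text \<open>Partial summation from \<open>sum_ln_over_primes_le\<close>, done as an induction on the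
  difference \<open>B n - A n / ln n\<close>, whose increments telescope to a double
  logarithm.\<close>

lemma sum_inverse_primes_le:
  assumes "n \<ge> 2"
  shows "(\<Sum>p | prime p \<and> p \<le> n. 1 / real p) \<le> 2 * ln (ln (real n)) + (2 - 2 * ln (ln 2))"
proof -
  define A where "A n = (\<Sum>p | prime p \<and> p \<le> n. ln (real p) / real p)" for n :: nat
  define B where "B n = (\<Sum>p | prime p \<and> p \<le> n. 1 / real p)" for n :: nat
  have step: "{p. prime p \<and> p \<le> Suc n} = (if prime (Suc n) then insert (Suc n) {p. prime p \<and> p \<le> n} else {p. prime p \<and> p \<le> n})"
    for n :: nat by (auto simp: le_Suc_eq)
  have fin: "finite {p::nat. prime p \<and> p \<le> n}" for n by (rule finite_subset[of _ "{..n}"]) auto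
  have "B n - A n / ln n \<le> 2 * (ln (ln (real n)) - ln (ln 2))"
    using assms
  proof (induction n rule: dec_induct)
    case base
    have "{p::nat. prime p \<and> p \<le> 2} = {2}" by (auto simp: le_less prime_ge_2_nat dest: prime_ge_2_nat)
    then show ?case by (simp add: A_def B_def)
  next
    case (step n)
    define u v where "u = ln (real n)" and "v = ln (real (Suc n))"
    have u: "u > 0" using step.hyps by (simp add: u_def)
    have uv: "u < v" using step.hyps by (simp add: u_def v_def)
    \<comment> \<open>If \<open>Suc n\<close> is prime, its term in \<open>A\<close> divided by
      \<open>v = ln (Suc n)\<close> is the reciprocal of \<open>Suc n\<close>, which cancels its
      term in \<open>B\<close>.\<close>
    have "B (Suc n) - A (Suc n) / v = B n - A n / v"
      using u uv unfolding A_def B_def \<open>\<And>n. {p. prime p \<and> p \<le> Suc n} = _\<close>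
      by (simp add: fin add_divide_distrib v_def)
    also have "\<dots> = (B n - A n / u) + A n * (1 / u - 1 / v)" by (simp add: algebra_simps)
    also have "\<dots> \<le> 2 * (ln u - ln (ln 2)) + 2 * u * (1 / u - 1 / v)"
    proof (intro add_mono mult_right_mono)
      show "A n \<le> 2 * u" unfolding A_def u_def using step.hyps by (intro sum_ln_over_primes_le) auto
      show "0 \<le> 1 / u - 1 / v" using u uv by (simp add: frac_le)
    qed (use step.IH in \<open>simp add: u_def\<close>)
    also have "2 * u * (1 / u - 1 / v) = 2 * (1 - u / v)" using u uv by (simp add: field_simps)
    also have "1 - u / v \<le> ln v - ln u"
      using ln_add_one_self_le_self2[of "u / v - 1"] u uv by (simp add: ln_div)
    finally show ?case by (simp add: u_def v_def)
  qed
  moreover have "A n / ln n \<le> 2"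
    using sum_ln_over_primes_le[of n] assms by (simp add: A_def field_simps)
  ultimately have "B n \<le> 2 * (ln (ln (real n)) - ln (ln 2)) + 2" by argo
  then have "B n \<le> 2 * ln (ln (real n)) + (2 - 2 * ln (ln 2))" by argo
  then show ?thesis by (simp only: B_def)
qed

section \<open>Divisor sums by induction over prime powers\<close>

lemma prime_power_induct [consumes 1, case_names one prime_power]:
  fixes q :: nat
  assumes "q > 0" "P 1"
    and "\<And>p a m. prime p \<Longrightarrow> a \<ge> 1 \<Longrightarrow> m \<ge> 1 \<Longrightarrow> \<not> p dvd m \<Longrightarrow> P m \<Longrightarrow> P (p ^ a * m)"
  shows "P q"
  using assms(1)
proof (induction q rule: less_induct)
  case (less q)
  show ?case
  proof (cases "q = 1")
    case False
    then obtain p where p: "prime p" "p dvd q" using prime_factor_nat by blast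
    obtain m where m: "q = p ^ multiplicity p q * m" "\<not> p dvd m"
      using less.prems p by (metis multiplicity_decompose' not_prime_unit not_gr0)
    have a: "multiplicity p q \<ge> 1"
      using p less.prems by (simp add: prime_multiplicity_gt_zero_iff Suc_le_eq)
    have "m > 0" using m less.prems by (cases m) auto
    moreover have "m < q"
    proof -
      have "p ^ 1 \<le> p ^ multiplicity p q"
        using a p prime_gt_0_nat[OF p(1)] by (intro power_increasing) auto
      then have "2 \<le> p ^ multiplicity p q" using prime_ge_2_nat[OF p(1)] by simp
      then have "2 * m \<le> q" using m by (metis mult_le_mono1)
      then show ?thesis using \<open>m > 0\<close> by simp
    qed
    ultimately have "P m" using less.IH by blast
    then show ?thesis using assms(3)[OF p(1) a _ m(2)] \<open>m > 0\<close> m(1) by simp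
  qed (use assms in auto)
qed

text \<open>Every divisor splits as \<open>p ^ i * e\<close>. For nonnegative \<open>f\<close>
  repeated values only enlarge the right side, so existence of the splitting is enough.\<close>

lemma sum_divisors_prime_power_mult_le:
  fixes f :: "nat \<Rightarrow> real"
  assumes "prime p" "m \<ge> 1" "\<And>d. d \<ge> 1 \<Longrightarrow> f d \<ge> 0"
  shows "(\<Sum>d | d dvd p ^ a * m. f d) \<le> (\<Sum>i\<le>a. \<Sum>e | e dvd m. f (p ^ i * e))"
proof -
  have p0: "p > 0" using assms prime_gt_0_nat by auto
  have sub: "{d. d dvd p ^ a * m} \<subseteq> (\<lambda>(i, e). p ^ i * e) ` ({..a} \<times> {e. e dvd m})"
  proof
    fix d assume "d \<in> {d. d dvd p ^ a * m}"
    then obtain b e where d: "d = b * e" "b dvd p ^ a" "e dvd m" using division_decomp by blast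
    then obtain i where "i \<le> a" "b = p ^ i" using divides_primepow_nat[OF assms(1)] by blast
    with d show "d \<in> (\<lambda>(i, e). p ^ i * e) ` ({..a} \<times> {e. e dvd m})" by force
  qed
  have fin: "finite ({..a} \<times> {e. e dvd m})" using assms(2) by simp
  have pos: "p ^ i * e \<ge> 1" if "e dvd m" for i e
    using that assms(2) p0 by (auto simp: Suc_le_eq intro!: Nat.gr0I)
  have "(\<Sum>d | d dvd p ^ a * m. f d) \<le> (\<Sum>d\<in>(\<lambda>(i, e). p ^ i * e) ` ({..a} \<times> {e. e dvd m}). f d)"
    using fin sub pos by (intro sum_mono2) (auto intro: assms(3))
  also have "\<dots> \<le> (\<Sum>(i, e)\<in>{..a} \<times> {e. e dvd m}. f (p ^ i * e))"
    using fin pos by (intro order.trans[OF sum_image_le]) (auto simp: split_def intro: assms(3))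
  finally show ?thesis by (simp add: sum.cartesian_product)
qed

lemma prime_factors_prime_power_mult:
  fixes p m :: nat
  assumes "prime p" "a \<ge> 1" "m \<ge> 1"
  shows "prime_factors (p ^ a * m) = insert p (prime_factors m)"
  using assms by (subst prime_factors_product) (auto simp: prime_factorization_prime_power)

text \<open>The first bound is an Euler product, the second its logarithmically weighted form. They
  are proved together, because splitting off \<open>p ^ a\<close> sends the pair of sums
  \<open>F\<close>, \<open>G\<close> to at most \<open>F / (1 - x)\<close> and
  \<open>(2 * x * ln p * F + G) / (1 - x)\<close> with \<open>x = 1 / p\<close>.\<close>

lemma divisor_sums_le:
  fixes q :: nat
  assumes "q > 0"
  shows "(\<Sum>d | d dvd q. 1 / real d) \<le> (\<Prod>p\<in>prime_factors q. 1 / (1 - 1 / real p)) \<and>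
     (\<Sum>d | d dvd q. ln (real d) / real d) \<le>
       (\<Prod>p\<in>prime_factors q. 1 / (1 - 1 / real p)) * (\<Sum>p\<in>prime_factors q. 2 * ln (real p) / real p)"
  using assms
proof (induction q rule: prime_power_induct)
  case one
  then show ?case by simp
next
  case (prime_power p a m)
  define F where "F = (\<Sum>d | d dvd m. 1 / real d)"
  define G where "G = (\<Sum>d | d dvd m. ln (real d) / real d)"
  define Q where "Q = (\<Prod>p\<in>prime_factors m. 1 / (1 - 1 / real p))"
  define L where "L = (\<Sum>p\<in>prime_factors m. 2 * ln (real p) / real p)"
  define x where "x = 1 / real p"
  have p2: "p \<ge> 2" using prime_power.hyps prime_ge_2_nat by blast
  have x: "0 < x" "x \<le> 1/2" using p2 by (auto simp: x_def field_simps)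
  have F0: "F \<ge> 0" unfolding F_def by (intro sum_nonneg) auto
  have IH: "F \<le> Q" "G \<le> Q * L" using prime_power.IH by (auto simp: F_def G_def Q_def L_def)
  have pf: "prime_factors (p ^ a * m) = insert p (prime_factors m)" and np: "p \<notin> prime_factors m"
    using prime_power.hyps by (auto simp: prime_factors_prime_power_mult in_prime_factors_iff)
  have Q': "(\<Prod>p\<in>prime_factors (p ^ a * m). 1 / (1 - 1 / real p)) = 1 / (1 - x) * Q"
    unfolding pf Q_def x_def using np by simp
  have L': "(\<Sum>p\<in>prime_factors (p ^ a * m). 2 * ln (real p) / real p) = 2 * ln p * x + L"
    unfolding pf L_def x_def using np by simp
  have geo: "(\<Sum>i\<le>a. x ^ i) \<le> 1 / (1 - x)"
    using sum_le_suminf[of "\<lambda>i. x ^ i" "{..a}"] x suminf_geometric[of x] summable_geometric[of x] by auto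
  \<comment> \<open>Shifting the index gives \<open>T \<le> x * T + x / (1 - x)\<close>;
    \<open>x \<le> 1 / 2\<close> absorbs half of \<open>T\<close>, whence the factor 2.\<close>
  have geo': "(\<Sum>i\<le>a. real i * x ^ i) \<le> 1 / (1 - x) * (2 * x)"
  proof -
    define T where "T = (\<Sum>i\<le>a. real i * x ^ i)"
    have "T = (\<Sum>i<a. real (Suc i) * x ^ Suc i)"
      unfolding T_def by (subst sum.atMost_shift) simp
    also have "\<dots> \<le> (\<Sum>i\<le>a. real (Suc i) * x ^ Suc i)"
      using x by (intro sum_mono2) auto
    also have "\<dots> = x * T + x * (\<Sum>i\<le>a. x ^ i)"
      by (simp add: T_def sum_distrib_left sum.distrib algebra_simps)
    also have "\<dots> \<le> x * T + x * (1 / (1 - x))" using geo x by (intro add_left_mono mult_left_mono) auto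
    also have "\<dots> \<le> 1/2 * T + x * (1 / (1 - x))"
      using x by (intro add_right_mono mult_right_mono) (auto simp: T_def intro!: sum_nonneg)
    finally show ?thesis by (simp add: T_def)
  qed
  have 1: "(\<Sum>d | d dvd p ^ a * m. 1 / real d) \<le> 1 / (1 - x) * F"
  proof -
    have "(\<Sum>d | d dvd p ^ a * m. 1 / real d) \<le> (\<Sum>i\<le>a. \<Sum>e | e dvd m. 1 / real (p ^ i * e))"
      using prime_power.hyps by (intro sum_divisors_prime_power_mult_le) auto
    also have "\<dots> = (\<Sum>i\<le>a. x ^ i) * F"
      by (simp add: F_def x_def sum_product power_divide)
    also have "\<dots> \<le> 1 / (1 - x) * F" using geo F0 by (rule mult_right_mono)
    finally show ?thesis .
  qed
  have 2: "(\<Sum>d | d dvd p ^ a * m. ln (real d) / real d) \<le> 1 / (1 - x) * (2 * x * ln p * F + G)"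
  proof -
    have G0: "G \<ge> 0" unfolding G_def
    proof (rule sum_nonneg)
      fix d assume "d \<in> {d. d dvd m}"
      then show "ln (real d) / real d \<ge> 0" by (cases "d = 0") auto
    qed
    have "(\<Sum>d | d dvd p ^ a * m. ln (real d) / real d) \<le> (\<Sum>i\<le>a. \<Sum>e | e dvd m. ln (real (p ^ i * e)) / real (p ^ i * e))"
      using prime_power.hyps by (intro sum_divisors_prime_power_mult_le) auto
    also have "\<dots> = (\<Sum>i\<le>a. \<Sum>e | e dvd m. real i * x ^ i * ln p * (1 / real e) + x ^ i * (ln (real e) / real e))"
    proof (intro sum.cong refl)
      fix i e assume "e \<in> {e. e dvd m}"
      then have "e > 0" using prime_power.hyps by (auto intro!: Nat.gr0I)
      then have "ln (real (p ^ i * e)) = real i * ln p + ln e"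
        using p2 by (simp add: ln_mult ln_realpow)
      then show "ln (real (p ^ i * e)) / real (p ^ i * e) =
          real i * x ^ i * ln p * (1 / real e) + x ^ i * (ln (real e) / real e)"
        using p2 \<open>e > 0\<close> by (simp add: x_def field_simps)
    qed
    also have "\<dots> = (\<Sum>i\<le>a. real i * x ^ i * ln p) * F + (\<Sum>i\<le>a. x ^ i) * G"
      unfolding F_def G_def sum_product by (simp only: sum.distrib)
    finally have le: "(\<Sum>d | d dvd p ^ a * m. ln (real d) / real d)
      \<le> (\<Sum>i\<le>a. real i * x ^ i * ln p) * F + (\<Sum>i\<le>a. x ^ i) * G" .
    have "(\<Sum>i\<le>a. real i * x ^ i * ln p) = (\<Sum>i\<le>a. real i * x ^ i) * ln p"
      by (rule sum_distrib_right[symmetric])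
    also have "\<dots> \<le> 1 / (1 - x) * (2 * x) * ln p" using p2 by (intro mult_right_mono geo') auto
    finally have "(\<Sum>i\<le>a. real i * x ^ i * ln p) * F \<le> 1 / (1 - x) * (2 * x) * ln p * F"
      using F0 by (rule mult_right_mono)
    moreover have "(\<Sum>i\<le>a. x ^ i) * G \<le> 1 / (1 - x) * G" using geo G0 by (rule mult_right_mono)
    moreover have "1 / (1 - x) * (2 * x) * ln p * F + 1 / (1 - x) * G = 1 / (1 - x) * (2 * x * ln p * F + G)"
      by (simp only: distrib_left mult.assoc)
    ultimately show ?thesis using le by linarith
  qed
  have c: "1 / (1 - x) \<ge> 0" using x by simp
  have "1 / (1 - x) * F \<le> 1 / (1 - x) * Q" by (rule mult_left_mono[OF IH(1) c])
  with 1 have g1: "(\<Sum>d | d dvd p ^ a * m. 1 / real d) \<le> 1 / (1 - x) * Q" by linarith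
  have "2 * x * ln p \<ge> 0" using x p2 by simp
  then have "2 * x * ln p * F + G \<le> 2 * x * ln p * Q + Q * L"
    by (intro add_mono mult_left_mono IH)
  from mult_left_mono[OF this c]
  have "1 / (1 - x) * (2 * x * ln p * F + G) \<le> 1 / (1 - x) * (2 * x * ln p * Q + Q * L)" .
  also have "\<dots> = 1 / (1 - x) * Q * (2 * ln p * x + L)"
    by (simp only: distrib_left mult_ac)
  finally have g2: "1 / (1 - x) * (2 * x * ln p * F + G) \<le> 1 / (1 - x) * Q * (2 * ln p * x + L)" .
  show ?case unfolding Q' L' using g1 order.trans[OF 2 g2] by (rule conjI)
qed

text \<open>Each factor is \<open>1 + 1 / (p - 1)\<close>, at most \<open>exp (1 / (p - 1))\<close>.
  Replacing \<open>1 / (p - 1)\<close> by \<open>1 / p\<close> costs a telescoping sum bounded by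
  1.\<close>

lemma prod_inverse_one_minus_le:
  assumes "finite A" "\<And>p. p \<in> A \<Longrightarrow> p \<ge> (2::nat)"
  shows "(\<Prod>p\<in>A. 1 / (1 - 1 / real p)) \<le> exp ((\<Sum>p\<in>A. 1 / real p) + 1)"
proof -
  have "(\<Prod>p\<in>A. 1 / (1 - 1 / real p)) \<le> (\<Prod>p\<in>A. exp (1 / real p + (1 / (real p - 1) - 1 / real p)))"
  proof (intro prod_mono conjI)
    fix p assume "p \<in> A"
    then have p: "p \<ge> 2" using assms by blast
    then show "0 \<le> 1 / (1 - 1 / real p)" by (simp add: field_simps)
    have "1 / (1 - 1 / real p) = 1 + 1 / (real p - 1)" using p by (simp add: field_simps)
    also have "\<dots> \<le> exp (1 / (real p - 1))" by (rule exp_ge_add_one_self)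
    finally show "1 / (1 - 1 / real p) \<le> exp (1 / real p + (1 / (real p - 1) - 1 / real p))" by simp
  qed
  also have "\<dots> = exp ((\<Sum>p\<in>A. 1 / real p) + (\<Sum>p\<in>A. 1 / (real p - 1) - 1 / real p))"
    by (simp only: exp_sum[OF assms(1), symmetric] sum.distrib)
  also have "(\<Sum>p\<in>A. 1 / (real p - 1) - 1 / real p) \<le> 1"
  proof -
    have tele: "(\<Sum>n\<in>{2..N}. 1 / (real n - 1) - 1 / real n) = 1 - 1 / real N" if "N \<ge> 1" for N
      using that by (induction N rule: dec_induct) (auto simp: sum.atLeast_Suc_atMost_Suc_shift)
    define N where "N = Max (insert 2 A)"
    have N: "N \<ge> 2" "A \<subseteq> {2..N}" using assms by (auto simp: N_def)
    have "(\<Sum>p\<in>A. 1 / (real p - 1) - 1 / real p) \<le> (\<Sum>n\<in>{2..N}. 1 / (real n - 1) - 1 / real n)"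
      using N by (intro sum_mono2) (auto simp: field_simps)
    also have "\<dots> \<le> 1" using N by (subst tele) auto
    finally show ?thesis .
  qed
  finally show ?thesis by simp
qed

text \<open>The primes dividing \<open>q\<close> are split at about \<open>log q\<close>. The small
  ones are compared with all primes up to that point; the large ones contribute at most 1, because
  their logarithms add up to at most \<open>ln q\<close>.\<close>

lemma divisor_sums_loglog_le:
  obtains K :: real where "K > 0"
    "\<And>q::nat. q \<ge> 16 \<Longrightarrow> (\<Sum>d | d dvd q. 1 / real d) \<le> K * (log 2 (log 2 q))^2"
    "\<And>q::nat. q \<ge> 16 \<Longrightarrow> (\<Sum>d | d dvd q. ln (real d) / real d) \<le> K * (log 2 (log 2 q))^3"
proof -
  \<comment> \<open>The exponent collects \<open>2 - 2 * ln (ln 2)\<close> from the primes up to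
    \<open>y\<close>, 1 from the primes above \<open>y\<close>, and 1 from
    \<open>prod_inverse_one_minus_le\<close>.\<close>
  define c where "c = exp (4 - 2 * ln (ln 2) :: real)"
  have main: "(\<Sum>d | d dvd q. 1 / real d) \<le> 4 * c * (log 2 (log 2 q))^2 \<and>
     (\<Sum>d | d dvd q. ln (real d) / real d) \<le> 40 * c * (log 2 (log 2 q))^3" if q: "q \<ge> 16" for q :: nat
  proof -
    define l where "l = log 2 q"
    define L where "L = log 2 l"
    have l4: "l \<ge> 4" using q by (simp add: l_def le_log_iff)
    have L2: "L \<ge> 2" using l4 by (simp add: L_def le_log_iff)
    \<comment> \<open>Large enough that dividing by \<open>p > y\<close> beats the total
      \<open>l * ln 2\<close> of the logarithms, and small enough that
      \<open>ln y \<le> 2 * L\<close>.\<close>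
    define y where "y = nat \<lceil>l\<rceil>"
    have y: "l \<le> y" "y \<le> l + 1" "y \<ge> 4" using l4 unfolding y_def by linarith+
    have "ln y \<le> ln (2 * l)" using y l4 by simp
    also have "\<dots> = ln 2 * (1 + L)" using l4 by (simp add: L_def log_def ln_mult distrib_left)
    also have "\<dots> \<le> 1 * (1 + L)" using L2 ln_2_less_1 by (intro mult_right_mono) auto
    finally have lny: "ln y \<le> 2 * L" using L2 by simp
    have lny1: "ln y \<ge> 1"
    proof -
      have "exp 1 \<le> real y" using e_less_272 y by simp
      then show ?thesis using y by (subst ln_ge_iff) auto
    qed
    let ?P = "prime_factors q"
    have p2: "p \<ge> 2" if "p \<in> ?P" for p using that by (auto intro: prime_ge_2_nat)
    have fin: "finite {p. prime p \<and> p \<le> y}" by (rule finite_subset[of _ "{..y}"]) auto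
    have split: "(\<Sum>p\<in>?P. f p) \<le> (\<Sum>p | prime p \<and> p \<le> y. f p) + (\<Sum>p\<in>{p\<in>?P. p > y}. f p)"
      if "\<And>p. prime p \<Longrightarrow> f p \<ge> 0" for f :: "nat \<Rightarrow> real"
    proof -
      have "(\<Sum>p\<in>?P. f p) = (\<Sum>p\<in>{p\<in>?P. p \<le> y}. f p) + (\<Sum>p\<in>{p\<in>?P. p > y}. f p)"
        by (subst sum.union_disjoint[symmetric]) (auto intro: sum.cong)
      moreover have "(\<Sum>p\<in>{p\<in>?P. p \<le> y}. f p) \<le> (\<Sum>p | prime p \<and> p \<le> y. f p)"
        using that fin by (intro sum_mono2) auto
      ultimately show ?thesis by simp
    qed
    have big: "(\<Sum>p\<in>{p\<in>?P. p > y}. ln (real p)) \<le> l * ln 2"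
    proof -
      have "(\<Sum>p\<in>{p\<in>?P. p > y}. ln (real p)) \<le> (\<Sum>p\<in>?P. ln (real p))"
        using p2 by (intro sum_mono2) force+
      also have "\<dots> \<le> ln q" using q by (intro sum_ln_prime_factors_le) auto
      finally show ?thesis by (simp add: l_def log_def)
    qed
    have big1: "(\<Sum>p\<in>{p\<in>?P. p > y}. ln (real p) / real p) \<le> 1"
    proof -
      have "(\<Sum>p\<in>{p\<in>?P. p > y}. ln (real p) / real p) \<le> (\<Sum>p\<in>{p\<in>?P. p > y}. ln (real p) / l)"
        using p2 y l4 by (intro sum_mono divide_left_mono) (force intro!: mult_pos_pos)+
      also have "\<dots> = (\<Sum>p\<in>{p\<in>?P. p > y}. ln (real p)) / l" by (rule sum_divide_distrib[symmetric])
      also have "\<dots> \<le> (l * ln 2) / l" using big l4 by (intro divide_right_mono) auto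
      also have "\<dots> \<le> 1" using l4 ln_2_less_1 by simp
      finally show ?thesis .
    qed
    have big2: "(\<Sum>p\<in>{p\<in>?P. p > y}. 1 / real p) \<le> 1"
    proof -
      have "(\<Sum>p\<in>{p\<in>?P. p > y}. 1 / real p) \<le> (\<Sum>p\<in>{p\<in>?P. p > y}. ln (real p) / real p)"
      proof (intro sum_mono divide_right_mono)
        fix p assume "p \<in> {p\<in>?P. p > y}"
        then have "ln (real y) \<le> ln (real p)" using y by auto
        then show "1 \<le> ln (real p)" using lny1 by linarith
      qed auto
      with big1 show ?thesis by linarith
    qed
    have s1: "(\<Sum>p\<in>?P. ln (real p) / real p) \<le> 4 * L + 1"
      using split[of "\<lambda>p. ln (real p) / real p"] big1 sum_ln_over_primes_le[of y] y lny
      by (force simp: prime_gt_0_nat Suc_le_eq intro!: divide_nonneg_nonneg)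
    have s2: "(\<Sum>p\<in>?P. 1 / real p) \<le> 2 * ln (ln y) + (3 - 2 * ln (ln 2))"
      using split[of "\<lambda>p. 1 / real p"] big2 sum_inverse_primes_le[of y] y by force
    define Q where "Q = (\<Prod>p\<in>?P. 1 / (1 - 1 / real p))"
    have "Q \<le> exp ((\<Sum>p\<in>?P. 1 / real p) + 1)"
      unfolding Q_def using p2 by (intro prod_inverse_one_minus_le) auto
    also have "\<dots> \<le> exp (2 * ln (ln y) + (4 - 2 * ln (ln 2)))" using s2 by simp
    also have "\<dots> = c * exp (ln (ln y)) ^ 2"
      unfolding c_def by (simp add: exp_add power2_eq_square flip: exp_add)
    also have "exp (ln (ln y)) = ln y" using lny1 by simp
    also have "c * (ln y) ^ 2 \<le> c * (2 * L) ^ 2"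
      using lny lny1 by (intro mult_left_mono power_mono) (auto simp: c_def)
    finally have Q: "Q \<le> 4 * c * L ^ 2" by (simp add: power_mult_distrib)
    have Q0: "Q \<ge> 0" unfolding Q_def using p2 by (intro prod_nonneg) (force simp: field_simps)
    have "(\<Sum>p\<in>?P. 2 * ln (real p) / real p) = 2 * (\<Sum>p\<in>?P. ln (real p) / real p)"
      by (simp add: sum_distrib_left)
    also have "\<dots> \<le> 10 * L" using s1 L2 by linarith
    finally have s3: "(\<Sum>p\<in>?P. 2 * ln (real p) / real p) \<le> 10 * L" .
    have "q > 0" using q by simp
    note ds = divisor_sums_le[OF this]
    have "(\<Sum>d | d dvd q. ln (real d) / real d) \<le> Q * (\<Sum>p\<in>?P. 2 * ln (real p) / real p)"
      using ds by (simp add: Q_def)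
    also have "\<dots> \<le> Q * (10 * L)" using s3 Q0 by (rule mult_left_mono)
    also have "\<dots> \<le> (4 * c * L ^ 2) * (10 * L)" using Q L2 by (intro mult_right_mono) auto
    also have "\<dots> = 40 * c * L ^ 3" by (simp add: power2_eq_square power3_eq_cube)
    finally have "(\<Sum>d | d dvd q. ln (real d) / real d) \<le> 40 * c * L ^ 3" .
    moreover have "(\<Sum>d | d dvd q. 1 / real d) \<le> 4 * c * L ^ 2"
      using ds Q unfolding Q_def by linarith
    ultimately show ?thesis by (simp add: L_def l_def)
  qed
  have c: "c > 0" by (simp add: c_def)
  show ?thesis
  proof (rule that[of "40 * c"])
    fix q :: nat assume q: "q \<ge> 16"
    have "4 * c * (log 2 (log 2 q))^2 \<le> 40 * c * (log 2 (log 2 q))^2" using c by (intro mult_right_mono) auto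
    then show "(\<Sum>d | d dvd q. 1 / real d) \<le> 40 * c * (log 2 (log 2 q))^2" using main[OF q] by linarith
  qed (use main c in auto)
qed

text \<open>The classical proof of the divisor bound: a prime power \<open>p ^ a\<close> contributes
  \<open>a + 1\<close>, compared with \<open>p powr (a * \<epsilon>)\<close>. The dependence on
  \<open>\<epsilon>\<close> is explicit because \<open>\<epsilon>\<close> later shrinks as
  \<open>q\<close> grows.\<close>

lemma card_divisors_le:
  fixes q :: nat and \<epsilon> :: real
  assumes "q > 0" "0 < \<epsilon>" "\<epsilon> \<le> 1"
  shows "card {d. d dvd q} \<le> (2 / \<epsilon>) powr (2 powr (1 / \<epsilon>)) * q powr \<epsilon>"
proof -
  define B where "B = 2 / \<epsilon>"
  define Y where "Y = 2 powr (1 / \<epsilon>)"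
  \<comment> \<open>From \<open>Y\<close> on, \<open>p powr (a * \<epsilon>)\<close> is at least
    \<open>2 ^ a\<close> and no constant is lost; each of the at most \<open>Y\<close> smaller
    primes costs a factor \<open>B\<close>.\<close>
  define h where "h p = (if real p < Y then B else 1)" for p :: nat
  have B1: "B \<ge> 1" using assms by (simp add: B_def field_simps)
  have h1: "h p \<ge> 1" for p using B1 by (simp add: h_def)
  have key: "real a + 1 \<le> h p * real p powr (a * \<epsilon>)" if "p \<ge> 2" for p a :: nat
  proof (cases "real p < Y")
    case True
    have hp: "h p = B" using True by (simp only: h_def if_True)
    have "\<epsilon> * real a * (1/2) \<le> \<epsilon> * real a * ln 2"
      using assms ln2_ge_two_thirds by (intro mult_left_mono) auto
    then have "1 + \<epsilon> * real a * (1/2) \<le> 1 + real a * \<epsilon> * ln 2" by (simp only: mult_ac add_left_mono)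
    also have "\<dots> \<le> exp (real a * \<epsilon> * ln 2)" by (rule exp_ge_add_one_self)
    also have "\<dots> = 2 powr (real a * \<epsilon>)" by (simp add: powr_def)
    also have "\<dots> \<le> real p powr (real a * \<epsilon>)" using that assms by (intro powr_mono2) auto
    finally have "B * (1 + \<epsilon> * real a * (1/2)) \<le> B * real p powr (real a * \<epsilon>)"
      using B1 by (intro mult_left_mono) auto
    moreover have "B * (1 + \<epsilon> * real a * (1/2)) = B + a" using assms by (simp add: B_def field_simps)
    ultimately have "B + a \<le> h p * real p powr (real a * \<epsilon>)" by (simp only: hp)
    moreover have "real a + 1 \<le> B + a" using B1 by simp
    ultimately show ?thesis by (rule order.trans[rotated])
  next
    case False
    then have hp: "h p = 1" by (simp only: h_def if_False)
    have "real a + 1 \<le> 2 ^ a" using Bernoulli_inequality[of "1::real" a] by simp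
    also have "\<dots> = (2 powr (1 / \<epsilon>)) powr (a * \<epsilon>)"
      using assms by (simp add: powr_powr powr_realpow)
    also have "\<dots> \<le> real p powr (a * \<epsilon>)"
      using assms False by (intro powr_mono2) (auto simp: Y_def)
    finally show ?thesis by (simp only: hp mult_1)
  qed
  have main: "card {d. d dvd q} \<le> (\<Prod>p\<in>prime_factors q. h p) * q powr \<epsilon>"
    using assms(1)
  proof (induction q rule: prime_power_induct)
    case one
    then show ?case by simp
  next
    case (prime_power p a m)
    have p2: "p \<ge> 2" using prime_power.hyps prime_ge_2_nat by blast
    have "real (card {d. d dvd p ^ a * m}) = (\<Sum>d | d dvd p ^ a * m. 1)" by simp
    also have "\<dots> \<le> (\<Sum>i\<le>a. \<Sum>e | e dvd m. 1)"
      using prime_power.hyps by (intro sum_divisors_prime_power_mult_le) auto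
    also have "\<dots> = (real a + 1) * card {d. d dvd m}" by simp
    also have "\<dots> \<le> (h p * real p powr (a * \<epsilon>)) * ((\<Prod>p\<in>prime_factors m. h p) * m powr \<epsilon>)"
      using prime_power.IH key[OF p2] h1[of p] by (intro mult_mono) auto
    also have "real p powr (a * \<epsilon>) = real (p ^ a) powr \<epsilon>"
      using p2 by (simp add: powr_powr flip: powr_realpow)
    also have "(h p * real (p ^ a) powr \<epsilon>) * ((\<Prod>p\<in>prime_factors m. h p) * m powr \<epsilon>)
       = (h p * (\<Prod>p\<in>prime_factors m. h p)) * real (p ^ a * m) powr \<epsilon>"
      by (simp add: powr_mult)
    also have "h p * (\<Prod>p\<in>prime_factors m. h p) = (\<Prod>p\<in>prime_factors (p ^ a * m). h p)"
      using prime_power.hyps by (auto simp: prime_factors_prime_power_mult in_prime_factors_iff)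
    finally show ?case .
  qed
  have "(\<Prod>p\<in>prime_factors q. h p) \<le> B powr Y"
  proof -
    let ?R = "{p \<in> prime_factors q. real p < Y}"
    have "(\<Prod>p\<in>prime_factors q. h p) = (\<Prod>p\<in>?R. B)"
      unfolding h_def by (subst prod.inter_filter[symmetric]) (auto intro: prod.cong)
    also have "\<dots> = B powr card ?R" using B1 by (simp add: powr_realpow)
    also have "\<dots> \<le> B powr Y"
    proof (intro powr_mono B1)
      have "?R \<subseteq> {1..nat \<lfloor>Y\<rfloor>}"
        by (auto simp: Suc_le_eq le_nat_iff le_floor_iff in_prime_factors_iff prime_gt_0_nat)
      then have "card ?R \<le> card {1..nat \<lfloor>Y\<rfloor>}" by (intro card_mono) auto
      then have "real (card ?R) \<le> nat \<lfloor>Y\<rfloor>" by simp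
      also have "\<dots> \<le> Y" by (simp add: Y_def)
      finally show "real (card ?R) \<le> Y" .
    qed
    finally show ?thesis .
  qed
  then have "(\<Prod>p\<in>prime_factors q. h p) * q powr \<epsilon> \<le> B powr Y * q powr \<epsilon>"
    by (rule mult_right_mono) simp
  with main show ?thesis unfolding B_def Y_def by (rule order.trans)
qed

section \<open>Overlap sums for a fixed denominator\<close>

lemma inverse_le_imp:
  fixes d y :: real
  assumes "0 < y" "1 / y \<le> d"
  shows "0 < d \<and> 1 / d \<le> y"
proof -
  have "0 < 1 / y" using assms by simp
  then have "0 < d" using assms by linarith
  then show ?thesis using assms by (simp add: field_simps)
qed

lemma sum_cover_le:
  fixes f :: "'b \<Rightarrow> real"
  assumes "finite I" "\<And>i. i \<in> I \<Longrightarrow> finite (B i)" "R \<subseteq> (\<Union>i\<in>I. B i)"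
    and nonneg: "\<And>i x. i \<in> I \<Longrightarrow> x \<in> B i \<Longrightarrow> 0 \<le> f x"
  shows "(\<Sum>x\<in>R. f x) \<le> (\<Sum>i\<in>I. \<Sum>x\<in>B i. f x)"
proof -
  have fin: "finite (Sigma I B)" using assms by auto
  have "(\<Sum>x\<in>R. f x) \<le> (\<Sum>x\<in>snd ` Sigma I B. f x)"
    using fin assms(3) nonneg by (intro sum_mono2) force+
  also have "\<dots> \<le> (\<Sum>y\<in>Sigma I B. f (snd y))"
    using sum_image_le[OF fin, of f snd] nonneg by (fastforce simp: o_def)
  also have "\<dots> = (\<Sum>i\<in>I. \<Sum>x\<in>B i. f x)"
    using assms by (subst sum.Sigma) (auto simp: split_def)
  finally show ?thesis .
qed

text \<open>The two-dimensional count with a trivial second coordinate: radius 2 is no condition,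
  and \<open>\<bar>k2\<bar> \<le> 1 / 2\<close> forces \<open>k2 = 0\<close>.\<close>

lemma card_near_le:
  fixes \<alpha> c D \<epsilon> :: real and N :: nat
  assumes "\<epsilon> > 0"
    and D: "\<And>k :: int. k \<noteq> 0 \<Longrightarrow> of_int \<bar>k\<bar> \<le> 1 / \<epsilon> \<Longrightarrow>
       dist_nint (of_int k * \<alpha>) > 0 \<and> 1 / dist_nint (of_int k * \<alpha>) \<le> D"
    and "D \<ge> 0"
  shows "card {n \<in> {..<N}. dist_nint (real n * \<alpha> + c) \<le> \<epsilon>} \<le> 8192 * real N * \<epsilon> + 32 * D"
proof -
  have "card {n \<in> {0..<0+N}. dist_nint (real n * \<alpha> + c) \<le> \<epsilon> \<and> dist_nint (real n * 0 + 0) \<le> 2}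
     \<le> 4096 * real N * \<epsilon> * 2 + 32 * D"
  proof (rule card_box_le)
    fix k1 k2 :: int assume k: "(k1, k2) \<noteq> (0, 0)" "of_int \<bar>k1\<bar> \<le> 1 / \<epsilon>" "of_int \<bar>k2\<bar> \<le> 1 / (2::real)"
    then have "k2 = 0" by linarith
    then show "dist_nint (of_int k1 * \<alpha> + of_int k2 * 0) > 0 \<and> 1 / dist_nint (of_int k1 * \<alpha> + of_int k2 * 0) \<le> D"
      using D[of k1] k by simp
  qed (use assms in auto)
  moreover have "dist_nint 0 \<le> 2" using dist_nint_le_half[of 0] by linarith
  ultimately show ?thesis by (simp add: atLeast0LessThan)
qed

text \<open>The level is the floor of \<open>log 2 (1 / a)\<close>. Since
  \<open>a \<le> 1 / 2\<close> the levels start at 1, so there are at most \<open>log 2 A\<close> of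
  them with no additive constant.\<close>

lemma dyadic_level:
  fixes a A :: real
  assumes "1 / A \<le> a" "a \<le> 1/2" "0 < A"
  obtains i :: nat where "i \<in> {1..nat \<lfloor>log 2 A\<rfloor>}" "1 / 2 ^ (i + 1) < a" "a \<le> 1 / 2 ^ i"
proof -
  have a0: "a > 0" using assms by (meson divide_pos_pos less_le_trans zero_less_one)
  define x where "x = log 2 (1 / a)"
  have x1: "x \<ge> 1" using assms a0 by (simp add: x_def le_log_iff field_simps)
  have xA: "x \<le> log 2 A" unfolding x_def using assms a0 by (intro log_mono) (auto simp: field_simps)
  define i where "i = nat \<lfloor>x\<rfloor>"
  have i: "real i \<le> x" "x < real i + 1" "i \<ge> 1" using x1 unfolding i_def by linarith+
  have "i \<le> nat \<lfloor>log 2 A\<rfloor>" unfolding i_def using xA by (intro nat_mono floor_mono)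
  have px: "2 powr x = 1 / a" using a0 by (simp add: x_def)
  have "2 powr real i \<le> 2 powr x" using i by simp
  then have "2 ^ i \<le> 1 / a" by (simp add: px powr_realpow)
  then have 1: "a \<le> 1 / 2 ^ i" using a0 by (simp add: field_simps)
  have "2 powr x < 2 powr (real (i + 1))" using i by simp
  then have "1 / a < 2 ^ (i + 1)" by (simp only: px powr_realpow zero_less_numeral)
  then have 2: "1 / 2 ^ (i + 1) < a" using a0 by (simp add: field_simps)
  show ?thesis using that 1 2 i \<open>i \<le> _\<close> by auto
qed

text \<open>The points of a dyadic block are sorted by the size of \<open>dist_nint (g n \<beta> - \<gamma>')\<close>.
  On level \<open>i\<close> this size is about \<open>2\<^sup>-\<^sup>i\<close>, which gains a factor \<open>2\<^sup>-\<^sup>i\<close> in the number of points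
  and loses a factor \<open>2\<^sup>i\<close> in the bound for \<open>\<delta>\<close>, so that every level contributes the same amount.\<close>

lemma dyadic_block_sum_le:
  fixes \<beta> \<gamma> \<gamma>' \<delta>q Y B A D :: real and q' g :: nat and S :: "nat set" and \<delta> :: "nat \<Rightarrow> real"
  assumes pos: "q' > 0" "g > 0" "\<delta>q > 0" "B > 0" "A \<ge> 1" "Y > 0" "D \<ge> 0"
    and \<delta>: "\<And>n. Y / 2 < real n \<Longrightarrow> real n \<le> Y \<Longrightarrow> g * n \<in> S \<Longrightarrow>
        0 < \<delta> (g * n) \<and> 1 / A \<le> dist_nint (real (g * n) * \<beta> - \<gamma>') \<and>
        \<delta> (g * n) \<le> B / dist_nint (real (g * n) * \<beta> - \<gamma>')"
    and D: "\<And>k1 k2 :: int. (k1, k2) \<noteq> (0, 0) \<Longrightarrow> of_int \<bar>k1\<bar> \<le> 1 / (q' * B) \<Longrightarrow> of_int \<bar>k2\<bar> \<le> A \<Longrightarrow>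
       dist_nint (of_int k1 * \<gamma> + of_int k2 * (g * \<beta>)) > 0 \<and>
       1 / dist_nint (of_int k1 * \<gamma> + of_int k2 * (g * \<beta>)) \<le> D"
  defines "T \<equiv> {n. Y / 2 < real n \<and> real n \<le> Y \<and> g * n \<in> S \<and>
        dist_nint ((real n - real q') * \<gamma>) < n * \<delta>q + q' * \<delta> (g * n)}"
  shows "(\<Sum>n\<in>T. min (1 / q') (\<delta> (g * n) / (n * \<delta>q))) \<le> log 2 A * (49152 * Y * B + 32 * D / q')"
proof (cases "Y \<ge> 1")
  case False
  have "T = {}"
  proof (rule ccontr)
    assume "T \<noteq> {}"
    then obtain n where "n \<in> T" by blast
    then have "real n > 0" "real n < 1" using pos False by (auto simp: T_def)
    then show False by simp
  qed
  then show ?thesis using pos by simp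
next
  case Y1: True
  define I where "I = nat \<lfloor>log 2 A\<rfloor>"
  have I: "real I \<le> log 2 A" using pos by (simp add: I_def)
  define a where "a n = dist_nint (real (g * n) * \<beta> - \<gamma>')" for n
  define Ti where "Ti i = {n \<in> T. 1 / 2 ^ (i + 1) < a n \<and> a n \<le> 1 / 2 ^ i}" for i :: nat
  define N where "N = nat \<lfloor>Y\<rfloor> + 1"
  have N: "real N \<le> 2 * Y" "\<And>n. real n \<le> Y \<Longrightarrow> n < N" using Y1 unfolding N_def by linarith+
  have fT: "finite T" by (rule finite_subset[of _ "{..<N}"]) (use N in \<open>auto simp: T_def\<close>)
  have bound: "(\<Sum>n\<in>Ti i. min (1 / q') (\<delta> (g * n) / (n * \<delta>q))) \<le> 49152 * Y * B + 32 * D / q'"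
    if i: "i \<in> {1..I}" for i
  proof -
    \<comment> \<open>\<open>Di\<close> bounds \<open>\<delta> (g * n)\<close> on level
      \<open>i\<close>, \<open>\<epsilon>\<close> the right side of the overlap condition, and
      \<open>m\<close> each summand.\<close>
    define Di where "Di = 2 ^ (i + 1) * B"
    define \<epsilon> where "\<epsilon> = Y * \<delta>q + q' * Di"
    define m where "m = min (1 / q') (2 * Di / (Y * \<delta>q))"
    have Di0: "Di > 0" using pos by (simp add: Di_def)
    have \<epsilon>0: "\<epsilon> > 0" using pos Di0 by (simp add: \<epsilon>_def add_pos_pos)
    have m0: "m \<ge> 0" using pos Di0 by (simp add: m_def)
    have \<delta>le: "\<delta> (g * n) \<le> Di" if n: "n \<in> Ti i" for n
    proof -
      have "\<delta> (g * n) \<le> B / a n" using n \<delta>[of n] by (auto simp: Ti_def T_def a_def)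
      also have "\<dots> \<le> B / (1 / 2 ^ (i + 1))"
      proof (rule divide_left_mono)
        have "0 < 1 / (2::real) ^ (i + 1)" by simp
        moreover have lt: "1 / 2 ^ (i + 1) < a n" using n by (simp add: Ti_def)
        ultimately have "0 < a n" by (rule less_trans)
        then show "0 < a n * (1 / 2 ^ (i + 1))" by simp
        show "1 / 2 ^ (i + 1) \<le> a n" using lt by simp
      qed (use pos in auto)
      also have "\<dots> = Di" by (simp add: Di_def)
      finally show ?thesis .
    qed
    have "(\<Sum>n\<in>Ti i. min (1 / q') (\<delta> (g * n) / (n * \<delta>q))) \<le> (\<Sum>n\<in>Ti i. m)"
    proof (rule sum_mono)
      fix n assume n: "n \<in> Ti i"
      then have nY: "Y / 2 \<le> real n" by (auto simp: Ti_def T_def)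
      have "\<delta> (g * n) / (n * \<delta>q) \<le> Di / ((Y / 2) * \<delta>q)"
        using \<delta>le[OF n] nY pos Di0 by (intro frac_le mult_right_mono mult_pos_pos) auto
      also have "\<dots> = 2 * Di / (Y * \<delta>q)" by simp
      finally show "min (1 / q') (\<delta> (g * n) / (n * \<delta>q)) \<le> m" unfolding m_def by (rule min.mono[OF order.refl])
    qed
    also have "\<dots> = card (Ti i) * m" by simp
    also have "\<dots> \<le> (4096 * (2 * Y) * \<epsilon> * (1 / 2 ^ i) + 32 * D) * m"
    proof (rule mult_right_mono[OF _ m0])
      have "Ti i \<subseteq> {n \<in> {0..<0+N}. dist_nint (real n * \<gamma> + (- (q' * \<gamma>))) \<le> \<epsilon> \<and> dist_nint (real n * (g * \<beta>) + (- \<gamma>')) \<le> 1 / 2 ^ i}"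
      proof
        fix n assume n: "n \<in> Ti i"
        then have nY: "real n \<le> Y" and lt: "dist_nint ((real n - real q') * \<gamma>) < n * \<delta>q + q' * \<delta> (g * n)"
          by (auto simp: Ti_def T_def)
        have "n * \<delta>q + q' * \<delta> (g * n) \<le> \<epsilon>"
          unfolding \<epsilon>_def using nY \<delta>le[OF n] pos by (intro add_mono mult_right_mono mult_left_mono) auto
        with lt have "dist_nint (real n * \<gamma> + (- (q' * \<gamma>))) \<le> \<epsilon>" by (simp add: left_diff_distrib)
        then show "n \<in> {n \<in> {0..<0+N}. dist_nint (real n * \<gamma> + (- (q' * \<gamma>))) \<le> \<epsilon> \<and> dist_nint (real n * (g * \<beta>) + (- \<gamma>')) \<le> 1 / 2 ^ i}"
          using n N(2)[OF nY] by (simp add: Ti_def a_def mult_ac)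
      qed
      then have "card (Ti i) \<le> card {n \<in> {0..<0+N}. dist_nint (real n * \<gamma> + (- (q' * \<gamma>))) \<le> \<epsilon> \<and> dist_nint (real n * (g * \<beta>) + (- \<gamma>')) \<le> 1 / 2 ^ i}"
        by (intro card_mono) auto
      then have "real (card (Ti i)) \<le> card {n \<in> {0..<0+N}. dist_nint (real n * \<gamma> + (- (q' * \<gamma>))) \<le> \<epsilon> \<and> dist_nint (real n * (g * \<beta>) + (- \<gamma>')) \<le> 1 / 2 ^ i}"
        by (rule of_nat_mono)
      also have "\<dots> \<le> 4096 * real N * \<epsilon> * (1 / 2 ^ i) + 32 * D"
      proof (rule card_box_le)
        fix k1 k2 :: int
        assume k: "(k1, k2) \<noteq> (0, 0)" "of_int \<bar>k1\<bar> \<le> 1 / \<epsilon>" "of_int \<bar>k2\<bar> \<le> 1 / (1 / (2::real) ^ i)"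
        \<comment> \<open>Since \<open>\<epsilon> \<ge> q' * B\<close> and
          \<open>2 ^ i \<le> A\<close>, one range of frequencies, hence one \<open>D\<close>, serves
          all levels.\<close>
        have "B * 1 \<le> B * 2 ^ (i + 1)" using pos by (intro mult_left_mono one_le_power) auto
        then have "q' * B \<le> q' * Di" unfolding Di_def by (intro mult_left_mono) (simp_all add: mult_ac)
        also have "\<dots> \<le> \<epsilon>" using pos by (simp add: \<epsilon>_def)
        finally have "1 / \<epsilon> \<le> 1 / (q' * B)" using pos by (intro divide_left_mono mult_pos_pos \<epsilon>0) auto
        moreover have "2 ^ i \<le> A"
        proof -
          have "real i \<le> log 2 A" using i I by auto
          then have "2 powr real i \<le> A" using pos by (simp add: le_log_iff)
          then show ?thesis by (simp add: powr_realpow)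
        qed
        ultimately show "dist_nint (of_int k1 * \<gamma> + of_int k2 * (g * \<beta>)) > 0 \<and>
           1 / dist_nint (of_int k1 * \<gamma> + of_int k2 * (g * \<beta>)) \<le> D"
          using k by (intro D) auto
      qed (use \<epsilon>0 pos in auto)
      also have "\<dots> \<le> 4096 * (2 * Y) * \<epsilon> * (1 / 2 ^ i) + 32 * D"
        using N \<epsilon>0 by (intro add_right_mono mult_right_mono mult_left_mono) auto
      finally show "card (Ti i) \<le> 4096 * (2 * Y) * \<epsilon> * (1 / 2 ^ i) + 32 * D" .
    qed
    also have "\<dots> = 8192 * Y * (1 / 2 ^ i) * (m * \<epsilon>) + 32 * D * m" by (simp add: algebra_simps)
    \<comment> \<open>Each entry of the minimum \<open>m\<close> controls one summand of
      \<open>\<epsilon>\<close>: the second gives \<open>2 * Di\<close>, the first gives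
      \<open>Di\<close>. The \<open>2 ^ i\<close> in \<open>Di\<close> then cancels.\<close>
    also have "\<dots> \<le> 8192 * Y * (1 / 2 ^ i) * (3 * Di) + 32 * D * (1 / q')"
    proof (intro add_mono mult_left_mono)
      have "m * (Y * \<delta>q) \<le> 2 * Di / (Y * \<delta>q) * (Y * \<delta>q)"
        using pos by (intro mult_right_mono) (auto simp: m_def)
      also have "\<dots> = 2 * Di" using pos by simp
      finally have 1: "m * (Y * \<delta>q) \<le> 2 * Di" .
      have "m * (q' * Di) \<le> 1 / q' * (q' * Di)" using Di0 by (intro mult_right_mono) (auto simp: m_def)
      also have "\<dots> = Di" using pos by simp
      finally show "m * \<epsilon> \<le> 3 * Di" using 1 by (simp add: \<epsilon>_def distrib_left)
    qed (use pos in \<open>auto simp: m_def\<close>)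
    also have "\<dots> = 49152 * Y * B + 32 * D / q'" by (simp add: Di_def)
    finally show ?thesis .
  qed
  have sub: "T \<subseteq> (\<Union>i\<in>{1..I}. Ti i)"
  proof
    fix n assume n: "n \<in> T"
    have "1 / A \<le> a n" using n \<delta>[of n] by (auto simp: T_def a_def)
    moreover have "a n \<le> 1/2" unfolding a_def by (rule dist_nint_le_half)
    ultimately obtain i where "i \<in> {1..I}" "1 / 2 ^ (i + 1) < a n" "a n \<le> 1 / 2 ^ i"
      using dyadic_level[of A "a n"] pos unfolding I_def by auto
    then show "n \<in> (\<Union>i\<in>{1..I}. Ti i)" using n by (auto simp: Ti_def)
  qed
  have nn: "0 \<le> min (1 / q') (\<delta> (g * n) / (n * \<delta>q))" if "n \<in> T" for n
    using that \<delta>[of n] pos by (auto simp: T_def)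
  have fTi: "finite (Ti i)" for i using fT by (auto simp: Ti_def)
  have "(\<Sum>n\<in>T. min (1 / q') (\<delta> (g * n) / (n * \<delta>q)))
     \<le> (\<Sum>i\<in>{1..I}. \<Sum>n\<in>Ti i. min (1 / q') (\<delta> (g * n) / (n * \<delta>q)))"
    using sub fTi by (intro sum_cover_le nn) (auto simp: Ti_def)
  also have "\<dots> \<le> (\<Sum>i\<in>{1..I}. 49152 * Y * B + 32 * D / q')" by (intro sum_mono bound)
  also have "\<dots> = I * (49152 * Y * B + 32 * D / q')" by simp
  also have "\<dots> \<le> log 2 A * (49152 * Y * B + 32 * D / q')" using I pos by (intro mult_right_mono) auto
  finally show ?thesis .
qed

lemma sum_by_gcd:
  fixes F :: "nat \<Rightarrow> real"
  assumes "finite R" "q > 0" "0 \<notin> R"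
  shows "(\<Sum>r\<in>R. F r) = (\<Sum>g | g dvd q. \<Sum>n | g * n \<in> R \<and> gcd q (g * n) = g. F (g * n))"
proof -
  have "(\<Sum>r\<in>R. F r) = (\<Sum>g | g dvd q. \<Sum>r\<in>{r \<in> R. gcd q r = g}. F r)"
    using assms by (intro sum.group[symmetric]) auto
  also have "\<dots> = (\<Sum>g | g dvd q. \<Sum>n | g * n \<in> R \<and> gcd q (g * n) = g. F (g * n))"
  proof (rule sum.cong[OF refl])
    fix g assume "g \<in> {g. g dvd q}"
    then have g: "g > 0" using assms by (auto intro!: Nat.gr0I)
    have "inj_on ((*) g) {n. g * n \<in> R \<and> gcd q (g * n) = g}" using g by (auto simp: inj_on_def)
    moreover have "(*) g ` {n. g * n \<in> R \<and> gcd q (g * n) = g} = {r \<in> R. gcd q r = g}"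
    proof (intro equalityI subsetI)
      fix r assume r: "r \<in> {r \<in> R. gcd q r = g}"
      then have "g dvd r" by (metis (mono_tags) gcd_dvd2 mem_Collect_eq)
      then obtain n where "r = g * n" unfolding dvd_def by blast
      with r show "r \<in> (*) g ` {n. g * n \<in> R \<and> gcd q (g * n) = g}" by auto
    qed auto
    ultimately show "(\<Sum>r\<in>{r \<in> R. gcd q r = g}. F r) = (\<Sum>n | g * n \<in> R \<and> gcd q (g * n) = g. F (g * n))"
      using sum.reindex[of "(*) g" "{n. g * n \<in> R \<and> gcd q (g * n) = g}" F] by (simp add: o_def)
  qed
  finally show ?thesis .
qed

text \<open>A square root halves the logarithm and lowers the iterated logarithm by 1, which is at
  most half of a value that is at least 4.\<close>

lemma log_log_ge_half:
  fixes q r :: real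
  assumes "q > 0" "16 \<le> log 2 q" "4 \<le> log 2 (log 2 q)" "sqrt q \<le> r"
  shows "r > 0" "log 2 q / 2 \<le> log 2 r" "log 2 (log 2 q) / 2 \<le> log 2 (log 2 r)"
proof -
  have q1: "sqrt q > 0" using assms by simp
  show "r > 0" using q1 assms by linarith
  have "log 2 q / 2 = log 2 (sqrt q)" using assms by (simp add: log_def ln_sqrt)
  also have "\<dots> \<le> log 2 r" using assms q1 by (intro log_mono) auto
  finally show 1: "log 2 q / 2 \<le> log 2 r" .
  have "log 2 (log 2 q) / 2 \<le> log 2 (log 2 q) - 1" using assms by simp
  also have "\<dots> = log 2 (log 2 q / 2)" using assms by (simp add: log_divide)
  also have "\<dots> \<le> log 2 (log 2 r)" using 1 assms by (intro log_mono) linarith+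
  finally show "log 2 (log 2 q) / 2 \<le> log 2 (log 2 r)" .
qed

text \<open>\<open>s\<close> is an exponent for the Diophantine condition up to height
  \<open>q\<close>. The scales interlock: \<open>sqrt q = t powr (16 * s)\<close>, so the condition
  at height \<open>t ^ 16\<close> gives \<open>1 / sqrt q\<close>, while at height
  \<open>z powr (2 * s)\<close> it gives more than \<open>1 / t ^ 4\<close>. The form of
  \<open>diophantine\<close>, with a real height \<open>M\<close> and all nonzero pairs, includes
  pairs of maximum 1.\<close>

locale overlap_scale =
  fixes \<gamma> \<beta> \<gamma>' C s z t L LL :: real and q :: nat and \<psi> :: "nat \<Rightarrow> real" and S :: "nat set"
    and a \<delta> :: "nat \<Rightarrow> real"
  defines "t \<equiv> z powr (s ^ 2)" and "L \<equiv> log 2 (real q)" and "LL \<equiv> log 2 L"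
    and "a \<equiv> \<lambda>r. dist_nint (real r * \<beta> - \<gamma>')" and "\<delta> \<equiv> \<lambda>r. \<psi> r / a r"
  assumes s: "s \<ge> 2" and z: "z \<ge> 2" and C: "C \<ge> 1" and Cz: "2 * C \<le> z"
    and q_eq: "real q = z powr (32 * s ^ 3)" and LL4: "LL \<ge> 4"
    and polylog: "32 * L * LL ^ 3 \<le> z" and tau: "real (card {d. d dvd q}) \<le> z"
    and diophantine: "\<And>k1 k2 M. (k1, k2) \<noteq> (0, 0) \<Longrightarrow> 2 \<le> M \<Longrightarrow> M \<le> real q \<Longrightarrow>
       of_int \<bar>k1\<bar> \<le> M \<Longrightarrow> of_int \<bar>k2\<bar> \<le> M \<Longrightarrow> M powr (- s) \<le> dist_nint (of_int k1 * \<gamma> + of_int k2 * \<beta>)"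
    and qS: "q \<in> S" and S0: "0 \<notin> S"
    and a_pos: "\<And>r. r \<in> S \<Longrightarrow> 0 < a r"
    and \<psi>_pos: "\<And>r. r \<in> S \<Longrightarrow> 0 < \<psi> r"
    and \<psi>_le: "\<And>r. r \<in> S \<Longrightarrow> \<psi> r \<le> C / (real r * log 2 (real r) * (log 2 (log 2 (real r))) ^ 3)"
    and a_ge: "\<And>r. r \<in> S \<Longrightarrow> sqrt (real q) \<le> real r \<Longrightarrow> r \<le> q \<Longrightarrow> 1 / t \<le> a r"
begin

lemma t_ge_z: "z \<le> t"
proof -
  have "z powr 1 \<le> z powr (s ^ 2)" using z s by (intro powr_mono) (auto simp: one_le_power)
  then show ?thesis using z by (simp add: t_def)
qed

lemma t2: "t \<ge> 2" using t_ge_z z by simp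

lemma q_eq_t: "real q = t powr (32 * s)"
  unfolding q_eq t_def by (simp add: powr_powr power2_eq_square power3_eq_cube mult_ac)

lemma sqrt_q: "sqrt (real q) = t powr (16 * s)"
  unfolding q_eq_t using t2 by (simp add: powr_half_sqrt[symmetric] powr_powr)

lemma q_pos: "q > 0"
  using q_eq z by (metis of_nat_0_less_iff powr_gt_zero less_le_trans zero_less_numeral order_less_irrefl)

text \<open>The limit 32 is \<open>16 * s\<close> at the least admissible
  \<open>s = 2\<close>.\<close>

lemma t_power_le_sqrt: "n \<le> 32 \<Longrightarrow> t ^ n \<le> sqrt (real q)"
proof -
  assume n: "n \<le> 32"
  have "t ^ n = t powr real n" using t2 by (simp add: powr_realpow)
  also have "\<dots> \<le> t powr (16 * s)" using t2 n s by (intro powr_mono) auto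
  finally show ?thesis by (simp add: sqrt_q)
qed

lemma sqrt_le_q: "sqrt (real q) \<le> real q"
proof -
  have "sqrt (real q) * 1 \<le> sqrt (real q) * sqrt (real q)" using q_pos by (intro mult_left_mono) auto
  then show ?thesis by simp
qed

lemma L16: "L \<ge> 16"
proof (rule ccontr)
  assume *: "\<not> L \<ge> 16"
  have "L > 0" using LL4 q_pos q_eq_t t2 s unfolding L_def by (simp add: log_powr)
  then have "LL < 4" using * by (simp add: LL_def log_less_iff)
  then show False using LL4 by simp
qed

lemma log_lower:
  assumes "sqrt (real q) \<le> r"
  shows "L / 2 \<le> log 2 r" "LL / 2 \<le> log 2 (log 2 r)" "r > 0"
  using log_log_ge_half[of q r] assms q_pos L16 LL4 by (auto simp: L_def LL_def)

text \<open>The factor 16 is 2 for the halved logarithm times \<open>2 ^ 3\<close> for the cube of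
  the halved double logarithm.\<close>

lemma \<psi>_le_ge:
  assumes "r \<in> S" "0 < R" "R \<le> real r" "sqrt (real q) \<le> real r"
  shows "\<psi> r \<le> 16 * C / (R * L * LL ^ 3)"
proof -
  note l = log_lower[OF assms(4)]
  have "R * (L / 2) * (LL / 2) ^ 3 \<le> real r * log 2 r * (log 2 (log 2 r)) ^ 3"
    using l assms L16 LL4 by (intro mult_mono power_mono mult_nonneg_nonneg) auto
  moreover have "0 < R * (L / 2) * (LL / 2) ^ 3" using assms L16 LL4 by (intro mult_pos_pos) auto
  ultimately have "C / (real r * log 2 r * (log 2 (log 2 r)) ^ 3) \<le> C / (R * (L / 2) * (LL / 2) ^ 3)"
    using C by (intro divide_left_mono mult_pos_pos[of "real r * log 2 r * (log 2 (log 2 r)) ^ 3"]) (simp | linarith)+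
  then show ?thesis using \<psi>_le[OF assms(1)] by (simp add: power_divide field_simps)
qed

text \<open>The necessary condition of \<open>near_set_Int_nonempty\<close> for \<open>q\<close> and
  \<open>r = g * n\<close>, when \<open>g\<close> divides \<open>q\<close>.\<close>

definition overlap_cond :: "nat \<Rightarrow> nat \<Rightarrow> bool" where
  "overlap_cond g n \<longleftrightarrow> dist_nint ((real n - real (q div g)) * \<gamma>) < real n * \<delta> q + real (q div g) * \<delta> (g * n)"

lemma \<delta>_pos: "r \<in> S \<Longrightarrow> 0 < \<delta> r"
  using a_pos \<psi>_pos by (simp add: \<delta>_def)

text \<open>A crude bound: the logarithms in the bound for \<open>\<psi>\<close> only cancel the
  factor 16, and dividing by \<open>a r\<close> costs at most \<open>t\<close>.\<close>

lemma \<delta>_le: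
  assumes "r \<in> S" "0 < R" "R \<le> real r" "sqrt (real q) \<le> real r" "r \<le> q"
  shows "\<delta> r \<le> C * t / R"
proof -
  have LLL: "16 * 1 \<le> L * LL ^ 3" using L16 LL4 by (intro mult_mono one_le_power) auto
  have "\<psi> r \<le> 16 * C / (R * L * LL ^ 3)" using assms by (intro \<psi>_le_ge)
  also have "\<dots> = C / R * (16 / (L * LL ^ 3))" by (simp add: mult_ac)
  also have "\<dots> \<le> C / R * 1" using LLL C assms by (intro mult_left_mono) (auto simp: divide_le_eq_1)
  finally have \<psi>: "\<psi> r \<le> C / R" by simp
  have "1 / t \<le> a r" using assms by (intro a_ge)
  then have "1 / a r \<le> t" using t2 inverse_le_imp[of t "a r"] by simp
  then have "\<psi> r * (1 / a r) \<le> (C / R) * t"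
    using \<psi> \<psi>_pos[OF assms(1)] a_pos[OF assms(1)] C assms by (intro mult_mono) auto
  then show ?thesis by (simp add: \<delta>_def)
qed

text \<open>From \<open>2 * C \<le> t\<close> and \<open>t ^ 2 \<le> q\<close>. Up to 1/2 the
  measure of \<open>near_set\<close> is exactly twice the radius.\<close>

lemma \<delta>_q_le_half: "\<delta> q \<le> 1 / 2"
proof -
  have "\<delta> q \<le> C * t / q" using qS q_pos sqrt_le_q by (intro \<delta>_le) auto
  also have "\<dots> \<le> (t / 2) * t / t ^ 2"
  proof (intro frac_le mult_right_mono)
    show "t ^ 2 \<le> real q" using t_power_le_sqrt[of 2] sqrt_le_q by simp
  qed (use Cz t_ge_z t2 C in auto)
  also have "\<dots> = 1 / 2" using t2 by (simp add: power2_eq_square)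
  finally show ?thesis .
qed

text \<open>\<open>dyadic_block_sum_le\<close> with \<open>A = t\<close> and
  \<open>D = sqrt q\<close>. The at most \<open>log 2 t \<le> L\<close> levels cancel the factor
  \<open>L\<close> in the bound for \<open>\<psi>\<close> and leave \<open>1 / (g * LL ^ 3)\<close>;
  \<open>1572864 = 49152 * 32\<close>.\<close>

lemma small_gcd_block:
  assumes g: "g dvd q" "real g \<le> t ^ 8" and Y: "real (q div g) / (g * LL ^ 3) \<le> Y" "Y \<le> real (q div g)"
  shows "(\<Sum>n | Y / 2 < real n \<and> real n \<le> Y \<and> g * n \<in> S \<and> overlap_cond g n.
       min (1 / real (q div g)) (\<delta> (g * n) / (n * \<delta> q))) \<le> (1572864 * C + 1) / (g * LL ^ 3)"
proof -
  define q' where "q' = q div g"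
  have qg: "q = g * q'" using g by (simp add: q'_def)
  have g0: "g > 0" "q' > 0" using q_pos qg by auto
  have rqg: "real q = real g * real q'" by (simp add: qg)
  have LL0: "LL > 0" "L > 0" using LL4 L16 by auto
  have "LL ^ 3 * 1 \<le> LL ^ 3 * (32 * L)" using LL0 L16 by (intro mult_left_mono) auto
  then have LLz: "LL ^ 3 \<le> t" using polylog t_ge_z by (simp add: mult_ac)
  have t1: "t \<ge> 1" using t2 by simp
  have Y0: "Y > 0"
  proof -
    have "real (q div g) / (g * LL ^ 3) > 0" using g0 LL0 by (simp add: q'_def)
    then show ?thesis using Y by linarith
  qed
  \<comment> \<open>The lower limit on \<open>Y\<close> places every \<open>g * n\<close> of the
    block above \<open>sqrt q\<close>, where the bounds for \<open>\<psi>\<close> and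
    \<open>a\<close> apply.\<close>
  have gY: "sqrt (real q) \<le> g * Y / 2"
  proof -
    have "2 * (g * LL ^ 3) \<le> t * (t ^ 8 * t)"
      using t2 g LLz LL0 by (intro mult_mono) auto
    also have "\<dots> = t ^ 10" by (simp add: eval_nat_numeral)
    also have "\<dots> \<le> sqrt (real q)" by (rule t_power_le_sqrt) simp
    finally have "sqrt (real q) * (2 * (g * LL ^ 3)) \<le> sqrt (real q) * sqrt (real q)"
      by (intro mult_left_mono) auto
    then have "sqrt (real q) * (2 * (g * LL ^ 3)) \<le> real q" by simp
    then have "sqrt (real q) \<le> g * (q' / (g * LL ^ 3)) / 2"
      using g0 LL0 by (simp add: rqg field_simps)
    also have "\<dots> \<le> g * Y / 2" using Y g0 by (intro divide_right_mono mult_left_mono) (auto simp: q'_def)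
    finally show ?thesis .
  qed
  \<comment> \<open>This is \<open>\<psi>_le_ge\<close> with \<open>R = g * Y / 2\<close>.\<close>
  define B where "B = 32 * C / (g * Y * L * LL ^ 3)"
  have B0: "B > 0" using C g0 Y0 LL0 by (simp add: B_def)
  have "(\<Sum>n | Y / 2 < real n \<and> real n \<le> Y \<and> g * n \<in> S \<and>
        dist_nint ((real n - real q') * \<gamma>) < n * \<delta> q + q' * \<delta> (g * n).
       min (1 / real q') (\<delta> (g * n) / (n * \<delta> q))) \<le> log 2 t * (49152 * Y * B + 32 * sqrt q / q')"
  proof (rule dyadic_block_sum_le)
    fix n :: nat assume n: "Y / 2 < real n" "real n \<le> Y" "g * n \<in> S"
    have ge: "g * Y / 2 \<le> real (g * n)" using n g0 by (simp add: field_simps)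
    have le: "g * n \<le> q"
    proof -
      have "real n \<le> real q'" using n Y by (simp add: q'_def)
      then show ?thesis using g0 by (simp add: qg)
    qed
    have "\<psi> (g * n) \<le> 16 * C / (g * Y / 2 * L * LL ^ 3)"
      using n ge order.trans[OF gY ge] Y0 g0 by (intro \<psi>_le_ge) auto
    also have "\<dots> = B" by (simp add: B_def field_simps)
    finally have "\<psi> (g * n) \<le> B" .
    then show "0 < \<delta> (g * n) \<and> 1 / t \<le> dist_nint (real (g * n) * \<beta> - \<gamma>') \<and>
        \<delta> (g * n) \<le> B / dist_nint (real (g * n) * \<beta> - \<gamma>')"
      using \<delta>_pos[OF n(3)] a_ge[OF n(3) _ le] ge gY a_pos[OF n(3)]
      by (auto simp: \<delta>_def a_def intro!: divide_right_mono)
  next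
    fix k1 k2 :: int
    assume k: "(k1, k2) \<noteq> (0, 0)" "of_int \<bar>k1\<bar> \<le> 1 / (q' * B)" "of_int \<bar>k2\<bar> \<le> t"
    \<comment> \<open>Both frequencies, the second one multiplied by \<open>g\<close>, are at most
      \<open>t ^ 9\<close> because \<open>g \<le> t ^ 8\<close>; the height \<open>t ^ 16\<close> is
      then used.\<close>
    have "1 / (q' * B) = (g * (L * LL ^ 3)) * (Y / (32 * C * q'))"
      using g0 Y0 LL0 C by (simp add: B_def field_simps)
    also have "\<dots> \<le> (t ^ 8 * t) * 1"
    proof (intro mult_mono)
      have "1 * (L * LL ^ 3) \<le> 32 * (L * LL ^ 3)" using LL0 by (intro mult_right_mono) auto
      then show "L * LL ^ 3 \<le> t" using polylog t_ge_z by simp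
      have "Y \<le> 1 * real q'" using Y by (simp add: q'_def)
      also have "\<dots> \<le> 32 * C * q'" using C by (intro mult_right_mono) auto
      finally show "Y / (32 * C * q') \<le> 1" using C g0 by simp
    qed (use g t1 LL0 Y0 C in auto)
    also have "\<dots> = t ^ 9" by (simp add: eval_nat_numeral)
    also have "\<dots> \<le> t ^ 16" using t1 by (intro power_increasing) auto
    finally have k1: "of_int \<bar>k1\<bar> \<le> t ^ 16" using k by linarith
    have "of_int \<bar>k2\<bar> * real g \<le> t * t ^ 8" using k g t1 by (intro mult_mono) auto
    also have "\<dots> = t ^ 9" by (simp add: eval_nat_numeral)
    also have "\<dots> \<le> t ^ 16" using t1 by (intro power_increasing) auto
    finally have k2: "of_int \<bar>k2 * int g\<bar> \<le> t ^ 16" by (simp add: abs_mult)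
    have "2 \<le> t ^ 16"
    proof -
      have "t ^ 1 \<le> t ^ 16" using t1 by (intro power_increasing) auto
      then show ?thesis using t2 by simp
    qed
    moreover have "t ^ 16 \<le> real q" using t_power_le_sqrt[of 16] sqrt_le_q by simp
    moreover have "(k1, k2 * int g) \<noteq> (0, 0)" using k g0 by auto
    ultimately have "(t ^ 16) powr (- s) \<le> dist_nint (of_int k1 * \<gamma> + of_int (k2 * int g) * \<beta>)"
      using k1 k2 by (intro diophantine) auto
    moreover have "(t ^ 16) powr (- s) = 1 / sqrt q"
    proof -
      have "t ^ 16 = t powr 16" using t2 by simp
      then have "(t ^ 16) powr (- s) = t powr (- (16 * s))" by (simp only: powr_powr mult_minus_right)
      then show ?thesis by (simp only: sqrt_q powr_minus_divide)
    qed
    ultimately have "1 / sqrt q \<le> dist_nint (of_int k1 * \<gamma> + of_int k2 * (g * \<beta>))" by (simp add: mult_ac)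
    moreover have "sqrt (real q) > 0" using q_pos by simp
    ultimately show "dist_nint (of_int k1 * \<gamma> + of_int k2 * (g * \<beta>)) > 0 \<and>
       1 / dist_nint (of_int k1 * \<gamma> + of_int k2 * (g * \<beta>)) \<le> sqrt q"
      by (intro inverse_le_imp)
  qed (use g0 Y0 B0 t2 \<delta>_pos[OF qS] in auto)
  also have "\<dots> \<le> L * (49152 * Y * B + 32 * sqrt q / q')"
  proof (rule mult_right_mono)
    have "t \<le> real q" using t_power_le_sqrt[of 1] sqrt_le_q by simp
    then show "log 2 t \<le> L" unfolding L_def using t2 by (intro log_mono) auto
  qed (use Y0 B0 in auto)
  also have "\<dots> = 1572864 * C / (g * LL ^ 3) + 32 * L * sqrt q / q'"
    using g0 Y0 LL0 by (simp add: B_def field_simps)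
  \<comment> \<open>The Fejer error: with \<open>q' = q / g\<close> it suffices that
    \<open>32 * L * LL ^ 3 * g\<^sup>2\<close>, at most \<open>t ^ 17\<close>, is below
    \<open>sqrt q\<close>.\<close>
  also have "32 * L * sqrt q / q' \<le> 1 / (g * LL ^ 3)"
  proof -
    have "real g * real g \<le> t ^ 8 * t ^ 8" using g t1 by (intro mult_mono) auto
    then have "(32 * L * LL ^ 3) * (g * g) \<le> t * (t ^ 8 * t ^ 8)"
      using polylog t_ge_z t1 by (intro mult_mono) auto
    also have "\<dots> = t ^ 17" by (simp add: eval_nat_numeral)
    also have "\<dots> \<le> sqrt q" by (rule t_power_le_sqrt) simp
    finally have "sqrt q * ((32 * L * LL ^ 3) * (g * g)) \<le> sqrt q * sqrt q" by (intro mult_left_mono) auto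
    then have "sqrt q * ((32 * L * LL ^ 3) * (g * g)) \<le> g * q'" by (simp add: rqg)
    moreover have "g * (sqrt q * ((32 * L * LL ^ 3) * g)) = sqrt q * ((32 * L * LL ^ 3) * (g * g))" by simp
    ultimately have "g * (sqrt q * ((32 * L * LL ^ 3) * g)) \<le> g * q'" by linarith
    then have "sqrt q * ((32 * L * LL ^ 3) * g) \<le> q'" using g0 by simp
    then show ?thesis using g0 LL0 by (simp add: field_simps)
  qed
  finally show ?thesis unfolding overlap_cond_def q'_def[symmetric] by (simp add: add_divide_distrib)
qed

text \<open>The \<open>n\<close> up to \<open>q' * X\<close> are counted trivially with weight
  \<open>1 / q'\<close> and give \<open>X\<close>. The others lie in at most
  \<open>log 2 (1 / X) + 1\<close> dyadic blocks, which explains the terms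
  \<open>log 2 g + 3 * log 2 LL\<close>.\<close>

lemma small_gcd_sum:
  assumes g: "g dvd q" "real g \<le> t ^ 8"
  shows "(\<Sum>n | n \<le> q div g \<and> g * n \<in> S \<and> overlap_cond g n. min (1 / real (q div g)) (\<delta> (g * n) / (n * \<delta> q)))
     \<le> (1 + (log 2 g + 3 * log 2 LL + 1) * (1572864 * C + 1)) / (g * LL ^ 3)"
proof -
  define q' where "q' = q div g"
  have qg: "q = g * q'" using g by (simp add: q'_def)
  have g0: "g > 0" "q' > 0" using q_pos qg by auto
  have LL0: "LL > 0" using LL4 by simp
  define X where "X = 1 / (real g * LL ^ 3)"
  have gLL: "real g * LL ^ 3 \<ge> 1"
  proof -
    have "1 * 1 \<le> real g * LL ^ 3" using g0 LL4 by (intro mult_mono one_le_power) auto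
    then show ?thesis by simp
  qed
  have X: "0 < X" "1 / X = real g * LL ^ 3" using g0 LL0 by (auto simp: X_def)
  define f where "f n = min (1 / real q') (\<delta> (g * n) / (n * \<delta> q))" for n
  define R where "R = {n. n \<le> q' \<and> g * n \<in> S \<and> overlap_cond g n}"
  define T0 where "T0 = {n \<in> R. real n \<le> q' * X}"
  define T where "T j = {n. real q' / 2 ^ j / 2 < real n \<and> real n \<le> real q' / 2 ^ j \<and> g * n \<in> S \<and> overlap_cond g n}" for j :: nat
  define J where "J = nat \<lfloor>log 2 (1 / X)\<rfloor>"
  have log0: "0 \<le> log 2 (1 / X)" using gLL by (simp add: X(2))
  have J: "real J \<le> log 2 (1 / X)" using log0 by (simp add: J_def)
  have n0: "n > 0" if "g * n \<in> S" for n using that S0 by (intro Nat.gr0I) auto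
  have nn: "0 \<le> f n" if "g * n \<in> S" for n
    using \<delta>_pos[OF that] \<delta>_pos[OF qS] by (auto simp: f_def)
  have finR: "finite R" by (rule finite_subset[of _ "{..q'}"]) (auto simp: R_def)
  have finT: "finite (T j)" for j
  proof (rule finite_subset[of _ "{..q'}"])
    have "real q' / 2 ^ j \<le> real q' / 1" by (intro divide_left_mono) auto
    then show "T j \<subseteq> {..q'}" by (force simp: T_def)
  qed simp
  have sub: "R - T0 \<subseteq> (\<Union>j\<in>{..J}. T j)"
  proof
    fix n assume n: "n \<in> R - T0"
    then have nR: "n \<le> q'" "g * n \<in> S" "overlap_cond g n" "q' * X < real n" by (auto simp: R_def T0_def)
    have np: "n > 0" using n0 nR by blast
    define x where "x = log 2 (real q' / n)"
    have x0: "x \<ge> 0" using nR np g0 by (simp add: x_def)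
    have xle: "x \<le> log 2 (1 / X)" unfolding x_def
      using nR np g0 X(1) by (intro log_mono) (auto simp: field_simps)
    define j where "j = nat \<lfloor>x\<rfloor>"
    have j: "real j \<le> x" "x < real j + 1" using x0 unfolding j_def by linarith+
    have "j \<le> J" unfolding j_def J_def using xle by (intro nat_mono floor_mono)
    have px: "2 powr x = real q' / n" using np g0 by (simp add: x_def)
    have "2 powr real j \<le> 2 powr x" using j by simp
    then have "2 ^ j \<le> real q' / n" by (simp only: px powr_realpow zero_less_numeral)
    then have 1: "real n \<le> real q' / 2 ^ j" using np by (simp add: field_simps)
    have "2 powr x < 2 powr (real (j + 1))" using j by simp
    then have "real q' / n < 2 ^ (j + 1)" by (simp only: px powr_realpow zero_less_numeral)
    then have 2: "real q' / 2 ^ j / 2 < real n" using np by (simp add: field_simps)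
    show "n \<in> (\<Union>j\<in>{..J}. T j)" using 1 2 nR \<open>j \<le> J\<close> by (auto simp: T_def)
  qed
  have "(\<Sum>n\<in>R. f n) = (\<Sum>n\<in>R - T0. f n) + (\<Sum>n\<in>T0. f n)"
    using finR by (intro sum.subset_diff) (auto simp: T0_def)
  moreover have "(\<Sum>n\<in>T0. f n) \<le> X"
  proof -
    have "T0 \<subseteq> {1..nat \<lfloor>q' * X\<rfloor>}"
      using n0 by (auto simp: T0_def R_def Suc_le_eq le_nat_iff le_floor_iff)
    then have "card T0 \<le> card {1..nat \<lfloor>q' * X\<rfloor>}" by (intro card_mono) auto
    then have "real (card T0) \<le> real (nat \<lfloor>q' * X\<rfloor>)" by simp
    also have "\<dots> \<le> q' * X" using X by simp
    finally have c: "real (card T0) \<le> q' * X" .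
    have "(\<Sum>n\<in>T0. f n) \<le> (\<Sum>n\<in>T0. 1 / q')" by (intro sum_mono) (auto simp: f_def)
    also have "\<dots> = card T0 / q'" by simp
    also have "\<dots> \<le> (q' * X) / q'" using c by (intro divide_right_mono) auto
    finally show ?thesis using g0 by simp
  qed
  moreover have "(\<Sum>n\<in>R - T0. f n) \<le> (\<Sum>j\<in>{..J}. \<Sum>n\<in>T j. f n)"
    using finT sub nn by (intro sum_cover_le) (auto simp: T_def)
  moreover have "(\<Sum>j\<in>{..J}. \<Sum>n\<in>T j. f n) \<le> (\<Sum>j\<in>{..J}. (1572864 * C + 1) * X)"
  proof (rule sum_mono)
    fix j assume j: "j \<in> {..J}"
    have "2 powr real j \<le> 1 / X" using j J X(1) by (subst le_log_iff[symmetric]) auto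
    then have "2 ^ j \<le> 1 / X" by (simp add: powr_realpow)
    then have "q' / (1 / X) \<le> q' / 2 ^ j"
      using X(1) by (intro divide_left_mono mult_pos_pos) auto
    then have 1: "real (q div g) / (g * LL ^ 3) \<le> q' / 2 ^ j" by (simp only: X q'_def)
    have "real q' / 2 ^ j \<le> real q' / 1" by (intro divide_left_mono) auto
    then have 2: "real q' / 2 ^ j \<le> real (q div g)" by (simp add: q'_def)
    show "(\<Sum>n\<in>T j. f n) \<le> (1572864 * C + 1) * X"
      using small_gcd_block[OF g 1 2] unfolding T_def f_def q'_def X_def by simp
  qed
  moreover have "(\<Sum>j\<in>{..J}. (1572864 * C + 1) * X) \<le> ((log 2 g + 3 * log 2 LL + 1) * (1572864 * C + 1)) * X"
  proof -
    have "log 2 (1 / X) = log 2 g + 3 * log 2 LL"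
      unfolding X(2) using g0 LL0 by (simp add: log_mult log_nat_power)
    then have "real J + 1 \<le> log 2 g + 3 * log 2 LL + 1" using J by simp
    then have "(real J + 1) * ((1572864 * C + 1) * X) \<le> (log 2 g + 3 * log 2 LL + 1) * ((1572864 * C + 1) * X)"
      using C X by (intro mult_right_mono) auto
    then show ?thesis by (simp add: mult.assoc add.commute)
  qed
  ultimately have "(\<Sum>n\<in>R. f n) \<le> X + ((log 2 g + 3 * log 2 LL + 1) * (1572864 * C + 1)) * X" by linarith
  also have "\<dots> = (1 + (log 2 g + 3 * log 2 LL + 1) * (1572864 * C + 1)) / (g * LL ^ 3)"
    by (simp add: X_def add_divide_distrib)
  finally show ?thesis unfolding R_def f_def q'_def .
qed

text \<open>The condition forces \<open>(n - q') * \<gamma>\<close> within \<open>1 / t ^ 4\<close>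
  of an integer. For small \<open>q'\<close> this contradicts the Diophantine condition, for large
  \<open>q'\<close> it is rare by \<open>card_near_le\<close>. The gain \<open>1 / z\<close> pays
  for the later sum over at most \<open>z\<close> divisors.\<close>

lemma large_gcd_sum:
  assumes g: "g dvd q" "t ^ 8 < real g"
  defines "R \<equiv> {n. n < q div g \<and> real q / t ^ 2 < real (g * n) \<and> g * n \<in> S \<and> overlap_cond g n}"
  shows "card R / real (q div g) \<le> 8224 / z"
proof -
  define q' where "q' = q div g"
  have qg: "q = g * q'" using g by (simp add: q'_def)
  have g0: "g > 0" "q' > 0" using q_pos qg by auto
  have t1: "t \<ge> 1" using t2 by simp
  have q'le: "real q' \<le> real q / t ^ 8" using g g0 t1 by (simp add: qg field_simps)
  \<comment> \<open>Both radii are at most \<open>C * t ^ 3 / q\<close> and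
    \<open>q' \<le> q / t ^ 8\<close>, so the right side of the condition is at most
    \<open>2 * C / t ^ 5\<close>; then \<open>2 * C \<le> t\<close>.\<close>
  have \<Delta>: "dist_nint ((real n - real q') * \<gamma>) < 1 / t ^ 4" if n: "n \<in> R" for n
  proof -
    have nR: "n < q'" "real q / t ^ 2 < real (g * n)" "g * n \<in> S" "overlap_cond g n"
      using n by (auto simp: R_def q'_def)
    have sq: "sqrt (real q) \<le> real q / t ^ 2"
    proof -
      have "sqrt (real q) * t ^ 2 \<le> sqrt (real q) * sqrt (real q)"
        by (intro mult_left_mono t_power_le_sqrt) auto
      then show ?thesis using t1 by (simp add: field_simps)
    qed
    have gn: "g * n \<le> q" using nR by (simp add: qg)
    have d1: "\<delta> q \<le> C * t / (real q / t ^ 2)"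
    proof (rule \<delta>_le[OF qS])
      show "real q / t ^ 2 \<le> real q" using t1 by (simp add: field_simps mult_le_cancel_left1 one_le_power)
    qed (use q_pos t1 sqrt_le_q in auto)
    have d2: "\<delta> (g * n) \<le> C * t / (real q / t ^ 2)"
      using nR sq q_pos t1 gn by (intro \<delta>_le) auto
    have "dist_nint ((real n - real q') * \<gamma>) < real n * \<delta> q + real q' * \<delta> (g * n)"
      using nR(4) by (simp add: overlap_cond_def q'_def)
    also have "\<dots> \<le> real q' * (C * t / (real q / t ^ 2)) + real q' * (C * t / (real q / t ^ 2))"
      using nR(1) d1 d2 \<delta>_pos[OF qS] \<delta>_pos[OF nR(3)] by (intro add_mono mult_mono) auto
    also have "\<dots> = real q' * (2 * C * t ^ 3 / real q)" by (simp add: eval_nat_numeral)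
    also have "\<dots> \<le> real q / t ^ 8 * (2 * C * t ^ 3 / real q)"
      using q'le C t1 by (intro mult_right_mono) auto
    also have "\<dots> = 2 * C / t ^ 5" using q_pos t1 by (simp add: field_simps eval_nat_numeral)
    also have "\<dots> \<le> t / t ^ 5" using Cz t_ge_z t1 by (intro divide_right_mono) auto
    also have "\<dots> = 1 / t ^ 4" using t1 by (simp add: eval_nat_numeral)
    finally show ?thesis .
  qed
  \<comment> \<open>For \<open>q' \<le> w\<close> the Diophantine bound
    \<open>w powr (- s) = z powr (- (2 * s ^ 2))\<close> exceeds \<open>1 / t ^ 4\<close>. For
    \<open>q' > w\<close> the inequality \<open>z powr s \<le> w / z\<close> makes the Fejer error
    at most \<open>32 * q' / z\<close>.\<close>
  define w where "w = z powr (2 * s)"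
  have zw: "z \<le> w"
  proof -
    have "z powr 1 \<le> z powr (2 * s)" using z s by (intro powr_mono) auto
    then show ?thesis using z by (simp add: w_def)
  qed
  have wq: "w \<le> real q"
  proof -
    have "s * s \<ge> s * 2" using s by (intro mult_left_mono) auto
    then have "w \<le> t" unfolding w_def t_def using z by (intro powr_mono) (auto simp: power2_eq_square)
    also have "t \<le> real q" using t_power_le_sqrt[of 1] sqrt_le_q by simp
    finally show ?thesis .
  qed
  have zs: "z powr s \<le> w / z"
  proof -
    have "z powr s * z = z powr (s + 1)" using z by (simp add: powr_add)
    also have "\<dots> \<le> w" unfolding w_def using z s by (intro powr_mono) auto
    finally show ?thesis using z by (simp add: field_simps)
  qed
  show ?thesis
  proof (cases "real q' \<le> w")
    case True
    have "R = {}"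
    proof (rule ccontr)
      assume "R \<noteq> {}"
      then obtain n where n: "n \<in> R" by blast
      then have nq: "n < q'" by (auto simp: R_def q'_def)
      have "w powr (- s) \<le> dist_nint (of_int (int n - int q') * \<gamma> + of_int 0 * \<beta>)"
        using nq True zw z wq by (intro diophantine) auto
      also have "\<dots> < 1 / t ^ 4" using \<Delta>[OF n] by simp
      also have "1 / t ^ 4 = z powr (- (4 * s ^ 2))"
      proof -
        have "t ^ 4 = t powr 4" using t2 by simp
        also have "\<dots> = z powr (4 * s ^ 2)" unfolding t_def by (simp add: powr_powr mult.commute)
        finally show ?thesis by (simp only: powr_minus_divide)
      qed
      also have "w powr (- s) = z powr (- (2 * s ^ 2))"
        by (simp add: w_def powr_powr power2_eq_square mult.assoc)
      finally have "z powr (- (2 * s ^ 2)) < z powr (- (4 * s ^ 2))" .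
      then have "2 * s ^ 2 > 4 * s ^ 2" using z by simp
      then show False using s by (simp add: power2_eq_square)
    qed
    then show ?thesis using z by simp
  next
    case False
    have "R \<subseteq> {n \<in> {..<q'}. dist_nint (real n * \<gamma> + (- (q' * \<gamma>))) \<le> 1 / z}"
    proof
      fix n assume n: "n \<in> R"
      have "t ^ 1 \<le> t ^ 4" using t1 by (intro power_increasing) auto
      then have "1 / t ^ 4 \<le> 1 / z" using t_ge_z z by (intro divide_left_mono) auto
      then have "dist_nint ((real n - real q') * \<gamma>) \<le> 1 / z" using \<Delta>[OF n] by linarith
      then show "n \<in> {n \<in> {..<q'}. dist_nint (real n * \<gamma> + (- (q' * \<gamma>))) \<le> 1 / z}"
        using n by (simp add: R_def q'_def left_diff_distrib)
    qed
    then have "card R \<le> card {n \<in> {..<q'}. dist_nint (real n * \<gamma> + (- (q' * \<gamma>))) \<le> 1 / z}"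
      by (intro card_mono) auto
    then have "real (card R) \<le> card {n \<in> {..<q'}. dist_nint (real n * \<gamma> + (- (q' * \<gamma>))) \<le> 1 / z}"
      by (rule of_nat_mono)
    \<comment> \<open>Relaxing \<open>1 / t ^ 4\<close> to \<open>1 / z\<close> keeps the
      frequencies below \<open>z\<close>, so the Diophantine loss is only
      \<open>z powr s\<close>.\<close>
    also have "\<dots> \<le> 8192 * real q' * (1 / z) + 32 * z powr s"
    proof (rule card_near_le)
      fix k :: int assume k: "k \<noteq> 0" "of_int \<bar>k\<bar> \<le> 1 / (1 / z)"
      have "z powr (- s) \<le> dist_nint (of_int k * \<gamma> + of_int 0 * \<beta>)"
        using k z zw wq by (intro diophantine) auto
      then have "1 / z powr s \<le> dist_nint (of_int k * \<gamma>)" by (simp add: powr_minus_divide)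
      then show "dist_nint (of_int k * \<gamma>) > 0 \<and> 1 / dist_nint (of_int k * \<gamma>) \<le> z powr s"
        using z by (intro inverse_le_imp) auto
    qed (use z in auto)
    also have "\<dots> \<le> 8192 * real q' * (1 / z) + 32 * (real q' / z)"
    proof -
      have "w / z \<le> real q' / z" using False z by (intro divide_right_mono) auto
      then show ?thesis using zs by simp
    qed
    also have "\<dots> = 8224 / z * q'" by (simp add: field_simps)
    finally have "card R \<le> 8224 / z * q'" .
    then show ?thesis using g0 by (simp add: pos_divide_le_eq flip: q'_def)
  qed
qed

text \<open>The second term of the overlap bound divided by \<open>2 * \<delta> q\<close>. The two
  entries come from averaging over the shifts by multiples of \<open>1 / q\<close> and of
  \<open>1 / r\<close>.\<close>

definition overlap_weight :: "nat \<Rightarrow> real" where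
  "overlap_weight r = min (real (gcd q r) / q) (real (gcd q r) * \<delta> r / (r * \<delta> q))"

text \<open>Three ranges: \<open>R1\<close> gives \<open>1 / t ^ 2\<close> per divisor of
  \<open>q\<close>, \<open>R3\<close> gives \<open>8224 / z\<close> per divisor, and both are
  absorbed by the bound \<open>z\<close> for the number of divisors. In \<open>R2\<close> the bounds
  of \<open>small_gcd_sum\<close> are added up with the divisor sums.\<close>

lemma sum_overlap_weight_le:
  assumes K: "K \<ge> 0" "(\<Sum>d | d dvd q. 1 / real d) \<le> K * LL ^ 2"
      "(\<Sum>d | d dvd q. ln (real d) / real d) \<le> K * LL ^ 3"
  shows "(\<Sum>r | r \<in> S \<and> r < q \<and> overlap_cond (gcd q r) (r div gcd q r). overlap_weight r)
     \<le> 8225 + 7 * (1572864 * C + 1) * K"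
proof -
  define c where "c = 1572864 * C + 1"
  have c1: "c \<ge> 1" using C by (simp add: c_def)
  define R where "R = {r. r \<in> S \<and> r < q \<and> overlap_cond (gcd q r) (r div gcd q r)}"
  define R1 where "R1 = {r \<in> R. real r \<le> real q / t ^ 2}"
  define R2 where "R2 = {r \<in> R. real q / t ^ 2 < real r \<and> real (gcd q r) \<le> t ^ 8}"
  define R3 where "R3 = {r \<in> R. real q / t ^ 2 < real r \<and> t ^ 8 < real (gcd q r)}"
  have t1: "t \<ge> 1" using t2 by simp
  have fin: "finite R" by (rule finite_subset[of _ "{..<q}"]) (auto simp: R_def)
  have fin': "finite R1" "finite R2" "finite R3" using fin by (auto simp: R1_def R2_def R3_def)
  have no0: "0 \<notin> R1" "0 \<notin> R2" "0 \<notin> R3" using S0 by (auto simp: R1_def R2_def R3_def R_def)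
  have dq: "g > 0" "q div g > 0" "real q = real g * real (q div g)" "real g / real q = 1 / real (q div g)"
    if "g dvd q" for g
  proof -
    obtain h where h: "q = g * h" using \<open>g dvd q\<close> unfolding dvd_def by blast
    then have "g > 0" "h > 0" using q_pos by auto
    then show "g > 0" "q div g > 0" "real q = real g * real (q div g)" "real g / real q = 1 / real (q div g)"
      by (auto simp: h)
  qed
  have nlt: "n < q div g" if "g dvd q" "g * n < q" for g n
    using that dq[of g] by (metis dvd_mult_div_cancel mult_less_cancel1)
  have w1: "overlap_weight r \<le> real (gcd q r) / q" for r by (simp add: overlap_weight_def)
  have split: "R = R1 \<union> (R2 \<union> R3)" by (auto simp: R1_def R2_def R3_def)
  have "(\<Sum>r\<in>R. overlap_weight r) = (\<Sum>r\<in>R1. overlap_weight r) + ((\<Sum>r\<in>R2. overlap_weight r) + (\<Sum>r\<in>R3. overlap_weight r))"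
    unfolding split using fin'
    by (subst sum.union_disjoint; (subst sum.union_disjoint)?) (auto simp: R1_def R2_def R3_def)
  moreover have "(\<Sum>r\<in>R1. overlap_weight r) \<le> 1"
  proof -
    have "(\<Sum>r\<in>R1. overlap_weight r) \<le> (\<Sum>r\<in>R1. real (gcd q r) / q)" by (intro sum_mono w1)
    also have "\<dots> = (\<Sum>g | g dvd q. \<Sum>n | g * n \<in> R1 \<and> gcd q (g * n) = g. real (gcd q (g * n)) / q)"
      by (rule sum_by_gcd[OF fin'(1) q_pos no0(1)])
    also have "\<dots> \<le> (\<Sum>g | g dvd q. 1 / t ^ 2)"
    proof (rule sum_mono)
      fix g assume "g \<in> {g. g dvd q}"
      then have g: "g dvd q" by simp
      let ?N = "{n. g * n \<in> R1 \<and> gcd q (g * n) = g}"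
      have "?N \<subseteq> {1..nat \<lfloor>real (q div g) / t ^ 2\<rfloor>}"
      proof
        fix n assume n: "n \<in> ?N"
        then have "n \<noteq> 0" using no0 by (metis (mono_tags, lifting) mult_0_right mem_Collect_eq)
        moreover have "real (g * n) \<le> real g * real (q div g) / t ^ 2" using n dq(3)[OF g] by (auto simp: R1_def)
        then have "real n \<le> real (q div g) / t ^ 2" using dq(1)[OF g] t1 by (simp add: field_simps)
        ultimately show "n \<in> {1..nat \<lfloor>real (q div g) / t ^ 2\<rfloor>}" by (simp add: le_nat_iff le_floor_iff)
      qed
      then have "card ?N \<le> card {1..nat \<lfloor>real (q div g) / t ^ 2\<rfloor>}" by (intro card_mono) auto
      then have "card ?N \<le> nat \<lfloor>real (q div g) / t ^ 2\<rfloor>" by simp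
      then have "real (card ?N) \<le> real (nat \<lfloor>real (q div g) / t ^ 2\<rfloor>)" by (rule of_nat_mono)
      also have "\<dots> \<le> real (q div g) / t ^ 2" by simp
      finally have c: "real (card ?N) \<le> real (q div g) / t ^ 2" .
      have "(\<Sum>n\<in>?N. real (gcd q (g * n)) / q) = (\<Sum>n\<in>?N. 1 / real (q div g))"
        using dq(4)[OF g] by (intro sum.cong refl) auto
      also have "\<dots> = card ?N / real (q div g)" by simp
      also have "\<dots> \<le> (real (q div g) / t ^ 2) / real (q div g)" using c by (intro divide_right_mono) auto
      also have "\<dots> = 1 / t ^ 2" using dq(2)[OF g] by simp
      finally show "(\<Sum>n\<in>?N. real (gcd q (g * n)) / q) \<le> 1 / t ^ 2" .
    qed
    also have "\<dots> = card {g. g dvd q} / t ^ 2" by simp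
    also have "\<dots> \<le> t ^ 2 / t ^ 2"
    proof (rule divide_right_mono)
      have "t ^ 1 \<le> t ^ 2" using t1 by (intro power_increasing) auto
      then show "real (card {g. g dvd q}) \<le> t ^ 2" using tau t_ge_z by simp
    qed auto
    finally show ?thesis using t1 by simp
  qed
  moreover have "(\<Sum>r\<in>R2. overlap_weight r) \<le> 7 * c * K"
  proof -
    have "(\<Sum>r\<in>R2. overlap_weight r) = (\<Sum>g | g dvd q. \<Sum>n | g * n \<in> R2 \<and> gcd q (g * n) = g. overlap_weight (g * n))"
      by (rule sum_by_gcd[OF fin'(2) q_pos no0(2)])
    also have "\<dots> \<le> (\<Sum>g | g dvd q. (1 + (log 2 g + 3 * log 2 LL + 1) * c) / (g * LL ^ 3))"
    proof (rule sum_mono)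
      fix g assume "g \<in> {g. g dvd q}"
      then have g: "g dvd q" by simp
      let ?N = "{n. g * n \<in> R2 \<and> gcd q (g * n) = g}"
      show "(\<Sum>n\<in>?N. overlap_weight (g * n)) \<le> (1 + (log 2 g + 3 * log 2 LL + 1) * c) / (g * LL ^ 3)"
      proof (cases "real g \<le> t ^ 8")
        case True
        let ?M = "{n. n \<le> q div g \<and> g * n \<in> S \<and> overlap_cond g n}"
        have "(\<Sum>n\<in>?N. overlap_weight (g * n)) = (\<Sum>n\<in>?N. min (1 / real (q div g)) (\<delta> (g * n) / (n * \<delta> q)))"
        proof (rule sum.cong[OF refl])
          fix n assume n: "n \<in> ?N"
          then have "n \<noteq> 0" using no0 by (metis (mono_tags, lifting) mult_0_right mem_Collect_eq)
          have "real g * \<delta> (g * n) / (real (g * n) * \<delta> q) = \<delta> (g * n) / (n * \<delta> q)"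
            using dq(1)[OF g] by simp
          then show "overlap_weight (g * n) = min (1 / real (q div g)) (\<delta> (g * n) / (n * \<delta> q))"
            using n dq(4)[OF g] by (simp add: overlap_weight_def)
        qed
        also have "\<dots> \<le> (\<Sum>n\<in>?M. min (1 / real (q div g)) (\<delta> (g * n) / (n * \<delta> q)))"
        proof (rule sum_mono2)
          show "finite ?M" by (rule finite_subset[of _ "{..q div g}"]) auto
          show "?N \<subseteq> ?M"
          proof
            fix n assume n: "n \<in> ?N"
            then have "g * n \<in> S" "g * n < q" "overlap_cond (gcd q (g * n)) (g * n div gcd q (g * n))" "gcd q (g * n) = g"
              by (auto simp: R2_def R_def)
            moreover from this have "overlap_cond g n" using dq(1)[OF g] by simp
            ultimately show "n \<in> ?M" using nlt[OF g, of n] by auto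
          qed
          fix n assume "n \<in> ?M - ?N"
          then have "\<delta> (g * n) > 0" using \<delta>_pos by auto
          then show "0 \<le> min (1 / real (q div g)) (\<delta> (g * n) / (n * \<delta> q))" using \<delta>_pos[OF qS] by simp
        qed
        also have "\<dots> \<le> (1 + (log 2 g + 3 * log 2 LL + 1) * c) / (g * LL ^ 3)"
          unfolding c_def by (rule small_gcd_sum[OF g True])
        finally show ?thesis .
      next
        case False
        then have e: "?N = {}" by (auto simp: R2_def)
        have "log 2 g \<ge> 0" "log 2 LL \<ge> 0" using dq(1)[OF g] LL4 by auto
        then have "0 \<le> (1 + (log 2 g + 3 * log 2 LL + 1) * c) / (g * LL ^ 3)"
          using c1 LL4 by (intro divide_nonneg_nonneg add_nonneg_nonneg mult_nonneg_nonneg) auto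
        then show ?thesis unfolding e by simp
      qed
    qed
    \<comment> \<open>Here \<open>log 2 LL \<le> LL\<close> and
      \<open>log 2 g \<le> 2 * ln g\<close>; the term 1 and the single \<open>c\<close> are absorbed
      by \<open>c \<ge> 1\<close> and \<open>LL \<ge> 4\<close>.\<close>
    also have "\<dots> \<le> (\<Sum>g | g dvd q. (5 * c * LL / LL ^ 3) * (1 / real g) + (2 * c / LL ^ 3) * (ln (real g) / real g))"
    proof (rule sum_mono)
      fix g assume "g \<in> {g. g dvd q}"
      then have g: "g > 0" using dq by auto
      have "ln (real g) * (1 / ln 2) \<le> ln (real g) * 2"
        using g ln2_ge_two_thirds by (intro mult_left_mono) (auto simp: field_simps)
      then have l1: "log 2 g \<le> 2 * ln g" by (simp add: log_def)
      have l2: "log 2 LL \<le> LL"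
      proof -
        have "ln LL = ln (LL / 2) + ln 2" using LL4 by (simp add: ln_div)
        also have "\<dots> \<le> (LL / 2 - 1) + 1" using LL4 ln_2_less_1 by (intro add_mono ln_le_minus_one) auto
        also have "\<dots> \<le> LL * ln 2" using LL4 ln2_ge_two_thirds mult_left_mono[of "1/2" "ln 2" LL] by simp
        finally show ?thesis by (simp add: log_def field_simps)
      qed
      have "1 + (log 2 g + 3 * log 2 LL + 1) * c \<le> 1 + (2 * ln g + 3 * LL + 1) * c"
        using l1 l2 c1 by (intro add_left_mono mult_right_mono) auto
      also have "\<dots> \<le> 5 * c * LL + 2 * c * ln g"
      proof -
        have "c * 4 \<le> c * LL" using c1 LL4 by (intro mult_left_mono) auto
        moreover have "(2 * ln g + 3 * LL + 1) * c = 2 * c * ln g + 3 * (c * LL) + c"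
          by (simp add: algebra_simps)
        moreover have "5 * c * LL = 5 * (c * LL)" by simp
        ultimately show ?thesis using c1 by linarith
      qed
      finally have "(1 + (log 2 g + 3 * log 2 LL + 1) * c) / (g * LL ^ 3) \<le> (5 * c * LL + 2 * c * ln g) / (g * LL ^ 3)"
        using LL4 by (intro divide_right_mono) auto
      also have "\<dots> = (5 * c * LL / LL ^ 3) * (1 / real g) + (2 * c / LL ^ 3) * (ln (real g) / real g)"
        using g LL4 by (simp add: field_simps)
      finally show "(1 + (log 2 g + 3 * log 2 LL + 1) * c) / (g * LL ^ 3) \<le>
          (5 * c * LL / LL ^ 3) * (1 / real g) + (2 * c / LL ^ 3) * (ln (real g) / real g)" .
    qed
    also have "\<dots> = (5 * c * LL / LL ^ 3) * (\<Sum>g | g dvd q. 1 / real g) + (2 * c / LL ^ 3) * (\<Sum>g | g dvd q. ln (real g) / real g)"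
      by (simp only: sum.distrib sum_distrib_left)
    \<comment> \<open>Here the third power of the double logarithm in the bound for
      \<open>\<psi>\<close> is used up, by both divisor sums.\<close>
    also have "\<dots> \<le> (5 * c * LL / LL ^ 3) * (K * LL ^ 2) + (2 * c / LL ^ 3) * (K * LL ^ 3)"
      using c1 LL4 K by (intro add_mono mult_left_mono) auto
    also have "\<dots> = 7 * c * K" using LL4 by (simp add: field_simps eval_nat_numeral)
    finally show ?thesis .
  qed
  moreover have "(\<Sum>r\<in>R3. overlap_weight r) \<le> 8224"
  proof -
    have "(\<Sum>r\<in>R3. overlap_weight r) \<le> (\<Sum>r\<in>R3. real (gcd q r) / q)" by (intro sum_mono w1)
    also have "\<dots> = (\<Sum>g | g dvd q. \<Sum>n | g * n \<in> R3 \<and> gcd q (g * n) = g. real (gcd q (g * n)) / q)"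
      by (rule sum_by_gcd[OF fin'(3) q_pos no0(3)])
    also have "\<dots> \<le> (\<Sum>g | g dvd q. 8224 / z)"
    proof (rule sum_mono)
      fix g assume "g \<in> {g. g dvd q}"
      then have g: "g dvd q" by simp
      let ?N = "{n. g * n \<in> R3 \<and> gcd q (g * n) = g}"
      let ?M = "{n. n < q div g \<and> real q / t ^ 2 < real (g * n) \<and> g * n \<in> S \<and> overlap_cond g n}"
      have eq: "(\<Sum>n\<in>?N. real (gcd q (g * n)) / q) = card ?N / real (q div g)"
      proof -
        have "(\<Sum>n\<in>?N. real (gcd q (g * n)) / q) = (\<Sum>n\<in>?N. 1 / real (q div g))"
          using dq(4)[OF g] by (intro sum.cong refl) auto
        then show ?thesis by simp
      qed
      show "(\<Sum>n\<in>?N. real (gcd q (g * n)) / q) \<le> 8224 / z"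
      proof (cases "real g \<le> t ^ 8")
        case True
        then have e: "?N = {}" by (auto simp: R3_def)
        show ?thesis unfolding e using z by simp
      next
        case False
        have "?N \<subseteq> ?M"
        proof
          fix n assume n: "n \<in> ?N"
          then have "g * n \<in> S" "g * n < q" "overlap_cond (gcd q (g * n)) (g * n div gcd q (g * n))"
              "gcd q (g * n) = g" "real q / t ^ 2 < real (g * n)"
            by (auto simp: R3_def R_def)
          moreover from this have "overlap_cond g n" using dq(1)[OF g] by simp
          ultimately show "n \<in> ?M" using nlt[OF g, of n] by auto
        qed
        moreover have "finite ?M" by (rule finite_subset[of _ "{..q div g}"]) auto
        ultimately have "card ?N \<le> card ?M" by (intro card_mono)
        then have "card ?N / real (q div g) \<le> card ?M / real (q div g)" by (intro divide_right_mono) auto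
        also have "\<dots> \<le> 8224 / z" using False by (intro large_gcd_sum g) auto
        finally show ?thesis by (simp only: eq)
      qed
    qed
    also have "\<dots> = card {g. g dvd q} * (8224 / z)" by simp
    also have "\<dots> \<le> z * (8224 / z)" using tau z by (intro mult_right_mono) auto
    also have "\<dots> = 8224" using z by simp
    finally show ?thesis .
  qed
  ultimately show ?thesis unfolding R_def c_def by linarith
qed

end

section \<open>Full measure\<close>

text \<open>In terms of \<open>l\<close> one has \<open>LL = 2 powr l\<close> and
  \<open>L = 2 powr (2 powr l)\<close>, while \<open>s\<close> grows only like
  \<open>sqrt l\<close>; all conditions become growth comparisons in \<open>l\<close>.\<close>

lemma eventually_scale:
  fixes c C :: real
  assumes "c \<ge> 2"
  shows "eventually (\<lambda>q::nat. let L = log 2 (real q); LL = log 2 L; l = log 2 LL; s = c * sqrt l; z = real q powr (1 / (32 * s ^ 3)) in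
     q \<ge> 16 \<and> 16 \<le> L \<and> 4 \<le> LL \<and> 2 \<le> l \<and> 2 \<le> s \<and> 2 \<le> z \<and> 2 * C \<le> z \<and> 32 * L * LL ^ 3 \<le> z \<and> real (card {d. d dvd q}) \<le> z) sequentially"
proof -
  \<comment> \<open>After taking logarithms to base 2, the first inequality bounds the constant of
    \<open>card_divisors_le\<close>, the second is \<open>32 * L * LL ^ 3 \<le> z\<close>, and the
    last gives \<open>2 * \<bar>C\<bar> + 2 \<le> LL\<close>.\<close>
  let ?P = "\<lambda>l::real. (2::real) powr (64 * (c * sqrt l) ^ 3) * log 2 (128 * (c * sqrt l) ^ 3) * (64 * (c * sqrt l) ^ 3) \<le> 2 powr (2 powr l)
     \<and> 32 * (c * sqrt l) ^ 3 * (5 + 2 powr l + 3 * l) \<le> (2::real) powr (2 powr l) \<and> 2 \<le> l \<and> log 2 (2 * \<bar>C\<bar> + 2) \<le> l"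
  have c0: "c > 0" using assms by simp
  have "eventually ?P at_top"
  proof (intro eventually_conj)
    show "eventually (\<lambda>l::real. (2::real) powr (64 * (c * sqrt l) ^ 3) * log 2 (128 * (c * sqrt l) ^ 3) * (64 * (c * sqrt l) ^ 3) \<le> 2 powr (2 powr l)) at_top"
      using c0 by real_asymp
    show "eventually (\<lambda>l::real. 32 * (c * sqrt l) ^ 3 * (5 + 2 powr l + 3 * l) \<le> (2::real) powr (2 powr l)) at_top"
      using c0 by real_asymp
  qed (rule eventually_ge_at_top)+
  moreover have "filterlim (\<lambda>q::nat. log 2 (log 2 (log 2 (real q)))) at_top sequentially" by real_asymp
  ultimately have "eventually (\<lambda>q::nat. ?P (log 2 (log 2 (log 2 (real q))))) sequentially"
    by (rule eventually_compose_filterlim)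
  moreover have "eventually (\<lambda>q::nat. 16 \<le> log 2 (real q)) sequentially" by real_asymp
  moreover have "eventually (\<lambda>q::nat. 4 \<le> log 2 (log 2 (real q))) sequentially" by real_asymp
  moreover have "eventually (\<lambda>q::nat. q \<ge> 16) sequentially" by (rule eventually_ge_at_top)
  ultimately show ?thesis
  proof eventually_elim
    case (elim q)
    define L where "L = log 2 (real q)"
    define LL where "LL = log 2 L"
    define l where "l = log 2 LL"
    define s where "s = c * sqrt l"
    define z where "z = real q powr (1 / (32 * s ^ 3))"
    have P: "2 powr (64 * s ^ 3) * log 2 (128 * s ^ 3) * (64 * s ^ 3) \<le> 2 powr (2 powr l)"
      "32 * s ^ 3 * (5 + 2 powr l + 3 * l) \<le> 2 powr (2 powr l)" "2 \<le> l" "log 2 (2 * \<bar>C\<bar> + 2) \<le> l"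
      using elim(1) by (simp_all only: L_def LL_def l_def s_def)
    have LLL: "16 \<le> L" "4 \<le> LL" "q \<ge> 16" using elim by (simp_all only: L_def LL_def)
    have pl: "2 powr l = LL" "2 powr LL = L" "2 powr L = real q"
      using LLL by (simp_all add: l_def LL_def L_def)
    have s2: "2 \<le> s"
    proof -
      have "1 \<le> sqrt l" using P(3) by simp
      then have "2 * 1 \<le> c * sqrt l" using assms by (intro mult_mono) auto
      then show ?thesis by (simp add: s_def)
    qed
    have s3: "s ^ 3 > 0" "s ^ 3 \<ge> 1" using s2 by (auto intro: one_le_power)
    have z_eq: "z = 2 powr (L / (32 * s ^ 3))"
      unfolding z_def pl(3)[symmetric] by (simp add: powr_powr)
    have "5 + LL + 3 * l \<le> L / (32 * s ^ 3)"
      using P(2) s3 by (simp only: pl) (simp add: field_simps)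
    then have ze: "2 powr (5 + LL + 3 * l) \<le> z" unfolding z_eq by simp
    have "2 powr (5 + LL + 3 * l) = 2 powr 5 * 2 powr LL * (2 powr l) powr 3"
      by (simp only: powr_add powr_powr mult.commute)
    also have "\<dots> = 32 * L * LL ^ 3" using LLL by (simp only: pl) simp
    finally have polylog: "32 * L * LL ^ 3 \<le> z" using ze by simp
    have "2 powr l \<le> 2 powr (5 + LL + 3 * l)" using P(3) LLL by simp
    then have "LL \<le> z" using ze pl(1) by simp
    moreover have "2 * \<bar>C\<bar> + 2 \<le> LL"
    proof -
      have "2 * \<bar>C\<bar> + 2 = 2 powr (log 2 (2 * \<bar>C\<bar> + 2))" by simp
      also have "\<dots> \<le> 2 powr l" using P(4) by (rule powr_mono) simp
      finally show ?thesis by (simp only: pl)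
    qed
    ultimately have zC: "2 \<le> z" "2 * C \<le> z" by linarith+
    \<comment> \<open>Half the exponent that defines \<open>z\<close>: one factor
      \<open>q powr \<epsilon>\<close> is the divisor bound itself, the other absorbs its
      constant.\<close>
    define \<epsilon> where "\<epsilon> = 1 / (64 * s ^ 3)"
    have \<epsilon>: "0 < \<epsilon>" "\<epsilon> \<le> 1" "1 / \<epsilon> = 64 * s ^ 3" "2 / \<epsilon> = 128 * s ^ 3" using s3 by (auto simp: \<epsilon>_def)
    have "real (card {d. d dvd q}) \<le> (2 / \<epsilon>) powr (2 powr (1 / \<epsilon>)) * q powr \<epsilon>"
      using LLL \<epsilon> by (intro card_divisors_le) auto
    also have "(2 / \<epsilon>) powr (2 powr (1 / \<epsilon>)) = 2 powr (2 powr (64 * s ^ 3) * log 2 (128 * s ^ 3))"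
    proof -
      have "128 * s ^ 3 = 2 powr (log 2 (128 * s ^ 3))" using s3 by simp
      then have "(128 * s ^ 3) powr (2 powr (64 * s ^ 3)) = 2 powr (log 2 (128 * s ^ 3) * 2 powr (64 * s ^ 3))"
        by (metis powr_powr)
      then show ?thesis by (simp only: \<epsilon> mult.commute)
    qed
    also have "\<dots> * q powr \<epsilon> \<le> 2 powr (L * \<epsilon>) * q powr \<epsilon>"
    proof (rule mult_right_mono)
      have "2 powr (64 * s ^ 3) * log 2 (128 * s ^ 3) \<le> L * \<epsilon>"
        using P(1) s3 by (simp only: pl \<epsilon>_def) (simp add: field_simps)
      then show "2 powr (2 powr (64 * s ^ 3) * log 2 (128 * s ^ 3)) \<le> 2 powr (L * \<epsilon>)" by simp
    qed simp
    also have "2 powr (L * \<epsilon>) * q powr \<epsilon> = q powr (2 * \<epsilon>)"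
      by (simp only: powr_powr[symmetric] pl(3) mult_2 powr_add)
    also have "\<dots> = z" by (simp add: z_def \<epsilon>_def)
    finally have tau: "real (card {d. d dvd q}) \<le> z" .
    show ?case
      unfolding Let_def L_def[symmetric] LL_def[symmetric] l_def[symmetric] s_def[symmetric] z_def[symmetric]
      using LLL P(3) s2 zC polylog tau by simp
  qed
qed

text \<open>The infimum need not be attained, so an admissible \<open>\<sigma>\<close> below
  \<open>(C + 1) * sqrt l\<close> is taken. Pairs of maximum 1 are outside the definition of
  \<open>sigma_exp\<close>; doubling them costs a factor 2, absorbed by adding 1 to the exponent
  since \<open>M \<ge> 2\<close>.\<close>

lemma sigma_exp_diophantine:
  fixes \<gamma> \<beta> C l :: real and q :: nat
  assumes "sigma_exp \<gamma> \<beta> q \<le> ennreal (C * sqrt l)" "C > 0" "l \<ge> 1" "q \<ge> 2"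
    and k: "(k1, k2) \<noteq> (0, 0)" "2 \<le> M" "M \<le> real q" "of_int \<bar>k1\<bar> \<le> M" "of_int \<bar>k2\<bar> \<le> M"
  shows "M powr (- ((C + 2) * sqrt l)) \<le> dist_nint (of_int k1 * \<gamma> + of_int k2 * \<beta>)"
proof -
  have l1: "sqrt l \<ge> 1" using assms by simp
  have "ennreal (C * sqrt l) < ennreal ((C + 1) * sqrt l)"
    using assms l1 by (intro ennreal_lessI) auto
  with assms(1) have "sigma_exp \<gamma> \<beta> q < ennreal ((C + 1) * sqrt l)" by (rule le_less_trans)
  then obtain \<sigma> :: real where \<sigma>: "\<sigma> > 0" "ennreal \<sigma> < ennreal ((C + 1) * sqrt l)"
    and D: "\<And>k1 k2 :: int. 2 \<le> max \<bar>k1\<bar> \<bar>k2\<bar> \<Longrightarrow> max \<bar>k1\<bar> \<bar>k2\<bar> \<le> int q \<Longrightarrow>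
          of_int (max \<bar>k1\<bar> \<bar>k2\<bar>) powr (- \<sigma>) \<le> dist_nint (of_int k1 * \<gamma> + of_int k2 * \<beta>)"
    unfolding sigma_exp_def Inf_less_iff by blast
  have "\<sigma> < (C + 1) * sqrt l" using \<sigma> by (metis ennreal_less_iff less_imp_le)
  moreover have "(C + 1) * sqrt l + 1 \<le> (C + 2) * sqrt l" using l1 by (simp add: algebra_simps)
  ultimately have \<sigma>le: "\<sigma> + 1 \<le> (C + 2) * sqrt l" by linarith
  define m where "m = max \<bar>k1\<bar> \<bar>k2\<bar>"
  have m1: "m \<ge> 1" using k(1) unfolding m_def by auto
  have mM: "of_int m \<le> M" using k by (auto simp: m_def max_def)
  have mq: "m \<le> int q" using mM k(3) by linarith
  have Mle: "M powr (- ((C + 2) * sqrt l)) \<le> M powr (- (\<sigma> + 1))"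
    using \<sigma>le k by (intro powr_mono) auto
  show ?thesis
  proof (cases "m \<ge> 2")
    case True
    have "M powr (- (\<sigma> + 1)) \<le> M powr (- \<sigma>)" using k by (intro powr_mono) auto
    also have "\<dots> \<le> of_int m powr (- \<sigma>)" using mM m1 \<sigma> by (intro powr_mono2') auto
    also have "\<dots> \<le> dist_nint (of_int k1 * \<gamma> + of_int k2 * \<beta>)"
      using D[of k1 k2] True mq by (simp add: m_def)
    finally show ?thesis using Mle by linarith
  next
    case False
    then have "m = 1" using m1 by simp
    then have "max \<bar>2 * k1\<bar> \<bar>2 * k2\<bar> = 2" unfolding m_def by (simp add: abs_mult max_def split: if_splits)
    then have "2 powr (- \<sigma>) \<le> dist_nint (of_int (2 * k1) * \<gamma> + of_int (2 * k2) * \<beta>)"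
      using D[of "2 * k1" "2 * k2"] assms(4) by simp
    also have "of_int (2 * k1) * \<gamma> + of_int (2 * k2) * \<beta> = of_int 2 * (of_int k1 * \<gamma> + of_int k2 * \<beta>)"
      by (simp add: algebra_simps)
    also have "dist_nint \<dots> \<le> \<bar>of_int 2\<bar> * dist_nint (of_int k1 * \<gamma> + of_int k2 * \<beta>)" by (rule dist_nint_mult_int)
    finally have 1: "2 powr (- \<sigma>) / 2 \<le> dist_nint (of_int k1 * \<gamma> + of_int k2 * \<beta>)" by simp
    have "M powr (- (\<sigma> + 1)) \<le> 2 powr (- (\<sigma> + 1))" using k \<sigma> by (intro powr_mono2') auto
    also have "\<dots> = 2 powr (- \<sigma>) / 2" by (simp add: powr_diff)
    finally show ?thesis using 1 Mle by linarith
  qed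
qed

text \<open>Between \<open>sqrt q\<close> and \<open>q\<close> the square root in
  \<open>omega_fun\<close> is at least half its value at \<open>q\<close>, so the exponent at most
  doubles.\<close>

lemma powr_omega_fun_ge:
  fixes c :: real and q r :: nat
  assumes "c > 0" "16 \<le> log 2 (real q)" "4 \<le> log 2 (log 2 (real q))" "2 \<le> log 2 (log 2 (log 2 (real q)))"
    and "q \<ge> 1" "sqrt (real q) \<le> real r" "r \<le> q"
  shows "real q powr (- (2 * c / sqrt (log 2 (log 2 (log 2 (real q)))))) \<le> real r powr (- omega_fun c r)"
proof -
  define LL where "LL = log 2 (log 2 (real q))"
  define l where "l = log 2 LL"
  have LL: "4 \<le> LL" "2 \<le> l" using assms by (simp_all add: LL_def l_def)
  have r: "real r > 0" "LL / 2 \<le> log 2 (log 2 (real r))"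
    using log_log_ge_half[of "real q" "real r"] assms by (auto simp: LL_def)
  have "l / 2 ^ 2 \<le> l - 1" using LL by simp
  also have "\<dots> = log 2 (LL / 2)" using LL by (simp add: l_def log_divide)
  also have "\<dots> \<le> log 2 (log 2 (log 2 (real r)))" using r LL by (intro log_mono) auto
  finally have "sqrt (l / 2 ^ 2) \<le> sqrt (log 2 (log 2 (log 2 (real r))))" by simp
  then have sq: "sqrt l / 2 \<le> sqrt (log 2 (log 2 (log 2 (real r))))" by (simp add: real_sqrt_divide)
  have "omega_fun c r = c / sqrt (log 2 (log 2 (log 2 (real r))))"
    using r LL by (simp add: omega_fun_def)
  also have "\<dots> \<le> c / (sqrt l / 2)"
    using sq LL assms by (intro divide_left_mono) (auto intro!: mult_pos_pos less_le_trans[OF _ sq])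
  finally have \<omega>: "omega_fun c r \<le> 2 * c / sqrt l" by (simp add: field_simps)
  have "real q powr (- (2 * c / sqrt l)) \<le> real r powr (- (2 * c / sqrt l))"
    using assms r LL by (intro powr_mono2') auto
  also have "\<dots> \<le> real r powr (- omega_fun c r)" using \<omega> r by (intro powr_mono) auto
  finally show ?thesis by (simp add: l_def LL_def)
qed

text \<open>The second terms of the two off-diagonal halves each contribute \<open>K\<close> times
  the total mass and the diagonal contributes it once, hence \<open>1 + 2 * K\<close>.\<close>

lemma double_sum_le:
  fixes f :: "nat \<Rightarrow> nat \<Rightarrow> real" and \<delta> :: "nat \<Rightarrow> real"
  assumes "finite F" and sym: "\<And>q r. f q r = f r q"
    and diag: "\<And>q. q \<in> F \<Longrightarrow> f q q = 2 * \<delta> q" and "\<And>q. q \<in> F \<Longrightarrow> \<delta> q \<ge> 0"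
    and off: "\<And>q r. q \<in> F \<Longrightarrow> r \<in> F \<Longrightarrow> r < q \<Longrightarrow> f q r \<le> 4 * \<delta> q * \<delta> r + 2 * \<delta> q * e q r"
    and e: "\<And>q. q \<in> F \<Longrightarrow> (\<Sum>r\<in>{r\<in>F. r < q}. e q r) \<le> K"
  shows "(\<Sum>q\<in>F. \<Sum>r\<in>F. f q r) \<le> (\<Sum>q\<in>F. 2 * \<delta> q)\<^sup>2 + (1 + 2 * K) * (\<Sum>q\<in>F. 2 * \<delta> q)"
proof -
  define h where "h q r = (if r < q then 2 * \<delta> q * e q r else 0)" for q r :: nat
  have "(\<Sum>q\<in>F. \<Sum>r\<in>F. f q r) \<le> (\<Sum>q\<in>F. \<Sum>r\<in>F. (2 * \<delta> q) * (2 * \<delta> r) + (h q r + h r q + (if q = r then 2 * \<delta> q else 0)))"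
  proof (intro sum_mono)
    fix q r assume qr: "q \<in> F" "r \<in> F"
    consider "r < q" | "q < r" | "q = r" by linarith
    then show "f q r \<le> (2 * \<delta> q) * (2 * \<delta> r) + (h q r + h r q + (if q = r then 2 * \<delta> q else 0))"
    proof cases
      case 1
      then show ?thesis using off[of q r] qr by (simp add: h_def)
    next
      case 2
      then show ?thesis using off[of r q] sym[of q r] qr by (simp add: h_def mult_ac)
    next
      case 3
      then show ?thesis using diag[of q] qr by (simp add: h_def)
    qed
  qed
  also have "\<dots> = (\<Sum>q\<in>F. 2 * \<delta> q)\<^sup>2 + ((\<Sum>q\<in>F. \<Sum>r\<in>F. h q r) + (\<Sum>q\<in>F. \<Sum>r\<in>F. h r q) + (\<Sum>q\<in>F. 2 * \<delta> q))"
    using assms(1) by (simp add: sum.distrib power2_eq_square sum_product)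
  also have "(\<Sum>q\<in>F. \<Sum>r\<in>F. h r q) = (\<Sum>q\<in>F. \<Sum>r\<in>F. h q r)" by (rule sum.swap)
  finally have main: "(\<Sum>q\<in>F. \<Sum>r\<in>F. f q r) \<le> (\<Sum>q\<in>F. 2 * \<delta> q)\<^sup>2 +
     ((\<Sum>q\<in>F. \<Sum>r\<in>F. h q r) + (\<Sum>q\<in>F. \<Sum>r\<in>F. h q r) + (\<Sum>q\<in>F. 2 * \<delta> q))" .
  have "(\<Sum>q\<in>F. \<Sum>r\<in>F. h q r) \<le> (\<Sum>q\<in>F. K * (2 * \<delta> q))"
  proof (rule sum_mono)
    fix q assume q: "q \<in> F"
    have "(\<Sum>r\<in>F. h q r) = (\<Sum>r\<in>{r\<in>F. r < q}. 2 * \<delta> q * e q r)"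
      unfolding h_def using assms(1) by (subst sum.inter_filter) auto
    also have "\<dots> = 2 * \<delta> q * (\<Sum>r\<in>{r\<in>F. r < q}. e q r)" by (rule sum_distrib_left[symmetric])
    also have "\<dots> \<le> 2 * \<delta> q * K" using e[OF q] assms(4)[OF q] by (intro mult_left_mono) auto
    finally show "(\<Sum>r\<in>F. h q r) \<le> K * (2 * \<delta> q)" by (simp add: mult_ac)
  qed
  also have "\<dots> = K * (\<Sum>q\<in>F. 2 * \<delta> q)" by (rule sum_distrib_left[symmetric])
  finally show ?thesis using main by (simp add: algebra_simps)
qed

text \<open>The terms below \<open>N0\<close> have a finite sum, so bounded tails would bound every
  finite subsum and hence the infinite sum.\<close>

lemma unbounded_partial_sums:
  fixes f :: "nat \<Rightarrow> real" and N0 :: nat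
  assumes "\<And>q. q \<in> A \<Longrightarrow> f q \<ge> 0" "(\<Sum>\<^sub>\<infinity>q\<in>A. ennreal (f q)) = \<infinity>"
  shows "\<exists>n. B \<le> (\<Sum>q\<in>{q\<in>A. q \<ge> N0} \<inter> {..<n}. f q)"
proof (rule ccontr)
  assume "\<not> ?thesis"
  then have bd: "(\<Sum>q\<in>{q\<in>A. q \<ge> N0} \<inter> {..<n}. f q) < B" for n by (meson not_le)
  define B' where "B' = (\<Sum>q\<in>A \<inter> {..<N0}. f q) + B"
  have "(\<Sum>\<^sub>\<infinity>q\<in>A. ennreal (f q)) = (SUP F\<in>{F. finite F \<and> F \<subseteq> A}. \<Sum>q\<in>F. ennreal (f q))"
    by (rule nonneg_infsum_complete) simp
  also have "\<dots> \<le> ennreal B'"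
  proof (rule SUP_least)
    fix F assume "F \<in> {F. finite F \<and> F \<subseteq> A}"
    then have F: "finite F" "F \<subseteq> A" by auto
    have sub: "F \<subseteq> (A \<inter> {..<N0}) \<union> ({q\<in>A. q \<ge> N0} \<inter> {..<Suc (Max F)})"
      using F by (auto simp: less_Suc_eq_le)
    have "(\<Sum>q\<in>F. f q) \<le> (\<Sum>q\<in>(A \<inter> {..<N0}) \<union> ({q\<in>A. q \<ge> N0} \<inter> {..<Suc (Max F)}). f q)"
      using sub assms(1) by (intro sum_mono2) auto
    also have "\<dots> = (\<Sum>q\<in>A \<inter> {..<N0}. f q) + (\<Sum>q\<in>{q\<in>A. q \<ge> N0} \<inter> {..<Suc (Max F)}. f q)"
      by (rule sum.union_disjoint) auto
    also have "\<dots> \<le> B'" using bd[of "Suc (Max F)"] by (simp add: B'_def)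
    finally have "ennreal (\<Sum>q\<in>F. f q) \<le> ennreal B'" by (rule ennreal_leI)
    then show "(\<Sum>q\<in>F. ennreal (f q)) \<le> ennreal B'"
      using F assms(1) by (subst sum_ennreal) auto
  qed
  finally show False using assms(2) by (simp add: top_unique)
qed

text \<open>Transfers the variance criterion to Lebesgue measure on \<open>[0, 1)\<close>: the
  hypothesis \<open>overlap\<close> bounds the second terms, and the limsup set obtained lies in
  \<open>W_set\<close>, itself a subset of \<open>[0, 1]\<close>.\<close>

lemma measure_W_set_eq_1:
  fixes \<psi> :: "nat \<Rightarrow> real" and S :: "nat set" and \<gamma> \<beta> \<gamma>' K :: real
  defines "\<delta> \<equiv> \<lambda>q. \<psi> q / dist_nint (real q * \<beta> - \<gamma>')"
  assumes S: "\<And>q. q \<in> S \<Longrightarrow> q \<ge> 1 \<and> 0 < dist_nint (real q * \<beta> - \<gamma>') \<and> 0 < \<delta> q \<and> \<delta> q \<le> 1 / 2"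
    and unbounded: "\<And>B. \<exists>n. B \<le> (\<Sum>q\<in>S \<inter> {..<n}. \<delta> q)"
    and overlap: "\<And>q. q \<in> S \<Longrightarrow>
      (\<Sum>r | r \<in> S \<and> r < q \<and> dist_nint ((real (r div gcd q r) - real (q div gcd q r)) * \<gamma>)
            < real (r div gcd q r) * \<delta> q + real (q div gcd q r) * \<delta> r.
         min (real (gcd q r) / q) (real (gcd q r) * \<delta> r / (r * \<delta> q))) \<le> K"
  shows "measure lebesgue (W_set \<psi> \<beta> \<gamma> \<gamma>') = 1"
proof -
  define A where "A q = (if q \<in> S then {0..<1} \<inter> near_set q \<gamma> (\<delta> q) else {})" for q
  define M where "M = restrict_space lborel {0..<1::real}"
  have spM: "space M = {0..<1}" by (simp add: M_def space_restrict_space)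
  interpret prob_space M
    by (rule prob_spaceI) (simp add: M_def space_restrict_space emeasure_restrict_space)
  have A_sets: "A q \<in> sets borel" for q by (simp add: A_def)
  have A_ev: "A q \<in> events" for q
    unfolding M_def using A_sets[of q] by (auto simp: sets_restrict_space_iff A_def)
  have prob_eq: "prob X = measure lebesgue X" if "X \<in> sets borel" "X \<subseteq> {0..<1}" for X
    unfolding M_def using that by (subst measure_restrict_space) auto
  have pA: "prob (A q) = 2 * \<delta> q" if "q \<in> S" for q
  proof -
    have "prob (A q) = measure lebesgue (A q)" by (rule prob_eq[OF A_sets]) (simp add: A_def)
    also have "\<dots> = measure lebesgue ({0..<1} \<inter> near_set q \<gamma> (\<delta> q))" using that by (simp only: A_def if_True)
    also have "\<dots> = 2 * \<delta> q" using S[OF that] by (intro measure_near_set) auto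
    finally show ?thesis .
  qed
  have pAA: "prob (A q \<inter> A r) = measure lebesgue ({0..<1} \<inter> (near_set q \<gamma> (\<delta> q) \<inter> near_set r \<gamma> (\<delta> r)))"
    if "q \<in> S" "r \<in> S" for q r
  proof -
    have "A q \<inter> A r = {0..<1} \<inter> (near_set q \<gamma> (\<delta> q) \<inter> near_set r \<gamma> (\<delta> r))" using that by (auto simp: A_def)
    then show ?thesis using A_sets[of q] A_sets[of r] by (subst prob_eq) auto
  qed
  define cond where "cond q r \<longleftrightarrow> dist_nint ((real (r div gcd q r) - real (q div gcd q r)) * \<gamma>)
     < real (r div gcd q r) * \<delta> q + real (q div gcd q r) * \<delta> r" for q r
  define w where "w q r = min (real (gcd q r) / q) (real (gcd q r) * \<delta> r / (r * \<delta> q))" for q r :: nat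
  define e where "e q r = (if cond q r then w q r else 0)" for q r
  \<comment> \<open>The two orders of the arguments in \<open>measure_near_set_Int_le\<close> give
    the two entries of the minimum. If \<open>cond\<close> fails the intersection is empty, so
    \<open>e\<close> may vanish there.\<close>
  have off: "prob (A q \<inter> A r) \<le> 4 * \<delta> q * \<delta> r + 2 * \<delta> q * e q r" if qr: "q \<in> S" "r \<in> S" for q r
  proof (cases "cond q r")
    case True
    have d: "0 < \<delta> q" "\<delta> q \<le> 1/2" "0 < \<delta> r" "\<delta> r \<le> 1/2" "q \<ge> 1" "r \<ge> 1" using S qr by auto
    have 1: "prob (A q \<inter> A r) \<le> 4 * \<delta> q * \<delta> r + 2 * \<delta> q * (real (gcd q r) / q)"
      using measure_near_set_Int_le[of q r "\<delta> q" "\<delta> r" \<gamma>] d by (simp add: pAA[OF qr])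
    have 2: "prob (A q \<inter> A r) \<le> 4 * \<delta> q * \<delta> r + 2 * \<delta> q * (real (gcd q r) * \<delta> r / (r * \<delta> q))"
      using measure_near_set_Int_le[of r q "\<delta> r" "\<delta> q" \<gamma>] d
      by (simp add: pAA[OF qr] Int_commute gcd.commute mult_ac)
    show ?thesis using 1 2 True by (auto simp: e_def w_def min_def)
  next
    case False
    have "{0..<1} \<inter> (near_set q \<gamma> (\<delta> q) \<inter> near_set r \<gamma> (\<delta> r)) = {}"
    proof (rule ccontr)
      assume "\<not> ?thesis"
      then obtain x where "x \<in> near_set q \<gamma> (\<delta> q) \<inter> near_set r \<gamma> (\<delta> r)" by auto
      moreover have "q = gcd q r * (q div gcd q r)" "r = gcd q r * (r div gcd q r)" by auto
      moreover have "q div gcd q r > 0" "r div gcd q r > 0"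
        using S[OF qr(1)] S[OF qr(2)] by (auto simp: div_greater_zero_iff intro: dvd_imp_le)
      ultimately have "cond q r" unfolding cond_def by (metis near_set_Int_nonempty)
      with False show False by simp
    qed
    then have "prob (A q \<inter> A r) = 0" by (simp add: pAA[OF qr])
    then show ?thesis using False S[OF qr(1)] S[OF qr(2)] by (simp add: e_def)
  qed
  have esum: "(\<Sum>r\<in>{r\<in>F. r < q}. e q r) \<le> K" if q: "q \<in> S" and F: "F \<subseteq> S" "finite F" for q F
  proof -
    have "(\<Sum>r\<in>{r\<in>F. r < q}. e q r) = (\<Sum>r\<in>{r\<in>{r\<in>F. r < q}. cond q r}. w q r)"
      unfolding e_def using F by (subst sum.inter_filter) auto
    also have "\<dots> \<le> (\<Sum>r | r \<in> S \<and> r < q \<and> cond q r. w q r)"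
    proof (rule sum_mono2)
      show "finite {r. r \<in> S \<and> r < q \<and> cond q r}" by (rule finite_subset[of _ "{..<q}"]) auto
      fix r assume "r \<in> {r. r \<in> S \<and> r < q \<and> cond q r} - {r \<in> {r \<in> F. r < q}. cond q r}"
      then show "0 \<le> w q r" using S[of r] S[OF q] by (auto simp: w_def)
    qed (use F in auto)
    also have "\<dots> \<le> K" using overlap[OF q] by (simp add: cond_def w_def)
    finally show ?thesis .
  qed
  have "prob {x \<in> space M. infinite {q \<in> S. x \<in> A q}} = 1"
  proof (rule prob_infinitely_often_eq_1)
    fix n
    let ?F = "S \<inter> {..<n}"
    have "(\<Sum>q\<in>?F. \<Sum>r\<in>?F. prob (A q \<inter> A r)) \<le> (\<Sum>q\<in>?F. 2 * \<delta> q)\<^sup>2 + (1 + 2 * K) * (\<Sum>q\<in>?F. 2 * \<delta> q)"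
    proof (rule double_sum_le)
      fix q assume q: "q \<in> ?F"
      show "(\<Sum>r\<in>{r\<in>?F. r < q}. e q r) \<le> K" using q by (intro esum) auto
      show "prob (A q \<inter> A q) = 2 * \<delta> q" using pA q by simp
      show "\<delta> q \<ge> 0" using S q by force
    qed (auto simp: Int_commute intro: off)
    moreover have "(\<Sum>q\<in>?F. prob (A q)) = (\<Sum>q\<in>?F. 2 * \<delta> q)" by (intro sum.cong refl pA) auto
    ultimately show "(\<Sum>q\<in>?F. \<Sum>r\<in>?F. prob (A q \<inter> A r)) \<le>
       (\<Sum>q\<in>?F. prob (A q))\<^sup>2 + (1 + 2 * K) * (\<Sum>q\<in>?F. prob (A q))" by simp
  next
    fix B
    obtain n where n: "B / 2 \<le> (\<Sum>q\<in>S \<inter> {..<n}. \<delta> q)" using unbounded by blast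
    have "(\<Sum>q\<in>S \<inter> {..<n}. prob (A q)) = (\<Sum>q\<in>S \<inter> {..<n}. 2 * \<delta> q)" by (intro sum.cong refl pA) auto
    also have "\<dots> = 2 * (\<Sum>q\<in>S \<inter> {..<n}. \<delta> q)" by (rule sum_distrib_left[symmetric])
    finally show "\<exists>n. B \<le> (\<Sum>q\<in>S \<inter> {..<n}. prob (A q))" using n by (intro exI[of _ n]) simp
  qed (rule A_ev)
  moreover define G where "G = {x \<in> space M. infinite {q \<in> S. x \<in> A q}}"
  have G_eq: "G = {0..<1} \<inter> (\<Inter>m. \<Union>q\<in>{q\<in>S. m \<le> q}. A q)"
    unfolding G_def spM by (auto simp: infinite_nat_iff_unbounded_le)
  have G: "G \<in> sets borel" "G \<subseteq> {0..<1}"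
    unfolding G_eq using A_sets by (intro sets.Int sets.countable_INT'' sets.countable_UN') auto
  ultimately have mG: "measure lebesgue G = 1" using prob_eq[OF G] by (simp add: G_def)
  let ?W = "W_set \<psi> \<beta> \<gamma> \<gamma>'"
  have sub: "G \<subseteq> ?W"
  proof
    fix x assume x: "x \<in> G"
    have "{q \<in> S. x \<in> A q} \<subseteq> {q. q \<ge> 1 \<and> dist_nint (real q * x - \<gamma>) * dist_nint (real q * \<beta> - \<gamma>') < \<psi> q}"
    proof
      fix q assume q: "q \<in> {q \<in> S. x \<in> A q}"
      then have "dist_nint (real q * x - \<gamma>) < \<psi> q / dist_nint (real q * \<beta> - \<gamma>')"
        by (auto simp: A_def near_set_def \<delta>_def)
      then show "q \<in> {q. q \<ge> 1 \<and> dist_nint (real q * x - \<gamma>) * dist_nint (real q * \<beta> - \<gamma>') < \<psi> q}"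
        using q S[of q] by (simp add: pos_less_divide_eq)
    qed
    moreover have "infinite {q \<in> S. x \<in> A q}" "0 \<le> x" "x \<le> 1" using x G(2) by (auto simp: G_def)
    ultimately show "x \<in> ?W" unfolding W_set_def using infinite_super by auto
  qed
  have W_eq: "?W = {0..1} \<inter> (\<Inter>m. \<Union>q\<in>{q. 1 \<le> q \<and> m \<le> q}. {x. dist_nint (real q * x - \<gamma>) * dist_nint (real q * \<beta> - \<gamma>') < \<psi> q})"
    unfolding W_set_def by (auto simp: infinite_nat_iff_unbounded_le)
  have W: "?W \<in> sets borel"
    unfolding W_eq by (intro sets.Int sets.countable_INT'' sets.countable_UN') auto
  have W01: "?W \<subseteq> {0..1}" by (auto simp: W_set_def)
  have W_leb: "?W \<in> sets lebesgue" and G_leb: "G \<in> sets lebesgue" using W G(1) by simp_all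
  have "bounded ?W" using W01 by (rule bounded_subset[rotated]) simp
  then have W_fin: "?W \<in> lmeasurable" using W_leb by (rule bounded_set_imp_lmeasurable)
  have "{0..1::real} \<in> lmeasurable" by simp
  then have "measure lebesgue ?W \<le> measure lebesgue {0..1::real}"
    by (rule measure_mono_fmeasurable[OF W01 W_leb])
  moreover have "measure lebesgue G \<le> measure lebesgue ?W"
    by (rule measure_mono_fmeasurable[OF sub G_leb W_fin])
  ultimately show ?thesis using mG by simp
qed

theorem theorem1p10:
  fixes \<psi> :: "nat \<Rightarrow> real" and \<gamma> \<beta> :: real
  assumes "\<forall>q\<ge>1. \<psi> q > 0"
    and "\<exists>C>0. \<forall>q\<ge>3. \<psi> q \<le> C * (1 / (real q * log 2 (real q) * (log 2 (log 2 (real q))) ^ 3))"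
    and "\<gamma> \<notin> \<rat>" and "\<beta> \<notin> \<rat>"
    and "\<exists>C>0. \<forall>q\<ge>5. sigma_exp \<gamma> \<beta> q \<le> ennreal (C * sqrt (log 2 (log 2 (log 2 (real q)))))"
  shows "\<exists>c>0. \<forall>\<gamma>'::real.
    (\<Sum>\<^sub>\<infinity>q\<in>{q::nat. q \<ge> 1 \<and>
          dist_nint (real q * \<beta> - \<gamma>') \<in> {real q powr (- omega_fun c q)..<1}}.
        ennreal (\<psi> q / dist_nint (real q * \<beta> - \<gamma>'))) = \<infinity>
    \<longrightarrow> measure lebesgue (W_set \<psi> \<beta> \<gamma> \<gamma>') = 1"
proof -
  obtain C0 where C0: "C0 > 0"
    "\<And>q. q \<ge> 3 \<Longrightarrow> \<psi> q \<le> C0 * (1 / (real q * log 2 (real q) * (log 2 (log 2 (real q))) ^ 3))"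
    using assms(2) by blast
  obtain C1 where C1: "C1 > 0"
    "\<And>q. q \<ge> 5 \<Longrightarrow> sigma_exp \<gamma> \<beta> q \<le> ennreal (C1 * sqrt (log 2 (log 2 (log 2 (real q)))))"
    using assms(5) by blast
  \<comment> \<open>\<open>overlap_scale\<close> needs \<open>C \<ge> 1\<close>, and
    \<open>C2\<close> is the factor produced by \<open>sigma_exp_diophantine\<close>. With
    \<open>s = C2 * sqrt l\<close> the choice of \<open>c\<close> makes
    \<open>2 * c / sqrt l = 1 / (32 * s)\<close>, so the lower bound for \<open>a\<close> is exactly
    \<open>1 / t\<close>. All constants precede \<open>\<gamma>'\<close>.\<close>
  define C where "C = C0 + 1"
  define C2 where "C2 = C1 + 2"
  define c where "c = 1 / (64 * C2)"
  have C2: "C2 \<ge> 2" using C1 by (simp add: C2_def)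
  obtain K where K: "K > 0"
    "\<And>q::nat. q \<ge> 16 \<Longrightarrow> (\<Sum>d | d dvd q. 1 / real d) \<le> K * (log 2 (log 2 q))^2"
    "\<And>q::nat. q \<ge> 16 \<Longrightarrow> (\<Sum>d | d dvd q. ln (real d) / real d) \<le> K * (log 2 (log 2 q))^3"
    using divisor_sums_loglog_le by blast
  define l where "l q = log 2 (log 2 (log 2 (real q)))" for q :: nat
  define s where "s q = C2 * sqrt (l q)" for q :: nat
  define z where "z q = real q powr (1 / (32 * s q ^ 3))" for q :: nat
  obtain Q where Q: "\<And>q. q \<ge> Q \<Longrightarrow> q \<ge> 16 \<and> 16 \<le> log 2 (real q) \<and> 4 \<le> log 2 (log 2 (real q)) \<and> 2 \<le> l q \<and> 2 \<le> s q \<and>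
      2 \<le> z q \<and> 2 * C \<le> z q \<and> 32 * log 2 (real q) * log 2 (log 2 (real q)) ^ 3 \<le> z q \<and> real (card {d. d dvd q}) \<le> z q"
    using eventually_scale[OF C2, of C] unfolding Let_def eventually_sequentially l_def s_def z_def by blast
  have "c > 0" using C2 by (simp add: c_def)
  moreover have "measure lebesgue (W_set \<psi> \<beta> \<gamma> \<gamma>') = 1"
    if inf: "(\<Sum>\<^sub>\<infinity>q\<in>{q::nat. q \<ge> 1 \<and>
          dist_nint (real q * \<beta> - \<gamma>') \<in> {real q powr (- omega_fun c q)..<1}}.
        ennreal (\<psi> q / dist_nint (real q * \<beta> - \<gamma>'))) = \<infinity>" for \<gamma>' :: real
  proof -
    define a where "a q = dist_nint (real q * \<beta> - \<gamma>')" for q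
    define \<delta> where "\<delta> q = \<psi> q / a q" for q
    define S0 where "S0 = {q::nat. q \<ge> 1 \<and> a q \<in> {real q powr (- omega_fun c q)..<1}}"
    \<comment> \<open>Above \<open>Q\<close> all scale conditions hold; discarding finitely many
      terms preserves the divergence.\<close>
    define S where "S = {q \<in> S0. q \<ge> Q}"
    have a_pos: "0 < a q" if "q \<in> S0" for q
    proof -
      have "0 < real q powr (- omega_fun c q)" using that by (simp add: S0_def)
      also have "\<dots> \<le> a q" using that by (simp add: S0_def)
      finally show ?thesis .
    qed
    have \<delta>_pos: "0 < \<delta> q" if "q \<in> S0" for q
      using that assms(1) a_pos[OF that] by (auto simp: \<delta>_def S0_def)
    have scale: "overlap_scale \<gamma> \<beta> \<gamma>' C (s q) (z q) q \<psi> S" if q: "q \<in> S" for q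
    proof -
      have qQ: "q \<ge> Q" using q by (simp add: S_def)
      have s3: "s q ^ 3 > 0" "s q > 0" using Q[OF qQ] by auto
      have t_eq: "z q powr (s q ^ 2) = real q powr (1 / (32 * s q))"
        unfolding z_def powr_powr using s3 by (simp add: eval_nat_numeral)
      show ?thesis
      proof (unfold_locales)
        show "real q = z q powr (32 * s q ^ 3)"
          unfolding z_def powr_powr using s3 Q[OF qQ] by simp
        fix k1 k2 :: int and M :: real
        assume "(k1, k2) \<noteq> (0, 0)" "2 \<le> M" "M \<le> real q" "of_int \<bar>k1\<bar> \<le> M" "of_int \<bar>k2\<bar> \<le> M"
        then show "M powr (- s q) \<le> dist_nint (of_int k1 * \<gamma> + of_int k2 * \<beta>)"
          unfolding s_def C2_def l_def using C1 Q[OF qQ]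
          by (intro sigma_exp_diophantine[of _ _ q]) (auto simp: l_def)
      next
        fix r assume r: "r \<in> S" "sqrt (real q) \<le> real r" "r \<le> q"
        have "2 * c / sqrt (l q) = 1 / (32 * s q)" by (simp add: c_def s_def mult.assoc)
        then have e: "1 / (z q powr (s q ^ 2)) = real q powr (- (2 * c / sqrt (l q)))"
          by (simp only: t_eq powr_minus_divide)
        have "real q powr (- (2 * c / sqrt (l q))) \<le> real r powr (- omega_fun c r)"
          unfolding l_def using r Q[OF qQ] \<open>c > 0\<close> by (intro powr_omega_fun_ge) (auto simp: l_def)
        moreover have "real r powr (- omega_fun c r) \<le> a r" using r by (simp add: S_def S0_def)
        ultimately show "1 / z q powr (s q ^ 2) \<le> dist_nint (real r * \<beta> - \<gamma>')"
          unfolding e a_def by (rule order.trans)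
      next
        fix r assume r: "r \<in> S"
        then have rQ: "r \<ge> Q" and r0: "r \<in> S0" by (auto simp: S_def)
        show "0 < dist_nint (real r * \<beta> - \<gamma>')" using a_pos[OF r0] by (simp add: a_def)
        show "0 < \<psi> r" using assms(1) r0 by (simp add: S0_def)
        have "\<psi> r \<le> C0 * (1 / (real r * log 2 (real r) * (log 2 (log 2 (real r))) ^ 3))"
          using Q[OF rQ] by (intro C0) auto
        also have "\<dots> \<le> C * (1 / (real r * log 2 (real r) * (log 2 (log 2 (real r))) ^ 3))"
        proof (rule mult_right_mono)
          have "0 < log 2 (real r)" "0 < log 2 (log 2 (real r))" using Q[OF rQ] by linarith+
          then show "0 \<le> 1 / (real r * log 2 (real r) * (log 2 (log 2 (real r))) ^ 3)" by (simp only: divide_nonneg_nonneg mult_nonneg_nonneg zero_le_power less_imp_le of_nat_0_le_iff zero_le_one)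
        qed (simp add: C_def)
        finally show "\<psi> r \<le> C / (real r * log 2 (real r) * (log 2 (log 2 (real r))) ^ 3)" by simp
      qed (use Q[OF qQ] C0 q in \<open>auto simp: C_def S_def S0_def\<close>)
    qed
    show ?thesis
    proof (rule measure_W_set_eq_1[of S])
      fix q assume q: "q \<in> S"
      interpret sc: overlap_scale \<gamma> \<beta> \<gamma>' C "s q" "z q" "z q powr (s q ^ 2)" "log 2 (real q)" "log 2 (log 2 (real q))" q \<psi> S a \<delta>
        using scale[OF q] by (simp_all add: a_def[abs_def] \<delta>_def[abs_def])
      show "q \<ge> 1 \<and> 0 < dist_nint (real q * \<beta> - \<gamma>') \<and> 0 < \<psi> q / dist_nint (real q * \<beta> - \<gamma>') \<and>
          \<psi> q / dist_nint (real q * \<beta> - \<gamma>') \<le> 1 / 2"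
        using sc.\<delta>_q_le_half q a_pos[of q] \<delta>_pos[of q] by (simp add: S_def S0_def \<delta>_def a_def)
      have "(\<Sum>r | r \<in> S \<and> r < q \<and> sc.overlap_cond (gcd q r) (r div gcd q r). sc.overlap_weight r)
          \<le> 8225 + 7 * (1572864 * C + 1) * K"
        using K Q[of q] q by (intro sc.sum_overlap_weight_le) (simp_all add: S_def)
      then show "(\<Sum>r | r \<in> S \<and> r < q \<and> dist_nint ((real (r div gcd q r) - real (q div gcd q r)) * \<gamma>)
            < real (r div gcd q r) * (\<psi> q / dist_nint (real q * \<beta> - \<gamma>')) + real (q div gcd q r) * (\<psi> r / dist_nint (real r * \<beta> - \<gamma>')).
         min (real (gcd q r) / q) (real (gcd q r) * (\<psi> r / dist_nint (real r * \<beta> - \<gamma>')) / (r * (\<psi> q / dist_nint (real q * \<beta> - \<gamma>')))))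
         \<le> 8225 + 7 * (1572864 * C + 1) * K"
        unfolding sc.overlap_cond_def sc.overlap_weight_def by (simp only: dvd_mult_div_cancel gcd_dvd2 \<delta>_def a_def)
    next
      fix B
      have "S = {q \<in> S0. q \<ge> Q}" by (simp add: S_def)
      moreover have "(\<Sum>\<^sub>\<infinity>q\<in>S0. ennreal (\<delta> q)) = \<infinity>" using inf by (simp only: S0_def \<delta>_def a_def)
      ultimately have "\<exists>n. B \<le> (\<Sum>q\<in>S \<inter> {..<n}. \<delta> q)"
        using unbounded_partial_sums[of S0 \<delta> B Q] \<delta>_pos by (simp add: less_imp_le)
      then show "\<exists>n. B \<le> (\<Sum>q\<in>S \<inter> {..<n}. \<psi> q / dist_nint (real q * \<beta> - \<gamma>'))"
        by (simp only: \<delta>_def a_def)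
    qed
  qed
  ultimately show ?thesis by blast
qed

end
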